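(* Let $d\in\mathbb N$, $1\le d_1<d$, $-\infty<\gamma<1$, $\boldsymbol\alpha\in(0,\infty)^d$, $\boldsymbol\beta\in\mathbb R^d$, and let $l,m$ be integers with $0<l\le m$. Then there is a constant $C>0$, independent of $u$, $N_1$, $N_2$, such that for all sufficiently large $N_1,N_2$ and every $u\in\mathcal K^m_{\boldsymbol\alpha,\boldsymbol\beta}(\mathbb R^d)$, $$\inf_{U\in X_{N_1,N_2}}|u-U|_{\mathcal W^l_{\boldsymbol\alpha,\boldsymbol\beta}(\mathbb R^d)}\le C\,|\boldsymbol\alpha|_\infty^{l-m}\left(N_1^{l-m}+N_2^{\frac{1-\gamma}{d-d_1-\gamma}(l-m)}\right)^{\frac12}|u|_{\mathcal K^m_{\boldsymbol\alpha,\boldsymbol\beta}(\mathbb R^d)}.$$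
   Context: $\|\cdot\|$ is the $L^2(\mathbb R^d)$ norm and $\mathbb N_0=\{0,1,2,\dots\}$. $|\boldsymbol\alpha|_\infty=\max_j\alpha_j$. For $\alpha>0$, $\beta\in\mathbb R$, $n\in\mathbb N_0$, the generalized Hermite function is $\mathcal H_n^{\alpha,\beta}(x)=\left(\frac{\alpha}{2^n n!\sqrt\pi}\right)^{1/2}H_n(\alpha(x-\beta))e^{-\frac12\alpha^2(x-\beta)^2}$, where $H_n(x)=(-1)^ne^{x^2}\partial_x^ne^{-x^2}$. For $\mathbf n\in\mathbb N_0^d$, $\mathcal H_{\mathbf n}^{\boldsymbol\alpha,\boldsymbol\beta}(\mathbf x)=\prod_{j=1}^d\mathcal H_{n_j}^{\alpha_j,\beta_j}(x_j)$; these form an orthonormal basis of $L^2(\mathbb R^d)$. Let $\mathcal D_{x_j}=\partial_{x_j}+\alpha_j^2(x_j-\beta_j)$ (weak derivatives) and, for $\mathbf k\in\mathbb N_0^d$, $\mathcal D_{\mathbf x}^{\mathbf k}=\mathcal D_{x_1}^{k_1}\cdots\mathcal D_{x_d}^{k_d}$. For a multi-index $\mathbf k$ (of any length): $|\mathbf k|_\infty=\max_jk_j$, $|\mathbf k|_{\rm mix}=\prod_{j}\max\{1,k_j\}$. Seminorm: $|u|_{\mathcal W^l_{\boldsymbol\alpha,\boldsymbol\beta}(\mathbb R^d)}=\big(\sum_{j=1}^d\|\mathcal D_{x_j}^lu\|^2\big)^{1/2}$. $\mathcal K^m_{\boldsymbol\alpha,\boldsymbol\beta}(\mathbb R^d)=\{u:\mathcal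 D^{\mathbf k}_{\mathbf x}u\in L^2(\mathbb R^d),\ 0\le|\mathbf k|_\infty\le m\}$ with seminorm $|u|_{\mathcal K^m_{\boldsymbol\alpha,\boldsymbol\beta}(\mathbb R^d)}=\big(\sum_{|\mathbf k|_\infty=m}\|\mathcal D_{\mathbf x}^{\mathbf k}u\|^2\big)^{1/2}$. Dimension-adaptive space: write $\mathbf n\in\mathbb N_0^d$ as $(\mathbf n_1,\mathbf n_2)$ with $\mathbf n_1=(n_1,\dots,n_{d_1})$, $\mathbf n_2=(n_{d_1+1},\dots,n_d)$. Then $$X_{N_1,N_2}=\mathrm{span}\{\mathcal H_{\mathbf n}^{\boldsymbol\alpha,\boldsymbol\beta}:\ |\mathbf n_1|_\infty\le N_1,\ |\mathbf n_2|_{\rm mix}|\mathbf n_2|_\infty^{-\gamma}\le N_2^{1-\gamma}\},$$ where the second condition is taken to hold when $\mathbf n_2=\mathbf 0$. The constant $C$ may depend on $d,d_1,l,m,\gamma,\boldsymbol\alpha$. "Sufficiently large" means $N_1,N_2\ge N_0$ for some $N_0$ depending only on the fixed parameters ($d,d_1,l,m,\gamma,\boldsymbol\alpha$), not on $u$. *)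

theory Defs
  imports "HOL-Analysis.Analysis"
begin

text \<open>
  The dimension is \<open>d = CARD('n)\<close>; the linear order on the index type \<open>'n\<close> plays the role of the
  numbering \<open>1, \<dots>, d\<close> of the coordinates. Multi-indices are functions \<open>'n \<Rightarrow> nat\<close>. All functions
  are real-valued, and elements of \<open>L\<^sup>2\<close> are represented by Borel measurable functions.
\<close>

subsection \<open>Multi-indices\<close>

definition first_coords :: "nat \<Rightarrow> 'n::{finite,linorder} set" where
  "first_coords d1 = {j. card {i. i < j} < d1}"

text \<open>The set \<open>J\<close> selects a block of coordinates, so the block itself need not be a separate type.\<close>

definition mi_inf :: "'n set \<Rightarrow> ('n \<Rightarrow> nat) \<Rightarrow> nat" where
  "mi_inf J k = Max (k ` J)"

definition mi_mix :: "'n set \<Rightarrow> ('n \<Rightarrow> nat) \<Rightarrow> nat" where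
  "mi_mix J k = (\<Prod>j\<in>J. max 1 (k j))"


subsection \<open>Generalized Hermite functions\<close>

definition hermite :: "nat \<Rightarrow> real \<Rightarrow> real" where
  "hermite n x = (-1) ^ n * exp (x\<^sup>2) * (deriv ^^ n) (\<lambda>t. exp (- (t\<^sup>2))) x"

definition hermite_fun :: "real \<Rightarrow> real \<Rightarrow> nat \<Rightarrow> real \<Rightarrow> real" where
  "hermite_fun a b n x =
     sqrt (a / (2 ^ n * fact n * sqrt pi)) * hermite n (a * (x - b)) * exp (- (1/2) * a\<^sup>2 * (x - b)\<^sup>2)"

definition hermite_tensor :: "real^'n \<Rightarrow> real^'n \<Rightarrow> ('n::finite \<Rightarrow> nat) \<Rightarrow> real^'n \<Rightarrow> real" where
  "hermite_tensor \<alpha> \<beta> n x = (\<Prod>j\<in>UNIV. hermite_fun (\<alpha> $ j) (\<beta> $ j) (n j) (x $ j))"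


subsection \<open>Weak derivatives\<close>

primrec C_k :: "nat \<Rightarrow> ('a::euclidean_space \<Rightarrow> real) \<Rightarrow> bool" where
  "C_k 0 f \<longleftrightarrow> continuous_on UNIV f"
| "C_k (Suc k) f \<longleftrightarrow>
     f differentiable_on UNIV \<and> (\<forall>b\<in>Basis. C_k k (\<lambda>x. frechet_derivative f (at x) b))"

definition test_function :: "('a::euclidean_space \<Rightarrow> real) \<Rightarrow> bool" where
  "test_function \<phi> \<longleftrightarrow> (\<forall>k. C_k k \<phi>) \<and> compact (closure {x. \<phi> x \<noteq> 0})"

definition locally_integrable :: "('a::euclidean_space \<Rightarrow> real) \<Rightarrow> bool" where
  "locally_integrable f \<longleftrightarrow> (\<forall>K. compact K \<longrightarrow> set_integrable lborel K f)"

text \<open>Weak derivatives are unique only almost everywhere, hence a relation: \<open>v\<close> is a version of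
  \<open>\<partial>u/\<partial>x\<^sub>j\<close>.\<close>

definition weak_partial :: "'n::finite \<Rightarrow> (real^'n \<Rightarrow> real) \<Rightarrow> (real^'n \<Rightarrow> real) \<Rightarrow> bool" where
  "weak_partial j u v \<longleftrightarrow>
     locally_integrable u \<and> locally_integrable v \<and>
     (\<forall>\<phi>. test_function \<phi> \<longrightarrow>
        (LINT x|lborel. u x * frechet_derivative \<phi> (at x) (axis j 1)) = - (LINT x|lborel. v x * \<phi> x))"

text \<open>\<open>w = \<partial>u/\<partial>x\<^sub>j + \<alpha>\<^sub>j\<^sup>2 (x\<^sub>j - \<beta>\<^sub>j) u\<close>, solved for the weak derivative.\<close>

definition herm_deriv ::
    "real^'n \<Rightarrow> real^'n \<Rightarrow> 'n::finite \<Rightarrow> (real^'n \<Rightarrow> real) \<Rightarrow> (real^'n \<Rightarrow> real) \<Rightarrow> bool" where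
  "herm_deriv \<alpha> \<beta> j u w \<longleftrightarrow>
     weak_partial j u (\<lambda>x. w x - (\<alpha> $ j)\<^sup>2 * (x $ j - \<beta> $ j) * u x)"

text \<open>The relation \<open>w = D\<^sub>1\<^bsup>k\<^sub>1\<^esup> \<dots> D\<^sub>d\<^bsup>k\<^sub>d\<^esup> u\<close>; the operator of the last coordinate acts first.\<close>

definition herm_deriv_multi ::
    "real^'n::{finite,linorder} \<Rightarrow> real^'n::{finite,linorder} \<Rightarrow> ('n::{finite,linorder} \<Rightarrow> nat)
      \<Rightarrow> (real^'n::{finite,linorder} \<Rightarrow> real) \<Rightarrow> (real^'n::{finite,linorder} \<Rightarrow> real) \<Rightarrow> bool" where
  "herm_deriv_multi \<alpha> \<beta> k =
     foldr (\<lambda>j R. R OO (herm_deriv \<alpha> \<beta> j ^^ k j)) (sorted_list_of_set UNIV) (=)"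


subsection \<open>Function spaces\<close>

definition L2 :: "('a::euclidean_space \<Rightarrow> real) set" where
  "L2 = {f. f \<in> borel_measurable lborel \<and> integrable lborel (\<lambda>x. (f x)\<^sup>2)}"

definition L2_norm :: "('a::euclidean_space \<Rightarrow> real) \<Rightarrow> real" where
  "L2_norm f = sqrt (LINT x|lborel. (f x)\<^sup>2)"

text \<open>The norm of \<open>D u\<close> for an operator given as a relation \<open>D\<close>. The choice of the version is
  immaterial since versions agree almost everywhere; the value is meaningful only if \<open>D u\<close> exists
  and lies in \<open>L\<^sup>2\<close>.\<close>

definition L2_norm_of ::
    "(('a::euclidean_space \<Rightarrow> real) \<Rightarrow> ('a \<Rightarrow> real) \<Rightarrow> bool) \<Rightarrow> ('a \<Rightarrow> real) \<Rightarrow> real" where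
  "L2_norm_of D u = L2_norm (SOME w. D u w)"

definition W_seminorm :: "real^'n \<Rightarrow> real^'n \<Rightarrow> nat \<Rightarrow> (real^'n::finite \<Rightarrow> real) \<Rightarrow> real" where
  "W_seminorm \<alpha> \<beta> l u = sqrt (\<Sum>j\<in>UNIV. (L2_norm_of (herm_deriv \<alpha> \<beta> j ^^ l) u)\<^sup>2)"

definition K_space ::
    "real^'n::{finite,linorder} \<Rightarrow> real^'n::{finite,linorder} \<Rightarrow> nat
      \<Rightarrow> (real^'n::{finite,linorder} \<Rightarrow> real) set" where
  "K_space \<alpha> \<beta> m =
     {u. \<forall>k. mi_inf UNIV k \<le> m \<longrightarrow> (\<exists>w\<in>L2. herm_deriv_multi \<alpha> \<beta> k u w)}"

definition K_seminorm ::
    "real^'n::{finite,linorder} \<Rightarrow> real^'n::{finite,linorder} \<Rightarrow> nat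
      \<Rightarrow> (real^'n::{finite,linorder} \<Rightarrow> real) \<Rightarrow> real" where
  "K_seminorm \<alpha> \<beta> m u =
     sqrt (\<Sum>k | mi_inf UNIV k = m. (L2_norm_of (herm_deriv_multi \<alpha> \<beta> k) u)\<^sup>2)"


subsection \<open>The dimension-adaptive space\<close>

definition adaptive_index_set ::
    "nat \<Rightarrow> real \<Rightarrow> nat \<Rightarrow> nat \<Rightarrow> ('n::{finite,linorder} \<Rightarrow> nat) set" where
  "adaptive_index_set d1 \<gamma> N1 N2 =
     {n. let J1 = first_coords d1; J2 = - first_coords d1 in
           mi_inf J1 n \<le> N1 \<and>
           ((\<forall>j\<in>J2. n j = 0) \<or>
            real (mi_mix J2 n) * real (mi_inf J2 n) powr (- \<gamma>) \<le> real N2 powr (1 - \<gamma>))}"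

text \<open>The linear span, written out because functions \<open>real^'n \<Rightarrow> real\<close> are no instance of
  \<open>real_vector\<close>.\<close>

definition adaptive_space ::
    "real^'n::{finite,linorder} \<Rightarrow> real^'n::{finite,linorder} \<Rightarrow> nat
      \<Rightarrow> real \<Rightarrow> nat \<Rightarrow> nat
      \<Rightarrow> (real^'n::{finite,linorder} \<Rightarrow> real) set" where
  "adaptive_space \<alpha> \<beta> d1 \<gamma> N1 N2 =
     {U. \<exists>S c. finite S \<and> S \<subseteq> adaptive_index_set d1 \<gamma> N1 N2 \<and>
               U = (\<lambda>x. \<Sum>n\<in>S. c n * hermite_tensor \<alpha> \<beta> n x)}"

end

theory Submission
  imports Defs "HOL-Probability.Probability"
begin

text \<open>
  In the Hermite basis \<open>D\<^sub>j\<close> is a weighted shift, since its adjoint raises the \<open>j\<close>-th index: the coefficient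
  of \<open>D\<^sub>j\<^bsup>l\<^esup> u\<close> at \<open>n\<close> is that of \<open>u\<close> at \<open>n + l e\<^sub>j\<close>, up to a factor of order \<open>n\<^sub>j\<^bsup>l/2\<^esup>\<close>. Let \<open>U\<close> be the
  truncation of the Hermite series of \<open>u\<close> to the adaptive index set. By Parseval the squared error
  is a weighted sum of the squared coefficients of \<open>u\<close> outside that set, and each index \<open>n\<close> there has
  maximal entry \<open>M = n\<^sub>i\<close> exceeding \<open>N\<^sub>1\<close> or \<open>N\<^sub>2\<^bsup>(1-\<gamma>)/(d-d\<^sub>1-\<gamma>)\<^esup>\<close>, as the mixed size of a block of \<open>p\<close> coordinates
  is at most the \<open>p\<close>-th power of its maximum. Its weight is \<open>O(M\<^sup>l)\<close> in the error and at least a multiple of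
  \<open>M\<^sup>m\<close> in \<open>\<parallel>D\<^sub>i\<^sup>m u\<parallel>\<^sup>2\<close>, which yields the factor \<open>M\<^bsup>l-m\<^esup>\<close>. Only the pure derivatives in the \<open>\<K>\<close> seminorm
  are needed.
\<close>

subsection \<open>One-dimensional Hermite functions\<close>

text \<open>Derivatives are relations between representatives, and a chain witnessing
  \<open>herm_deriv_multi\<close> may pass through any locally integrable versions. The coefficient
  formula is proved for functions in L2, so the chains are first rebuilt inside L2 from the almost
  everywhere uniqueness of weak derivatives. The adjoint relation serves twice: for general u it
  gives the coefficients of derivatives, and for u itself a Hermite function it gives orthogonality,
  so that the ground state is the only one whose norm is computed by an integral. In the error
  estimate, the coefficient of D_j^l (u - U) at n stems from an index n' = n + l e_j outside the
  set. It is charged to D_i^m u at n' - m e_i, where i is a maximal coordinate of n' and may differ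
  from j. This requires n'_i >= m, which is what large N_1 and N_2 provide. For fixed i and j the
  charging is injective, so Bessel's inequality bounds the total. The power of the largest alpha_j
  in the claim is balanced by its inverse inside C.\<close>

lemma gaussian_iterated_deriv:
  fixes x :: real
  defines "G \<equiv> \<lambda>n. (deriv ^^ n) (\<lambda>t::real. exp (- (t\<^sup>2)))"
  shows "(G n has_real_derivative (- 2 * x * G n x - 2 * real n * G (n - 1) x)) (at x)"
proof (induction n arbitrary: x rule: less_induct)
  case (less n)
  show ?case
  proof (cases n)
    case 0
    then show ?thesis by (auto simp: G_def intro!: derivative_eq_intros)
  next
    case (Suc m)
    \<comment> \<open>Since \<open>deriv\<close> is total, differentiability has to come from the
      induction hypothesis. The two-term form expresses the next iterate through lower ones already
      known to be differentiable.\<close>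
    have eq: "G (Suc k) = (\<lambda>x. - 2 * x * G k x - 2 * real k * G (k - 1) x)" if "k \<le> m" for k
      using DERIV_imp_deriv[OF less[of k]] that Suc by (auto simp: G_def fun_eq_iff)
    have d: "(G k has_real_derivative G (Suc k) x) (at x)" if "k \<le> m" for k x
      unfolding eq[OF that] using that Suc by (intro less) auto
    \<comment> \<open>For \<open>m = 0\<close> the factor \<open>real m\<close> makes both sides
      vanish, so the truncated index \<open>m - 1\<close> does no harm.\<close>
    have d': "((\<lambda>x. real m * G (m - 1) x) has_real_derivative real m * G m x) (at x)"
      using d[of "m - 1" x, THEN DERIV_cmult, of "real m"] by (cases m) auto
    have "((\<lambda>x. - 2 * x * G m x - 2 * (real m * G (m - 1) x)) has_real_derivative
        (- 2 * G m x - 2 * x * G (Suc m) x - 2 * (real m * G m x))) (at x)"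
      by (rule derivative_eq_intros refl d d' order_refl | simp)+
    then show ?thesis unfolding Suc eq[OF order_refl] by (simp add: algebra_simps)
  qed
qed

lemma hermite_0: "hermite 0 x = 1"
  by (simp add: hermite_def flip: exp_add)

lemma hermite_Suc: "hermite (Suc n) x = 2 * x * hermite n x - 2 * real n * hermite (n - 1) x"
proof -
  have D: "(deriv ^^ Suc n) (\<lambda>t. exp (- (t\<^sup>2))) x =
     - 2 * x * (deriv ^^ n) (\<lambda>t. exp (- (t\<^sup>2))) x - 2 * real n * (deriv ^^ (n - 1)) (\<lambda>t. exp (- (t\<^sup>2))) x"
    using DERIV_imp_deriv[OF gaussian_iterated_deriv[of n x]] by simp
  show ?thesis unfolding hermite_def D by (cases n) (simp_all del: funpow.simps add: algebra_simps)
qed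

text \<open>The term 2 x H_n from differentiating exp (x^2) cancels the -2 x in the recurrence of
  the Gaussian derivatives, leaving the lowered polynomial alone.\<close>

lemma hermite_has_derivative:
  "(hermite n has_real_derivative 2 * real n * hermite (n - 1) x) (at x)"
proof -
  let ?G = "\<lambda>n. (deriv ^^ n) (\<lambda>t::real. exp (- (t\<^sup>2)))"
  have "((\<lambda>x. (-1) ^ n * exp (x\<^sup>2) * ?G n x) has_real_derivative
     ((-1) ^ n * (exp (x\<^sup>2) * (2 * x))) * ?G n x + (- 2 * x * ?G n x - 2 * real n * ?G (n - 1) x) * ((-1) ^ n * exp (x\<^sup>2))) (at x)"
    by (rule derivative_eq_intros refl gaussian_iterated_deriv | simp)+
  moreover have "hermite n = (\<lambda>x. (-1) ^ n * exp (x\<^sup>2) * ?G n x)" by (auto simp: hermite_def)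
  ultimately show ?thesis
    by (cases n) (simp_all add: algebra_simps hermite_def)
qed

lemma hermite_fun_0:
  "hermite_fun a b 0 x = sqrt (a / sqrt pi) * exp (- (1/2) * a\<^sup>2 * (x - b)\<^sup>2)"
  by (simp add: hermite_fun_def hermite_0)

lemma hermite_fun_coeff_Suc:
  "sqrt (a / (2 ^ Suc n * fact (Suc n) * sqrt pi)) * sqrt (2 * (real n + 1)) = sqrt (a / (2 ^ n * fact n * sqrt pi))"
  unfolding real_sqrt_mult[symmetric] by (rule arg_cong[where f = sqrt]) (simp add: divide_simps)

text \<open>Renormalising from n to n - 1 absorbs one square root of 2 n; this is why the factor 2 n
  of the polynomials becomes sqrt (2 n) for the normalised functions.\<close>

lemma hermite_fun_coeff:
  "sqrt (a / (2 ^ n * fact n * sqrt pi)) * (2 * real n) =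
     sqrt (2 * real n) * sqrt (a / (2 ^ (n - 1) * fact (n - 1) * sqrt pi))"
proof (cases n)
  case (Suc m)
  let ?s = "sqrt (2 * (real m + 1))"
  have "2 * real n = ?s * ?s" unfolding Suc by simp
  moreover have "sqrt (2 * real n) = ?s" unfolding Suc by (simp add: add.commute)
  ultimately show ?thesis unfolding Suc diff_Suc_1 hermite_fun_coeff_Suc[of a m, symmetric]
    by (simp only: mult_ac)
qed simp

text \<open>The lowering relation: the Gaussian factor produces exactly the term that D adds back,
  so D maps h_n to a sqrt (2 n) h_(n-1).\<close>

lemma hermite_fun_has_derivative:
  "(hermite_fun a b n has_real_derivative
      a * sqrt (2 * real n) * hermite_fun a b (n - 1) x - a\<^sup>2 * (x - b) * hermite_fun a b n x) (at x)"
proof -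
  let ?c = "sqrt (a / (2 ^ n * fact n * sqrt pi))" and ?e = "\<lambda>x. exp (- (1/2) * a\<^sup>2 * (x - b)\<^sup>2)"
  have h: "((\<lambda>x. hermite n (a * (x - b))) has_real_derivative 2 * real n * hermite (n - 1) (a * (x - b)) * a) (at x)"
    by (rule DERIV_chain2[OF hermite_has_derivative]) (auto intro!: derivative_eq_intros)
  have e: "(?e has_real_derivative - a\<^sup>2 * (x - b) * ?e x) (at x)"
    by (auto intro!: derivative_eq_intros)
  have "((\<lambda>x. ?c * hermite n (a * (x - b)) * ?e x) has_real_derivative
     (?c * (2 * real n * hermite (n - 1) (a * (x - b)) * a)) * ?e x + (- a\<^sup>2 * (x - b) * ?e x) * (?c * hermite n (a * (x - b)))) (at x)"
    by (intro DERIV_mult DERIV_cmult h e)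
  also have "(?c * (2 * real n * hermite (n - 1) (a * (x - b)) * a)) * ?e x + (- a\<^sup>2 * (x - b) * ?e x) * (?c * hermite n (a * (x - b)))
      = a * (?c * (2 * real n)) * hermite (n - 1) (a * (x - b)) * ?e x - a\<^sup>2 * (x - b) * (?c * hermite n (a * (x - b)) * ?e x)"
    by (simp add: algebra_simps)
  finally show ?thesis unfolding hermite_fun_coeff hermite_fun_def[abs_def] by (simp only: mult.assoc)
qed

lemma hermite_fun_Suc:
  "a * sqrt (2 * real (Suc n)) * hermite_fun a b (Suc n) x =
     2 * a\<^sup>2 * (x - b) * hermite_fun a b n x - a * sqrt (2 * real n) * hermite_fun a b (n - 1) x"
proof -
  let ?c = "\<lambda>n. sqrt (a / (2 ^ n * fact n * sqrt pi))" and ?e = "exp (- (1/2) * a\<^sup>2 * (x - b)\<^sup>2)"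
  have "a * sqrt (2 * real (Suc n)) * hermite_fun a b (Suc n) x
      = a * (?c (Suc n) * sqrt (2 * (real n + 1))) * hermite (Suc n) (a * (x - b)) * ?e"
    by (simp add: hermite_fun_def add.commute)
  also have "\<dots> = a * ?c n * (2 * (a * (x - b)) * hermite n (a * (x - b)) - 2 * real n * hermite (n - 1) (a * (x - b))) * ?e"
    unfolding hermite_fun_coeff_Suc hermite_Suc ..
  also have "\<dots> = 2 * a * a * (x - b) * (?c n * hermite n (a * (x - b)) * ?e) - a * (?c n * (2 * real n)) * hermite (n - 1) (a * (x - b)) * ?e"
    by (simp add: algebra_simps)
  finally show ?thesis unfolding hermite_fun_coeff hermite_fun_def by (simp only: mult.assoc power2_eq_square)
qed

text \<open>The raising relation: the formal adjoint -d/dx + a^2 (x - b) of D maps h_n to a multiple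
  of h_(n+1). This form is used when a weak derivative is moved onto a Hermite function.\<close>

lemma hermite_fun_has_derivative':
  "(hermite_fun a b n has_real_derivative
      a\<^sup>2 * (x - b) * hermite_fun a b n x - a * sqrt (2 * real (Suc n)) * hermite_fun a b (Suc n) x) (at x)"
  using hermite_fun_has_derivative[of a b n x] unfolding hermite_fun_Suc
  by (auto elim!: back_subst[where P = "\<lambda>d. (_ has_real_derivative d) _"] simp: algebra_simps)

lemma continuous_hermite_fun: "continuous_on UNIV (hermite_fun a b n)"
  by (meson hermite_fun_has_derivative DERIV_isCont continuous_at_imp_continuous_on)

lemma hermite_fun_measurable[measurable]: "hermite_fun a b n \<in> borel_measurable borel"
  by (intro borel_measurable_continuous_onI continuous_hermite_fun)

text \<open>Quantifying over \<open>t\<close> absorbs all polynomial factors, since \<open>\<bar>y\<bar> \<le> exp \<bar>y\<bar>\<close>.\<close>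

lemma hermite_fun_decay:
  assumes a: "a > 0"
  shows "\<exists>K\<ge>0. \<forall>x. \<bar>hermite_fun a b n x\<bar> * exp (t * \<bar>x - b\<bar>) \<le> K * exp (- (a\<^sup>2 * (x - b)\<^sup>2 / 4))"
proof (induction n arbitrary: t rule: less_induct)
  case (less n)
  show ?case
  proof (cases n)
    case 0
    \<comment> \<open>Completing the square: half of the Gaussian exponent a^2 y^2 / 2 is spent on
      absorbing exp (t y), which leaves a^2 y^2 / 4.\<close>
    have *: "t * y \<le> a\<^sup>2 * y\<^sup>2 / 4 + t\<^sup>2 / a\<^sup>2" for y :: real
    proof -
      have "0 \<le> (a * y / 2 - t / a)\<^sup>2" by simp
      also have "\<dots> = a\<^sup>2 * y\<^sup>2 / 4 + t\<^sup>2 / a\<^sup>2 - t * y" using a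
        by (simp add: power2_diff power_mult_distrib power_divide)
      finally show ?thesis by simp
    qed
    have "exp (- (1/2) * a\<^sup>2 * (x - b)\<^sup>2) * exp (t * \<bar>x - b\<bar>) \<le> exp (t\<^sup>2 / a\<^sup>2) * exp (- (a\<^sup>2 * (x - b)\<^sup>2 / 4))" for x
      using *[of "\<bar>x - b\<bar>"] unfolding exp_add[symmetric] by simp
    then show ?thesis unfolding 0 hermite_fun_0 using a
      by (intro exI[of _ "sqrt (a / sqrt pi) * exp (t\<^sup>2 / a\<^sup>2)"])
         (auto simp: abs_mult mult.assoc intro!: mult_left_mono)
  next
    case (Suc m)
    obtain K1 where K1: "K1 \<ge> 0" "\<And>x. \<bar>hermite_fun a b m x\<bar> * exp ((t + 1) * \<bar>x - b\<bar>) \<le> K1 * exp (- (a\<^sup>2 * (x - b)\<^sup>2 / 4))"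
      using less[of m "t + 1"] Suc by auto
    obtain K2 where K2: "K2 \<ge> 0" "\<And>x. \<bar>hermite_fun a b (m - 1) x\<bar> * exp (t * \<bar>x - b\<bar>) \<le> K2 * exp (- (a\<^sup>2 * (x - b)\<^sup>2 / 4))"
    proof -
      have "m - 1 < n" using Suc by simp
      then show thesis using that less[of "m - 1" t] by blast
    qed
    define c where "c = a * sqrt (2 * real (Suc m))"
    define d where "d = a * sqrt (2 * real m)"
    have c: "c > 0" and d: "d \<ge> 0" unfolding c_def d_def using a by auto
    define K where "K = (2 * a\<^sup>2 * K1 + d * K2) / c"
    have "\<bar>hermite_fun a b n x\<bar> * exp (t * \<bar>x - b\<bar>) \<le> K * exp (- (a\<^sup>2 * (x - b)\<^sup>2 / 4))" for x
    proof -
      let ?y = "\<bar>x - b\<bar>"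
      have "c * hermite_fun a b n x = 2 * a\<^sup>2 * (x - b) * hermite_fun a b m x - d * hermite_fun a b (m - 1) x"
        unfolding Suc c_def d_def by (rule hermite_fun_Suc)
      then have "c * \<bar>hermite_fun a b n x\<bar> \<le> 2 * a\<^sup>2 * ?y * \<bar>hermite_fun a b m x\<bar> + d * \<bar>hermite_fun a b (m - 1) x\<bar>"
        using abs_triangle_ineq4[of "2 * a\<^sup>2 * (x - b) * hermite_fun a b m x" "d * hermite_fun a b (m - 1) x"]
          abs_mult[of c "hermite_fun a b n x"] c d by (simp add: abs_mult)
      also have "\<dots> \<le> 2 * a\<^sup>2 * exp ?y * \<bar>hermite_fun a b m x\<bar> + d * \<bar>hermite_fun a b (m - 1) x\<bar>"
      proof -
        have "?y \<le> exp ?y" using exp_ge_add_one_self[of ?y] by linarith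
        then show ?thesis by (intro add_mono mult_right_mono mult_left_mono order_refl) simp_all
      qed
      finally have "c * \<bar>hermite_fun a b n x\<bar> * exp (t * ?y) \<le> (2 * a\<^sup>2 * exp ?y * \<bar>hermite_fun a b m x\<bar> + d * \<bar>hermite_fun a b (m - 1) x\<bar>) * exp (t * ?y)"
        by (intro mult_right_mono) auto
      also have "\<dots> = 2 * a\<^sup>2 * (\<bar>hermite_fun a b m x\<bar> * exp ((t + 1) * ?y)) + d * (\<bar>hermite_fun a b (m - 1) x\<bar> * exp (t * ?y))"
        by (simp add: algebra_simps exp_add)
      also have "\<dots> \<le> 2 * a\<^sup>2 * (K1 * exp (- (a\<^sup>2 * (x - b)\<^sup>2 / 4))) + d * (K2 * exp (- (a\<^sup>2 * (x - b)\<^sup>2 / 4)))"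
        using K1 K2 d by (intro add_mono mult_left_mono) auto
      finally show ?thesis using c unfolding K_def by (simp add: field_simps)
    qed
    moreover have "K \<ge> 0" unfolding K_def using c d K1 K2 by auto
    ultimately show ?thesis by blast
  qed
qed

lemma gaussian_integrable:
  fixes c b :: real assumes c: "c > 0"
  shows "integrable lborel (\<lambda>x. exp (- (c * (x - b)\<^sup>2)))"
    and "(LBINT x. exp (- (c * (x - b)\<^sup>2))) = sqrt (pi / c)"
proof -
  define s where "s = 1 / sqrt (2 * c)"
  have s: "s > 0" "s\<^sup>2 = 1 / (2 * c)" using c by (auto simp: s_def power_divide)
  have eq: "exp (- (c * (x - b)\<^sup>2)) = sqrt (pi / c) * normal_density b s x" for x
    unfolding normal_density_def s using c by (simp add: real_sqrt_divide)
  show "integrable lborel (\<lambda>x. exp (- (c * (x - b)\<^sup>2)))"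
    unfolding eq using s by (intro integrable_mult_right integrable_normal_density)
  show "(LBINT x. exp (- (c * (x - b)\<^sup>2))) = sqrt (pi / c)"
    unfolding eq using s by simp
qed

text \<open>\<open>t = 0\<close> gives membership in L2; general \<open>t\<close> supplies the
  exponential moments for completeness.\<close>

lemma hermite_fun_exp_square_integrable:
  assumes a: "a > 0"
  shows "integrable lborel (\<lambda>x. (hermite_fun a b n x * exp (t * \<bar>x - b\<bar>))\<^sup>2)"
proof -
  obtain K where K: "K \<ge> 0" "\<And>x. \<bar>hermite_fun a b n x\<bar> * exp (t * \<bar>x - b\<bar>) \<le> K * exp (- (a\<^sup>2 * (x - b)\<^sup>2 / 4))"
    using hermite_fun_decay[OF a] by blast
  have "(hermite_fun a b n x * exp (t * \<bar>x - b\<bar>))\<^sup>2 \<le> K\<^sup>2 * exp (- (a\<^sup>2 / 2 * (x - b)\<^sup>2))" for x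
  proof -
    have "(hermite_fun a b n x * exp (t * \<bar>x - b\<bar>))\<^sup>2 = (\<bar>hermite_fun a b n x\<bar> * exp (t * \<bar>x - b\<bar>))\<^sup>2"
      by (simp add: power_mult_distrib)
    also have "\<dots> \<le> (K * exp (- (a\<^sup>2 * (x - b)\<^sup>2 / 4)))\<^sup>2"
      by (intro power_mono K) auto
    also have "\<dots> = K\<^sup>2 * exp (- (a\<^sup>2 / 2 * (x - b)\<^sup>2))"
      by (simp add: power_mult_distrib flip: exp_double)
    finally show ?thesis .
  qed
  then have "AE x in lborel. norm ((hermite_fun a b n x * exp (t * \<bar>x - b\<bar>))\<^sup>2) \<le> norm (K\<^sup>2 * exp (- (a\<^sup>2 / 2 * (x - b)\<^sup>2)))"
    by simp
  moreover have "(\<lambda>x. (hermite_fun a b n x * exp (t * \<bar>x - b\<bar>))\<^sup>2) \<in> borel_measurable lborel"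
    by simp
  moreover have "integrable lborel (\<lambda>x. K\<^sup>2 * exp (- (a\<^sup>2 / 2 * (x - b)\<^sup>2)))"
    using a by (intro integrable_mult_right gaussian_integrable) auto
  ultimately show ?thesis
    using Bochner_Integration.integrable_bound by blast
qed

lemma hermite_fun_0_norm:
  assumes a: "a > 0"
  shows "(LBINT x. (hermite_fun a b 0 x)\<^sup>2) = 1"
proof -
  have "(hermite_fun a b 0 x)\<^sup>2 = (a / sqrt pi) * exp (- (a\<^sup>2 * (x - b)\<^sup>2))" for x
    using a by (simp add: hermite_fun_0 power_mult_distrib flip: exp_double)
  then show ?thesis using gaussian_integrable(2)[of "a\<^sup>2" b] a by (simp add: real_sqrt_divide)
qed

subsection \<open>Smooth functions and bumps\<close>

text \<open>One-dimensional counterpart of \<open>C_k\<close>. Quantifying the derivative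
  existentially lets the closure properties follow from the differentiation rules without evaluating
  \<open>deriv\<close>.\<close>

primrec smooth_upto :: "nat \<Rightarrow> (real \<Rightarrow> real) \<Rightarrow> bool" where
  "smooth_upto 0 f \<longleftrightarrow> continuous_on UNIV f"
| "smooth_upto (Suc k) f \<longleftrightarrow> (\<exists>f'. (\<forall>x. (f has_real_derivative f' x) (at x)) \<and> smooth_upto k f')"

definition smooth :: "(real \<Rightarrow> real) \<Rightarrow> bool" where
  "smooth f \<longleftrightarrow> (\<forall>k. smooth_upto k f)"

lemma smooth_upto_continuous: "smooth_upto k f \<Longrightarrow> continuous_on UNIV f"
  by (cases k) (auto intro!: continuous_at_imp_continuous_on intro: DERIV_isCont)

lemma smooth_upto_Suc_D: "smooth_upto (Suc k) f \<Longrightarrow> smooth_upto k f"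
proof (induction k arbitrary: f)
  case 0
  then show ?case using smooth_upto_continuous[of "Suc 0" f] by simp
next
  case (Suc k)
  then show ?case by (metis smooth_upto.simps(2))
qed

lemma smooth_upto_add: "smooth_upto k f \<Longrightarrow> smooth_upto k g \<Longrightarrow> smooth_upto k (\<lambda>x. f x + g x)"
proof (induction k arbitrary: f g)
  case 0
  then show ?case by (auto intro!: continuous_on_add continuous_on_mult continuous_on_exp)
next
  case (Suc k)
  then obtain f' g' where "\<forall>x. (f has_real_derivative f' x) (at x)" "smooth_upto k f'"
    "\<forall>x. (g has_real_derivative g' x) (at x)" "smooth_upto k g'" by auto
  then show ?case using Suc.IH[of f' g']
    by (auto intro!: exI[of _ "\<lambda>x. f' x + g' x"] derivative_eq_intros)
qed

lemma smooth_upto_mult: "smooth_upto k f \<Longrightarrow> smooth_upto k g \<Longrightarrow> smooth_upto k (\<lambda>x. f x * g x)"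
proof (induction k arbitrary: f g)
  case 0
  then show ?case by (auto intro!: continuous_on_add continuous_on_mult continuous_on_exp)
next
  case (Suc k)
  note sm = smooth_upto_Suc_D[OF Suc.prems(1)] smooth_upto_Suc_D[OF Suc.prems(2)]
  from Suc obtain f' g' where *: "\<And>x. (f has_real_derivative f' x) (at x)" "smooth_upto k f'"
    "\<And>x. (g has_real_derivative g' x) (at x)" "smooth_upto k g'" by auto
  have "smooth_upto k (\<lambda>x. f' x * g x + g' x * f x)"
    using sm * by (intro smooth_upto_add Suc.IH)
  with DERIV_mult[OF *(1,3)] show ?case by (auto intro!: exI[of _ "\<lambda>x. f' x * g x + g' x * f x"])
qed

lemma smooth_upto_const: "smooth_upto k (\<lambda>x. c)"
  by (induction k arbitrary: c) (auto intro!: exI[of _ "\<lambda>x. 0"])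

lemma smooth_upto_affine: "smooth_upto k f \<Longrightarrow> smooth_upto k (\<lambda>x. f (a * x + b))"
proof (induction k arbitrary: f)
  case 0
  then show ?case by (auto intro!: continuous_on_compose2[of UNIV f] continuous_on_add continuous_on_mult)
next
  case (Suc k)
  then obtain f' where *: "\<And>x. (f has_real_derivative f' x) (at x)" "smooth_upto k f'" by auto
  have "smooth_upto k (\<lambda>x. f' (a * x + b) * a)"
    by (rule smooth_upto_mult[OF Suc.IH[OF *(2)] smooth_upto_const])
  moreover have "((\<lambda>x. f (a * x + b)) has_real_derivative f' (a * x + b) * a) (at x)" for x
    by (rule DERIV_chain2[OF *(1)]) (auto intro!: derivative_eq_intros)
  ultimately show ?case by (auto intro!: exI[of _ "\<lambda>x. f' (a * x + b) * a"])
qed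

lemma smooth_upto_exp: "smooth_upto k f \<Longrightarrow> smooth_upto k (\<lambda>x. exp (f x))"
proof (induction k arbitrary: f)
  case 0
  then show ?case by (auto intro!: continuous_on_add continuous_on_mult continuous_on_exp)
next
  case (Suc k)
  note sm = smooth_upto_Suc_D[OF Suc.prems]
  from Suc obtain f' where *: "\<And>x. (f has_real_derivative f' x) (at x)" "smooth_upto k f'" by auto
  have "smooth_upto k (\<lambda>x. exp (f x) * f' x)"
    using sm * by (intro smooth_upto_mult Suc.IH)
  with DERIV_fun_exp[OF *(1)] show ?case by (auto intro!: exI[of _ "\<lambda>x. exp (f x) * f' x"])
qed

lemma smooth_derivE:
  assumes "smooth f"
  obtains f' where "\<And>x. (f has_real_derivative f' x) (at x)" "smooth f'"
proof -
  have "\<exists>f'. (\<forall>x. (f has_real_derivative f' x) (at x)) \<and> smooth_upto k f'" for k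
    using assms unfolding smooth_def by (metis smooth_upto.simps(2))
  then obtain F where F: "\<And>k x. (f has_real_derivative F k x) (at x)" "\<And>k. smooth_upto k (F k)" by metis
  \<comment> \<open>The derivative chosen for order \<open>k\<close> might depend on
    \<open>k\<close>; uniqueness of derivatives makes it a single function.\<close>
  have "F k = F 0" for k using F(1) DERIV_unique by blast
  then show thesis using that[of "F 0"] F unfolding smooth_def by metis
qed

lemma smoothI_closed:
  assumes "f \<in> F" and "\<And>g. g \<in> F \<Longrightarrow> \<exists>g'\<in>F. \<forall>x. (g has_real_derivative g' x) (at x)"
  shows "smooth f"
proof -
  have "g \<in> F \<Longrightarrow> smooth_upto k g" for k g
  proof (induction k arbitrary: g)
    case 0
    then show ?case using assms(2) by (auto intro!: continuous_at_imp_continuous_on intro: DERIV_isCont)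
  next
    case (Suc k)
    then show ?case using assms(2)[of g] by auto
  qed
  with assms show ?thesis by (auto simp: smooth_def)
qed

lemma smooth_intros:
  "smooth (\<lambda>x. c)"
  "smooth f \<Longrightarrow> smooth g \<Longrightarrow> smooth (\<lambda>x. f x + g x)"
  "smooth f \<Longrightarrow> smooth g \<Longrightarrow> smooth (\<lambda>x. f x * g x)"
  "smooth f \<Longrightarrow> smooth (\<lambda>x. f (a * x + b))"
  "smooth f \<Longrightarrow> smooth (\<lambda>x. exp (f x))"
  by (auto simp: smooth_def smooth_upto_const smooth_upto_add smooth_upto_mult smooth_upto_affine smooth_upto_exp)

lemma smooth_continuous: "smooth f \<Longrightarrow> continuous_on UNIV f"
  using smooth_upto_continuous by (auto simp: smooth_def)

text \<open>The classical flat function exp (-1/x), with a polynomial in 1/x as parameter so that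
  the family is closed under differentiation.\<close>

definition flat_exp :: "real poly \<Rightarrow> real \<Rightarrow> real" where
  "flat_exp p x = (if x > 0 then poly p (1 / x) * exp (- (1 / x)) else 0)"

text \<open>With y = 1/x one has y' = -y^2, so p(y) exp (-y) has derivative y^2 (p - p')(y) exp
  (-y), and \<open>[:0, 0, 1:]\<close> is the monomial y^2. At 0 the difference quotient from the
  right is again a polynomial in y times exp (-y), with y tending to infinity.\<close>

lemma flat_exp_has_derivative:
  "(flat_exp p has_real_derivative flat_exp ([:0, 0, 1:] * (p - pderiv p)) x) (at x)"
proof -
  let ?q = "[:0, 0, 1:] * (p - pderiv p)"
  consider "x > 0" | "x < 0" | "x = 0" by linarith
  then show ?thesis
  proof cases
    case 1
    have "((\<lambda>x. poly p (1 / x) * exp (- (1 / x))) has_real_derivative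
       (poly (pderiv p) (1 / x) * (- 1 / x\<^sup>2)) * exp (- (1 / x)) + (exp (- (1 / x)) * (1 / x\<^sup>2)) * poly p (1 / x)) (at x)"
      using 1 by (intro DERIV_mult DERIV_chain2[OF poly_DERIV] DERIV_chain2[OF DERIV_exp])
        (auto intro!: derivative_eq_intros simp: power2_eq_square)
    moreover have "\<forall>\<^sub>F y in nhds x. flat_exp p y = poly p (1 / y) * exp (- (1 / y))"
      using eventually_nhds_in_open[of "{0<..}" x] 1 
      by (auto simp: flat_exp_def elim!: eventually_mono)
    ultimately show ?thesis using 1
      by (subst DERIV_cong_ev[OF refl _ refl])
         (auto elim!: back_subst[where P = "\<lambda>d. (_ has_real_derivative d) _"]
            simp: flat_exp_def algebra_simps power2_eq_square)
  next
    case 2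
    have "\<forall>\<^sub>F y in nhds x. flat_exp p y = 0"
      using eventually_nhds_in_open[of "{..<0}" x] 2 by (auto simp: flat_exp_def elim!: eventually_mono)
    then show ?thesis using 2
      by (subst DERIV_cong_ev[OF refl _ refl, where g = "\<lambda>_. 0"]) (auto simp: flat_exp_def)
  next
    case 3
    have lim: "((\<lambda>y. poly r y * exp (- y)) \<longlongrightarrow> 0) at_top" for r :: "real poly"
    proof -
      have "((\<lambda>y. \<Sum>i\<le>degree r. coeff r i * (y ^ i / exp y)) \<longlongrightarrow> (\<Sum>i\<le>degree r. coeff r i * 0)) at_top"
        by (intro tendsto_intros tendsto_power_div_exp_0)
      then show ?thesis by (simp add: poly_altdef exp_minus divide_inverse sum_distrib_right mult.assoc)
    qed
    have "((\<lambda>y. poly ([:0, 1:] * p) (1 / y) * exp (- (1 / y))) \<longlongrightarrow> 0) (at_right 0)"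
      by (rule filterlim_compose[OF lim]) (use filterlim_inverse_at_top_right in \<open>simp add: inverse_eq_divide\<close>)
    then have "((\<lambda>y. flat_exp p y / y) \<longlongrightarrow> 0) (at_right 0)"
      by (rule Lim_transform_eventually) (auto simp: eventually_at_filter flat_exp_def)
    moreover have "((\<lambda>y. flat_exp p y / y) \<longlongrightarrow> 0) (at_left 0)"
      by (rule tendsto_eventually) (auto simp: eventually_at_filter flat_exp_def)
    ultimately have "((\<lambda>y. flat_exp p y / y) \<longlongrightarrow> 0) (at 0)"
      by (simp add: filterlim_split_at)
    then show ?thesis unfolding 3 has_field_derivative_iff by (simp add: flat_exp_def)
  qed
qed

lemma smooth_flat_exp: "smooth (flat_exp p)"
  by (rule smoothI_closed[of _ "range flat_exp"]) (use flat_exp_has_derivative in blast)+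

definition bump :: "real \<Rightarrow> real \<Rightarrow> real \<Rightarrow> real" where
  "bump a b x = flat_exp 1 (x - a) * flat_exp 1 (b - x)"

lemma smooth_bump: "smooth (bump a b)"
proof -
  have "smooth (\<lambda>x. flat_exp 1 (1 * x + (- a)) * flat_exp 1 ((-1) * x + b))"
    by (intro smooth_intros smooth_flat_exp)
  then show ?thesis by (simp add: bump_def[abs_def])
qed

lemma bump_pos: "a < x \<Longrightarrow> x < b \<Longrightarrow> bump a b x > 0"
  and bump_eq_0: "\<not> (a < x \<and> x < b) \<Longrightarrow> bump a b x = 0"
  and bump_nonneg: "bump a b x \<ge> 0"
  by (auto simp: bump_def flat_exp_def)

subsection \<open>Tensor products\<close>

text \<open>One factor per coordinate, all independent: a partial derivative is then again a tensor
  with one factor replaced, which closes inductions over the order of differentiation.\<close>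

definition tensor :: "('n::finite \<Rightarrow> real \<Rightarrow> real) \<Rightarrow> real^'n \<Rightarrow> real" where
  "tensor g x = (\<Prod>j\<in>UNIV. g j (x $ j))"

lemma tensor_upd: "tensor (g(i := h)) x = h (x $ i) * (\<Prod>j\<in>UNIV - {i}. g j (x $ j))"
  unfolding tensor_def by (subst prod.remove[of _ i]) (auto intro!: prod.cong)

lemma tensor_remove: "tensor g x = g i (x $ i) * (\<Prod>j\<in>UNIV - {i}. g j (x $ j))"
  unfolding tensor_def by (subst prod.remove[of _ i]) auto

lemma tensor_has_derivative:
  assumes "\<And>j x. (g j has_real_derivative g' j x) (at x)"
  shows "(tensor g has_derivative (\<lambda>h. \<Sum>i\<in>UNIV. h $ i * tensor (g(i := g' i)) x)) (at x)"
proof -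
  have "((\<lambda>x. g j (x $ j)) has_derivative (\<lambda>h. g' j (x $ j) * h $ j)) (at x)" for j
    using has_derivative_compose[OF bounded_linear.has_derivative[OF bounded_linear_vec_nth has_derivative_ident]
        assms[of j "x $ j", unfolded has_field_derivative_def]] by (simp add: o_def)
  then have "((\<lambda>x. \<Prod>j\<in>UNIV. g j (x $ j)) has_derivative
       (\<lambda>h. \<Sum>i\<in>UNIV. (g' i (x $ i) * h $ i) * (\<Prod>j\<in>UNIV - {i}. g j (x $ j)))) (at x)"
    by (rule has_derivative_prod)
  moreover have "tensor g = (\<lambda>x. \<Prod>j\<in>UNIV. g j (x $ j))" by (simp add: tensor_def fun_eq_iff)
  ultimately show ?thesis by (simp add: tensor_upd mult_ac)
qed

lemma tensor_frechet:
  assumes "\<And>j x. (g j has_real_derivative g' j x) (at x)"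
  shows "frechet_derivative (tensor g) (at x) (axis i 1) = tensor (g(i := g' i)) x"
proof -
  have "frechet_derivative (tensor g) (at x) = (\<lambda>h. \<Sum>i\<in>UNIV. h $ i * tensor (g(i := g' i)) x)"
    using frechet_derivative_at[OF tensor_has_derivative[of g g' x]] assms by simp
  then show ?thesis by (simp add: axis_def if_distrib[of "\<lambda>c. c * _"] cong: if_cong)
qed

lemma continuous_tensor:
  assumes "\<And>j. continuous_on UNIV (g j)"
  shows "continuous_on UNIV (tensor g)"
  unfolding tensor_def[abs_def]
  by (intro continuous_on_prod continuous_on_compose2[OF assms] continuous_intros) auto

lemma C_k_tensor:
  assumes "\<And>j. smooth (g j)"
  shows "C_k k (tensor g)"
  using assms
proof (induction k arbitrary: g)
  case 0
  then show ?case by (auto intro!: continuous_tensor smooth_continuous)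
next
  case (Suc k)
  have "\<forall>j. \<exists>g'. (\<forall>x. (g j has_real_derivative g' x) (at x)) \<and> smooth g'"
    using smooth_derivE[OF Suc.prems] by metis
  then obtain g' where g': "\<And>j x. (g j has_real_derivative g' j x) (at x)" "\<And>j. smooth (g' j)" by metis
  have "tensor g differentiable_on UNIV"
    unfolding differentiable_on_def differentiable_def using tensor_has_derivative[of g g', OF g'(1)] by blast
  moreover have "C_k k (\<lambda>x. frechet_derivative (tensor g) (at x) b)" if b: "b \<in> Basis" for b
  proof -
    obtain i where "b = axis i 1" using b by (auto simp: Basis_vec_def)
    then show ?thesis using tensor_frechet[of g g', OF g'(1)] Suc.IH[of "g(i := g' i)"] Suc.prems g'(2) by (simp add: fun_upd_def)
  qed
  ultimately show ?case by simp
qed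

lemma test_function_tensor:
  assumes "\<And>j. smooth (g j)" and "\<And>j x. \<bar>x\<bar> > R \<Longrightarrow> g j x = 0"
  shows "test_function (tensor g)"
proof -
  have "{x. tensor g x \<noteq> 0} \<subseteq> cbox (\<chi> i. - R) (\<chi> i. R)"
  proof
    fix x assume "x \<in> {x. tensor g x \<noteq> 0}"
    then have "g j (x $ j) \<noteq> 0" for j by (auto simp: tensor_def)
    then have "\<bar>x $ j\<bar> \<le> R" for j using assms(2) by (meson not_le)
    then show "x \<in> cbox (\<chi> i. - R) (\<chi> i. R)" by (auto simp: mem_box_cart abs_le_iff minus_le_iff)
  qed
  then have "bounded {x. tensor g x \<noteq> 0}" using bounded_cbox bounded_subset by blast
  then show ?thesis using C_k_tensor assms by (auto simp: test_function_def)
qed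

lemma vec_nth_measurable[measurable]: "(\<lambda>x::real^'n::finite. x $ j) \<in> borel_measurable borel"
  by (intro borel_measurable_continuous_onI continuous_intros)

lemma tensor_measurable[measurable]:
  fixes g :: "'n::finite \<Rightarrow> real \<Rightarrow> real"
  assumes "\<And>j. g j \<in> borel_measurable borel"
  shows "tensor g \<in> borel_measurable borel"
proof -
  have "(\<lambda>x. g j (x $ j)) \<in> borel_measurable borel" for j
    by (rule measurable_compose[OF vec_nth_measurable assms])
  then show ?thesis unfolding tensor_def[abs_def] by (rule borel_measurable_prod)
qed

lemma nn_integral_tensor:
  fixes g :: "'n::finite \<Rightarrow> real \<Rightarrow> real"
  assumes [measurable]: "\<And>j. g j \<in> borel_measurable borel" and nn: "\<And>j x. g j x \<ge> 0"
  shows "(\<integral>\<^sup>+x. ennreal (tensor g x) \<partial>lborel) = (\<Prod>j\<in>UNIV. \<integral>\<^sup>+x. ennreal (g j x) \<partial>lborel)"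
proof -
  have inj: "inj (\<lambda>j::'n. axis j (1::real))" by (auto simp: inj_on_def axis_eq_axis)
  have B: "(Basis :: (real^'n) set) = range (\<lambda>j. axis j 1)" by (auto simp: Basis_vec_def)
  \<comment> \<open>The product formula for \<open>lborel\<close> indexes factors by basis vectors;
    \<open>f\<close> transports \<open>g\<close> along the bijection from coordinates to basis
    vectors.\<close>
  define f where "f b = g (the_inv (\<lambda>j. axis j (1::real)) b)" for b :: "real^'n"
  have f: "f (axis j 1) = g j" for j unfolding f_def by (simp add: the_inv_f_f[OF inj])
  have "(\<integral>\<^sup>+x. (\<Prod>b\<in>Basis. ennreal (f b (x \<bullet> b))) \<partial>lborel) = (\<Prod>b\<in>(Basis :: (real^'n) set). (\<integral>\<^sup>+x. ennreal (f b x) \<partial>lborel))"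
    by (rule nn_integral_lborel_prod) (auto simp: f_def)
  then show ?thesis unfolding B prod.reindex[OF inj] using nn
    by (simp add: f o_def inner_axis tensor_def prod_ennreal)
qed

lemma tensor_square: "(tensor g x)\<^sup>2 = tensor (\<lambda>j x. (g j x)\<^sup>2) x"
  by (simp add: tensor_def prod_power_distrib)

lemma tensor_abs: "\<bar>tensor g x\<bar> = tensor (\<lambda>j x. \<bar>g j x\<bar>) x"
  by (simp add: tensor_def abs_prod)

lemma tensor_mono: "(\<And>j x. 0 \<le> f j x) \<Longrightarrow> (\<And>j x. f j x \<le> g j x) \<Longrightarrow> tensor f x \<le> tensor g x"
  unfolding tensor_def by (auto intro!: prod_mono)

lemma tensor_L2:
  assumes [measurable]: "\<And>j. g j \<in> borel_measurable borel"
    and int: "\<And>j. integrable lborel (\<lambda>x. (g j x)\<^sup>2)"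
  shows "tensor g \<in> L2"
    and "(LBINT x. (tensor g x)\<^sup>2) = (\<Prod>j\<in>UNIV. LBINT x. (g j x)\<^sup>2)"
proof -
  have eq: "(\<integral>\<^sup>+x. ennreal ((tensor g x)\<^sup>2) \<partial>lborel) = ennreal (\<Prod>j\<in>UNIV. LBINT x. (g j x)\<^sup>2)"
    unfolding tensor_square 
    by (subst nn_integral_tensor) (auto simp: nn_integral_eq_integral[OF int] prod_ennreal)
  have m: "tensor g \<in> borel_measurable lborel" by simp
  have i: "integrable lborel (\<lambda>x. (tensor g x)\<^sup>2)"
    by (rule integrableI_nn_integral_finite[OF _ _ eq]) (auto intro!: borel_measurable_power m prod_nonneg)
  show "tensor g \<in> L2" unfolding L2_def using m i by auto
  show "(LBINT x. (tensor g x)\<^sup>2) = (\<Prod>j\<in>UNIV. LBINT x. (g j x)\<^sup>2)"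
  proof -
    have "(LBINT x. (tensor g x)\<^sup>2) = enn2real (\<integral>\<^sup>+x. ennreal ((tensor g x)\<^sup>2) \<partial>lborel)"
      using m by (intro integral_eq_nn_integral) auto
    also have "\<dots> = (\<Prod>j\<in>UNIV. LBINT x. (g j x)\<^sup>2)"
      unfolding eq by (intro enn2real_ennreal prod_nonneg ballI integral_nonneg) simp_all
    finally show ?thesis .
  qed
qed

subsection \<open>Uniqueness of weak derivatives\<close>

text \<open>The measures with densities v^+ and v^- agree on open boxes. These form an
  intersection-stable generator with a finite exhausting sequence, so the measures agree, hence the
  densities do almost everywhere. As v^+ and v^- are never both positive, they vanish.\<close>

lemma AE_zero_if_box_integrals_zero:
  fixes v :: "'a::euclidean_space \<Rightarrow> real"
  assumes [measurable]: "v \<in> borel_measurable borel"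
    and int: "\<And>a b. integrable lborel (\<lambda>x. v x * indicator (box a b) x)"
    and zero: "\<And>a b. (LBINT x. v x * indicator (box a b) x) = 0"
  shows "AE x in lborel. v x = 0"
proof -
  define P where "P = (\<lambda>x. max 0 (v x))"
  define N where "N = (\<lambda>x. max 0 (- v x))"
  have [measurable]: "P \<in> borel_measurable borel" "N \<in> borel_measurable borel"
    unfolding P_def N_def by measurable
  have Pint: "integrable lborel (\<lambda>x. P x * indicator (box a b) x)" for a b
    by (rule Bochner_Integration.integrable_bound[OF int[of a b]]) (auto simp: P_def indicator_def)
  have Nint: "integrable lborel (\<lambda>x. N x * indicator (box a b) x)" for a b
    by (rule Bochner_Integration.integrable_bound[OF int[of a b]]) (auto simp: N_def indicator_def)
  have em: "emeasure (density lborel (\<lambda>x. ennreal (f x))) (box a b) = ennreal (LBINT x. f x * indicator (box a b) x)"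
    if [measurable]: "f \<in> borel_measurable borel" and i: "integrable lborel (\<lambda>x. f x * indicator (box a b) x)" and nn: "\<And>x. 0 \<le> f x" for f a b
  proof -
    have "emeasure (density lborel (\<lambda>x. ennreal (f x))) (box a b) = (\<integral>\<^sup>+x. ennreal (f x * indicator (box a b) x) \<partial>lborel)"
      by (subst emeasure_density) (auto intro!: nn_integral_cong simp: indicator_def)
    also have "\<dots> = ennreal (LBINT x. f x * indicator (box a b) x)"
      using i nn by (intro nn_integral_eq_integral) auto
    finally show ?thesis .
  qed
  have PN: "(LBINT x. P x * indicator (box a b) x) = (LBINT x. N x * indicator (box a b) x)" for a b
  proof -
    have "(LBINT x. P x * indicator (box a b) x) - (LBINT x. N x * indicator (box a b) x)
      = (LBINT x. P x * indicator (box a b) x - N x * indicator (box a b) x)"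
      using Pint Nint by (rule Bochner_Integration.integral_diff[symmetric])
    also have "\<dots> = (LBINT x. v x * indicator (box a b) x)"
    proof -
      have "P x - N x = v x" for x by (simp add: P_def N_def)
      then show ?thesis by (simp flip: left_diff_distrib)
    qed
    also have "\<dots> = 0" by (rule zero)
    finally show ?thesis by (simp only: right_minus_eq)
  qed
  have P0: "0 \<le> P x" and N0: "0 \<le> N x" for x by (auto simp: P_def N_def)
  have "density lborel (\<lambda>x. ennreal (P x)) = density lborel (\<lambda>x. ennreal (N x))"
  proof (rule measure_eqI_generator_eq[where E = "range (\<lambda>(a, b). box a b)" and \<Omega> = UNIV
        and A = "\<lambda>n. box (- (real n *\<^sub>R One)) (real n *\<^sub>R One)"])
    show "Int_stable (range (\<lambda>(a, b). box a b :: 'a set))"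
      by (rule Int_stableI) (clarsimp simp: box_Int_box, rule rangeI[of "\<lambda>(a, b). box a b" "(a, b)" for a b, simplified])
    show "emeasure (density lborel (\<lambda>x. ennreal (P x))) X = emeasure (density lborel (\<lambda>x. ennreal (N x))) X"
      if "X \<in> range (\<lambda>(a, b). box a b)" for X
    proof -
      from that obtain a b where X: "X = box a b" by auto
      show ?thesis unfolding X by (subst (1 2) em) (use P0 N0 PN Pint Nint in auto)
    qed
    have sb: "sets borel = sigma_sets UNIV (range (\<lambda>(a, b). box a b :: 'a set))"
      using borel_eq_box by (metis Pow_UNIV subset_UNIV sets_measure_of)
    show "sets (density lborel (\<lambda>x. ennreal (P x))) = sigma_sets UNIV (range (\<lambda>(a, b). box a b :: 'a set))"
      "sets (density lborel (\<lambda>x. ennreal (N x))) = sigma_sets UNIV (range (\<lambda>(a, b). box a b :: 'a set))"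
      using sb by auto
    show "(\<Union>i. box (- (real i *\<^sub>R One)) (real i *\<^sub>R One)) = (UNIV :: 'a set)"
      by (rule UN_box_eq_UNIV)
    show "emeasure (density lborel (\<lambda>x. ennreal (P x))) (box (- (real i *\<^sub>R One)) (real i *\<^sub>R One)) \<noteq> \<infinity>" for i
      by (subst em) (use P0 Pint in auto)
  qed auto
  then have "AE x in lborel. ennreal (P x) = ennreal (N x)"
    by (rule sigma_finite_measure.density_unique[OF sigma_finite_lborel, rotated 2]) measurable
  then show ?thesis
    by eventually_elim (auto simp: P_def N_def max_def split: if_splits)
qed

text \<open>A common class for test functions and their partial derivatives, the two kinds of
  factors in the weak formulation.\<close>

definition continuous_compact_support :: "('a::euclidean_space \<Rightarrow> real) \<Rightarrow> bool" where
  "continuous_compact_support f \<longleftrightarrow> continuous_on UNIV f \<and> compact (closure {x. f x \<noteq> 0})"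

text \<open>Local integrability directly yields measurability of the truncations to balls;
  \<open>f\<close> is their pointwise limit.\<close>

lemma locally_integrable_measurable:
  assumes "locally_integrable f"
  shows "f \<in> borel_measurable borel"
proof (rule borel_measurable_LIMSEQ_metric)
  fix n
  have "integrable lborel (\<lambda>x. indicator (cball 0 (real n)) x *\<^sub>R f x)"
    using assms unfolding locally_integrable_def set_integrable_def by auto
  then show "(\<lambda>x. indicator (cball 0 (real n)) x *\<^sub>R f x) \<in> borel_measurable borel"
    by auto
next
  fix x :: 'a
  obtain N :: nat where "norm x \<le> real N" using real_arch_simple by blast
  then have "\<forall>n\<ge>N. indicator (cball 0 (real n)) x *\<^sub>R f x = f x" by auto
  then show "(\<lambda>n. indicator (cball 0 (real n)) x *\<^sub>R f x) \<longlonglongrightarrow> f x"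
    by (intro tendsto_eventually) (auto simp: eventually_sequentially)
qed

lemma locally_integrable_box:
  assumes "locally_integrable f"
  shows "integrable lborel (\<lambda>x. f x * indicator (cbox a b) x)"
    and "integrable lborel (\<lambda>x. f x * indicator (box a b) x)"
proof -
  have "set_integrable lborel (cbox a b) f" using assms by (auto simp: locally_integrable_def)
  moreover from this have "set_integrable lborel (box a b) f"
    by (rule set_integrable_subset) (auto simp: box_subset_cbox)
  ultimately show "integrable lborel (\<lambda>x. f x * indicator (cbox a b) x)"
    "integrable lborel (\<lambda>x. f x * indicator (box a b) x)"
    by (simp_all add: set_integrable_def mult.commute)
qed

lemma continuous_compact_support_bounded:
  assumes "continuous_compact_support f"
  obtains B where "B \<ge> 0" "\<And>x. \<bar>f x\<bar> \<le> B"
proof -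
  let ?K = "closure {x. f x \<noteq> 0}"
  have "compact (f ` ?K)"
    using assms unfolding continuous_compact_support_def by (meson compact_continuous_image continuous_on_subset subset_UNIV)
  then obtain B where B: "\<forall>y\<in>f ` ?K. norm y \<le> B"
    using compact_imp_bounded bounded_iff by blast
  have "\<bar>f x\<bar> \<le> max B 0" for x
  proof (cases "f x = 0")
    case False
    then have "x \<in> ?K" by (intro subsetD[OF closure_subset]) simp
    then have "\<bar>f x\<bar> \<le> B" using B by (metis imageI real_norm_def)
    then show ?thesis by simp
  qed simp
  then show thesis using that[of "max B 0"] by auto
qed

lemma integrable_mult_compact_support:
  assumes v: "locally_integrable v" and f: "continuous_compact_support f"
  shows "integrable lborel (\<lambda>x. v x * f x)"
proof -
  let ?K = "closure {x. f x \<noteq> 0}"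
  obtain B where B: "B \<ge> 0" "\<And>x. \<bar>f x\<bar> \<le> B" using continuous_compact_support_bounded[OF f] by blast
  have [measurable]: "f \<in> borel_measurable borel" "v \<in> borel_measurable borel"
    using f v by (auto simp: continuous_compact_support_def intro: borel_measurable_continuous_onI locally_integrable_measurable)
  have "integrable lborel (\<lambda>x. B * (indicator ?K x *\<^sub>R v x))"
    using v f unfolding locally_integrable_def set_integrable_def continuous_compact_support_def
    by (intro integrable_mult_right) auto
  then show ?thesis
  proof (rule Bochner_Integration.integrable_bound)
    show "AE x in lborel. norm (v x * f x) \<le> norm (B * (indicator ?K x *\<^sub>R v x))"
    proof (rule AE_I2)
      fix x
      show "norm (v x * f x) \<le> norm (B * (indicator ?K x *\<^sub>R v x))"
      proof (cases "f x = 0")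
        case False
        then have "x \<in> ?K" by (intro subsetD[OF closure_subset]) simp
        then show ?thesis using B mult_right_mono[OF B(2)[of x], of "\<bar>v x\<bar>"] by (simp add: abs_mult mult.commute)
      qed simp
    qed
  qed simp
qed

lemma test_function_continuous: "test_function \<phi> \<Longrightarrow> continuous_compact_support \<phi>"
  unfolding test_function_def continuous_compact_support_def by (metis C_k.simps(1))

lemma test_function_has_derivative:
  "test_function \<phi> \<Longrightarrow> (\<phi> has_derivative frechet_derivative \<phi> (at x)) (at x)"
  unfolding test_function_def by (metis C_k.simps(2) UNIV_I differentiable_on_def frechet_derivative_works)

lemma test_function_derivative:
  fixes \<phi> :: "real^'n::finite \<Rightarrow> real"
  assumes "test_function \<phi>"
  shows "continuous_compact_support (\<lambda>x. frechet_derivative \<phi> (at x) (axis j 1))"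
proof -
  have "(axis j 1 :: real^'n) \<in> Basis" by (auto simp: Basis_vec_def)
  then have cont: "continuous_on UNIV (\<lambda>x. frechet_derivative \<phi> (at x) (axis j 1))"
    using assms unfolding test_function_def by (metis C_k.simps)
  \<comment> \<open>Off its closed support the test function vanishes on an open set, and so does
    its derivative.\<close>
  have "{x. frechet_derivative \<phi> (at x) (axis j 1) \<noteq> 0} \<subseteq> closure {x. \<phi> x \<noteq> 0}"
  proof (rule ccontr)
    assume "\<not> ?thesis"
    then obtain x where x: "frechet_derivative \<phi> (at x) (axis j 1) \<noteq> 0" "x \<in> - closure {x. \<phi> x \<noteq> 0}" by auto
    have z: "\<phi> y = 0" if "y \<in> - closure {x. \<phi> x \<noteq> 0}" for y
      using that closure_subset[of "{x. \<phi> x \<noteq> 0}"] by auto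
    have "(\<phi> has_derivative (\<lambda>_. 0)) (at x)"
      by (rule has_derivative_transform_within_open[OF has_derivative_const[of 0] _ x(2) z[symmetric]])
         (simp_all add: open_Compl)
    then have "frechet_derivative \<phi> (at x) = (\<lambda>_. 0)" by (metis frechet_derivative_at)
    then show False using x by simp
  qed
  then have "closure {x. frechet_derivative \<phi> (at x) (axis j 1) \<noteq> 0} \<subseteq> closure {x. \<phi> x \<noteq> 0}"
    by (simp add: closure_minimal)
  moreover have "compact (closure {x. \<phi> x \<noteq> 0})" using assms by (simp add: test_function_def)
  ultimately have "compact (closure {x. frechet_derivative \<phi> (at x) (axis j 1) \<noteq> 0})"
    unfolding compact_eq_bounded_closed using bounded_subset by blast
  with cont show ?thesis unfolding continuous_compact_support_def by blast
qed

text \<open>The test functions \<open>\<Prod>\<^sub>j (1 - exp (- k bump x\<^sub>j))\<close> increase to the indicator of a box.\<close>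

lemma fundamental_lemma_variations:
  fixes v :: "real^'n::finite \<Rightarrow> real"
  assumes v: "locally_integrable v"
    and zero: "\<And>\<phi>. test_function \<phi> \<Longrightarrow> (LBINT x. v x * \<phi> x) = 0"
  shows "AE x in lborel. v x = 0"
proof (rule AE_zero_if_box_integrals_zero)
  show [measurable]: "v \<in> borel_measurable borel" by (rule locally_integrable_measurable[OF v])
  show "integrable lborel (\<lambda>x. v x * indicator (box a b) x)" for a b by (rule locally_integrable_box[OF v])
  fix a b :: "real^'n"
  define g where "g = (\<lambda>k::nat. \<lambda>j x. 1 - exp (- real k * bump (a $ j) (b $ j) x))"
  have g01: "0 \<le> g k j x" "g k j x \<le> 1" for k j x
    using bump_nonneg[of "a $ j" "b $ j" x] by (auto simp: g_def)
  have sm: "smooth (g k j)" for k j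
  proof -
    have "smooth (\<lambda>x. 1 + (-1) * exp (- real k * bump (a $ j) (b $ j) x))"
      by (intro smooth_intros smooth_bump)
    then show ?thesis by (simp add: g_def)
  qed
  have g0: "g k j x = 0" if "\<bar>x\<bar> > norm a + norm b" for k j x
  proof -
    have "\<not> (a $ j < x \<and> x < b $ j)"
      using that component_le_norm_cart[of a j] component_le_norm_cart[of b j] norm_ge_zero[of a] norm_ge_zero[of b] by linarith
    then show ?thesis by (simp add: g_def bump_eq_0)
  qed
  have t: "test_function (tensor (g k))" for k
    by (rule test_function_tensor[OF sm g0])
  have [measurable]: "tensor (g k) \<in> borel_measurable borel" for k
    using test_function_continuous[OF t[of k]]
    by (auto simp: continuous_compact_support_def intro: borel_measurable_continuous_onI)
  have glim: "(\<lambda>k. g k j x) \<longlonglongrightarrow> (if a $ j < x \<and> x < b $ j then 1 else 0)" for j x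
  proof (cases "a $ j < x \<and> x < b $ j")
    case True
    have "(\<lambda>k. 1 - exp (- bump (a $ j) (b $ j) x) ^ k) \<longlonglongrightarrow> 1 - 0"
      using bump_pos[of "a $ j" x "b $ j"] True
      by (intro tendsto_diff tendsto_const LIMSEQ_power_zero) auto
    moreover have "exp (- bump (a $ j) (b $ j) x) ^ k = exp (- real k * bump (a $ j) (b $ j) x)" for k
      by (simp flip: exp_of_nat_mult)
    ultimately show ?thesis using True by (simp add: g_def)
  next
    case False
    then show ?thesis by (auto simp: g_def bump_eq_0)
  qed
  have "(\<lambda>k. LBINT x. v x * tensor (g k) x) \<longlonglongrightarrow> (LBINT x. v x * indicator (box a b) x)"
  proof (rule integral_dominated_convergence[where w = "\<lambda>x. \<bar>v x * indicator (cbox a b) x\<bar>"])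
    show "integrable lborel (\<lambda>x. \<bar>v x * indicator (cbox a b) x\<bar>)"
      by (intro integrable_abs locally_integrable_box[OF v])
    show "AE x in lborel. (\<lambda>k. v x * tensor (g k) x) \<longlonglongrightarrow> v x * indicator (box a b) x"
    proof (rule AE_I2)
      fix x
      have "(\<lambda>k. tensor (g k) x) \<longlonglongrightarrow> (\<Prod>j\<in>UNIV. if a $ j < x $ j \<and> x $ j < b $ j then 1 else 0)"
        unfolding tensor_def by (intro tendsto_prod glim)
      also have "(\<Prod>j\<in>UNIV. if a $ j < x $ j \<and> x $ j < b $ j then 1 else 0) = (indicator (box a b) x :: real)"
        by (auto simp: indicator_def mem_box_cart)
      finally show "(\<lambda>k. v x * tensor (g k) x) \<longlonglongrightarrow> v x * indicator (box a b) x"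
        by (rule tendsto_mult_left)
    qed
    show "AE x in lborel. norm (v x * tensor (g k) x) \<le> \<bar>v x * indicator (cbox a b) x\<bar>" for k
    proof (rule AE_I2)
      fix x
      have "tensor (g k) x = 0" if "x \<notin> cbox a b"
      proof -
        obtain j where "\<not> (a $ j \<le> x $ j \<and> x $ j \<le> b $ j)" using \<open>x \<notin> cbox a b\<close> unfolding mem_box_cart by blast
        then have "g k j (x $ j) = 0" by (auto simp: g_def bump_eq_0)
        then show ?thesis unfolding tensor_def by (intro prod_zero) auto
      qed
      moreover have "\<bar>tensor (g k) x\<bar> \<le> 1"
        unfolding tensor_def abs_prod using g01 by (intro prod_le_1) auto
      ultimately show "norm (v x * tensor (g k) x) \<le> \<bar>v x * indicator (cbox a b) x\<bar>"
        by (cases "x \<in> cbox a b") (auto simp: abs_mult mult_left_le)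
    qed
  qed simp_all
  then show "(LBINT x. v x * indicator (box a b) x) = 0"
    using zero[OF t] by (simp add: LIMSEQ_const_iff)
qed

lemma locally_integrable_diff:
  "locally_integrable f \<Longrightarrow> locally_integrable g \<Longrightarrow> locally_integrable (\<lambda>x. f x - c * g x)"
  unfolding locally_integrable_def by (auto intro!: set_integral_diff(1) set_integrable_mult_right)

text \<open>Allowing \<open>u\<close> and \<open>u'\<close> to differ on a null set makes the
  statement iterable: the second derivative already starts from two different versions of the
  first.\<close>

lemma weak_partial_unique:
  assumes 1: "weak_partial j u v" and 2: "weak_partial j u' v'" and u: "AE x in lborel. u x = u' x"
  shows "AE x in lborel. v x = v' x"
proof -
  have li: "locally_integrable u" "locally_integrable u'" "locally_integrable v" "locally_integrable v'"
    using 1 2 by (auto simp: weak_partial_def)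
  note [measurable] = li[THEN locally_integrable_measurable]
  have "AE x in lborel. v x - 1 * v' x = 0"
  proof (rule fundamental_lemma_variations)
    show "locally_integrable (\<lambda>x. v x - 1 * v' x)" using li by (intro locally_integrable_diff)
    fix \<phi> :: "real^'a \<Rightarrow> real" assume \<phi>: "test_function \<phi>"
    note cc = test_function_continuous[OF \<phi>]
    have [measurable]: "(\<lambda>x. frechet_derivative \<phi> (at x) (axis j 1)) \<in> borel_measurable borel"
      using test_function_derivative[OF \<phi>] by (auto simp: continuous_compact_support_def intro: borel_measurable_continuous_onI)
    have "(LBINT x. (v x - 1 * v' x) * \<phi> x) = (LBINT x. v x * \<phi> x) - (LBINT x. v' x * \<phi> x)"
      by (subst Bochner_Integration.integral_diff[symmetric])
         (use li cc integrable_mult_compact_support in \<open>auto simp: left_diff_distrib\<close>)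
    also have "\<dots> = (LBINT x. u' x * frechet_derivative \<phi> (at x) (axis j 1)) - (LBINT x. u x * frechet_derivative \<phi> (at x) (axis j 1))"
      using 1 2 \<phi> by (simp add: weak_partial_def)
    also have "(LBINT x. u' x * frechet_derivative \<phi> (at x) (axis j 1)) = (LBINT x. u x * frechet_derivative \<phi> (at x) (axis j 1))"
      by (rule integral_cong_AE) (use u in auto)
    finally show "(LBINT x. (v x - 1 * v' x) * \<phi> x) = 0" by simp
  qed
  then show ?thesis by simp
qed

subsection \<open>Hermite coefficients of weak derivatives\<close>

lemma L2_measurable: "f \<in> L2 \<Longrightarrow> f \<in> borel_measurable borel"
  by (simp add: L2_def)

lemma L2_mult_integrable:
  assumes f: "f \<in> L2" and g: "g \<in> L2"
  shows "integrable lborel (\<lambda>x. f x * g x)"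
proof -
  note [measurable] = L2_measurable[OF f] L2_measurable[OF g]
  have "integrable lborel (\<lambda>x. (f x)\<^sup>2 + (g x)\<^sup>2)"
    using f g by (auto simp: L2_def)
  then show ?thesis
  proof (rule Bochner_Integration.integrable_bound)
    show "AE x in lborel. norm (f x * g x) \<le> norm ((f x)\<^sup>2 + (g x)\<^sup>2)"
    proof (rule AE_I2)
      fix x
      have "0 \<le> (\<bar>f x\<bar> - \<bar>g x\<bar>)\<^sup>2" by simp
      then have "2 * (\<bar>f x\<bar> * \<bar>g x\<bar>) \<le> (f x)\<^sup>2 + (g x)\<^sup>2" by (simp add: power2_diff)
      moreover have "0 \<le> \<bar>f x\<bar> * \<bar>g x\<bar>" by simp
      ultimately have "\<bar>f x\<bar> * \<bar>g x\<bar> \<le> (f x)\<^sup>2 + (g x)\<^sup>2" by linarith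
      then show "norm (f x * g x) \<le> norm ((f x)\<^sup>2 + (g x)\<^sup>2)" by (simp add: abs_mult)
    qed
  qed simp
qed

lemma L2_dominated:
  assumes f: "f \<in> L2" and [measurable]: "g \<in> borel_measurable borel" and le: "\<And>x. \<bar>g x\<bar> \<le> \<bar>f x\<bar>"
  shows "g \<in> L2"
proof -
  note [measurable] = L2_measurable[OF f]
  have "integrable lborel (\<lambda>x. (f x)\<^sup>2)" using f by (simp add: L2_def)
  then have "integrable lborel (\<lambda>x. (g x)\<^sup>2)"
    by (rule Bochner_Integration.integrable_bound) (use le in \<open>auto simp: abs_le_square_iff\<close>)
  then show ?thesis by (simp add: L2_def)
qed

lemma L2_lincomb:
  assumes f: "f \<in> L2" and g: "g \<in> L2"
  shows "(\<lambda>x. f x + c * g x) \<in> L2"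
proof -
  note [measurable] = L2_measurable[OF f] L2_measurable[OF g]
  have "integrable lborel (\<lambda>x. (f x)\<^sup>2 + 2 * c * (f x * g x) + c\<^sup>2 * (g x)\<^sup>2)"
    using f g L2_mult_integrable[OF f g] by (auto simp: L2_def)
  then show ?thesis by (simp add: L2_def power2_sum power_mult_distrib algebra_simps)
qed

lemma L2_zero: "(\<lambda>x. 0) \<in> L2" by (simp add: L2_def)

lemma L2_scale: "f \<in> L2 \<Longrightarrow> (\<lambda>x. c * f x) \<in> L2"
  using L2_lincomb[OF L2_zero, of f c] by simp

lemma L2_add: "f \<in> L2 \<Longrightarrow> g \<in> L2 \<Longrightarrow> (\<lambda>x. f x + g x) \<in> L2"
  using L2_lincomb[of f g 1] by simp

lemma L2_diff: "f \<in> L2 \<Longrightarrow> g \<in> L2 \<Longrightarrow> (\<lambda>x. f x - g x) \<in> L2"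
  using L2_lincomb[of f g "-1"] by simp

lemma L2_abs: "f \<in> L2 \<Longrightarrow> (\<lambda>x. \<bar>f x\<bar>) \<in> L2"
  by (auto simp: L2_def)

lemma L2_sum: "(\<And>i. i \<in> S \<Longrightarrow> f i \<in> L2) \<Longrightarrow> (\<lambda>x. \<Sum>i\<in>S. f i x) \<in> L2"
  by (induction S rule: infinite_finite_induct) (auto simp: L2_zero intro: L2_add)

lemma L2_locally_integrable:
  assumes f: "f \<in> L2"
  shows "locally_integrable f"
  unfolding locally_integrable_def
proof (intro allI impI)
  fix K :: "'a set" assume K: "compact K"
  then have [measurable]: "K \<in> sets borel" by (auto intro: borel_closed compact_imp_closed)
  have "integrable lborel (indicator K :: 'a \<Rightarrow> real)"
    using emeasure_compact_finite[OF K] by (intro integrable_real_indicator) simp_all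
  then have "indicator K \<in> (L2 :: ('a \<Rightarrow> real) set)"
    by (simp add: L2_def power2_eq_square flip: indicator_inter_arith)
  from L2_mult_integrable[OF this f] show "set_integrable lborel K f"
    by (simp add: set_integrable_def)
qed

lemma tensor_in_L2:
  assumes "\<And>j. g j \<in> L2"
  shows "tensor g \<in> L2"
  using assms by (intro tensor_L2) (auto simp: L2_def)

text \<open>Dominated convergence with hypotheses factor by factor: the tensor of the majorants
  \<open>D j\<close> lies in L2, so its product with \<open>u\<close> is an integrable majorant. It
  serves to remove cutoffs.\<close>

lemma integral_tensor_tendsto:
  assumes u: "u \<in> L2" and D: "\<And>j. D j \<in> L2"
    and G: "\<And>k j. G k j \<in> borel_measurable borel" and F: "\<And>j. F j \<in> borel_measurable borel"
    and le: "\<And>k j x. \<bar>G k j x\<bar> \<le> D j x" and lim: "\<And>j x. (\<lambda>k. G k j x) \<longlonglongrightarrow> F j x"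
  shows "(\<lambda>k. LBINT x. u x * tensor (G k) x) \<longlonglongrightarrow> (LBINT x. u x * tensor F x)"
proof (rule integral_dominated_convergence[where w = "\<lambda>x. \<bar>u x * tensor D x\<bar>"])
  note [measurable] = L2_measurable[OF u] tensor_measurable[OF F] tensor_measurable[OF G]
  show "(\<lambda>x. u x * tensor F x) \<in> borel_measurable lborel" by measurable
  show "(\<lambda>x. u x * tensor (G k) x) \<in> borel_measurable lborel" for k by measurable
  show "integrable lborel (\<lambda>x. \<bar>u x * tensor D x\<bar>)"
    by (intro integrable_abs L2_mult_integrable u tensor_in_L2 D)
  show "AE x in lborel. (\<lambda>k. u x * tensor (G k) x) \<longlonglongrightarrow> u x * tensor F x"
    unfolding tensor_def by (intro AE_I2 tendsto_mult_left tendsto_prod lim)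
  show "AE x in lborel. norm (u x * tensor (G k) x) \<le> \<bar>u x * tensor D x\<bar>" for k
  proof (rule AE_I2)
    fix x
    have "\<bar>tensor (G k) x\<bar> \<le> tensor D x" unfolding tensor_abs by (intro tensor_mono le) auto
    also have "\<dots> \<le> \<bar>tensor D x\<bar>" by simp
    finally show "norm (u x * tensor (G k) x) \<le> \<bar>u x * tensor D x\<bar>"
      by (simp add: abs_mult mult_left_mono)
  qed
qed

text \<open>For the dilations x -> eta (r x) with r tending to 0, continuity and
  \<open>\<eta> 0 = 1\<close> give the pointwise limit 1, and the bound on \<open>\<eta>'\<close>
  makes the derivative vanish, since it carries a factor r. A bump normalised at 0 therefore serves
  as cutoff.\<close>

lemma cutoff_exists:
  obtains \<eta> \<eta>' :: "real \<Rightarrow> real" and B where "smooth \<eta>" "\<And>x. (\<eta> has_real_derivative \<eta>' x) (at x)" "smooth \<eta>'"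
    "B \<ge> 0" "\<And>x. \<bar>\<eta> x\<bar> \<le> B" "\<And>x. \<bar>\<eta>' x\<bar> \<le> B" "\<eta> 0 = 1" "\<And>x. \<bar>x\<bar> > 1 \<Longrightarrow> \<eta> x = 0"
proof -
  define c where "c = bump (-1) 1 0"
  have c: "c > 0" unfolding c_def by (rule bump_pos) auto
  define \<eta> where "\<eta> = (\<lambda>x. (1 / c) * bump (-1) 1 x)"
  have sm: "smooth \<eta>" unfolding \<eta>_def by (intro smooth_intros smooth_bump)
  have z: "\<eta> x = 0" if "\<bar>x\<bar> > 1" for x
    using that unfolding \<eta>_def by (subst bump_eq_0) auto
  obtain \<eta>' where \<eta>': "\<And>x. (\<eta> has_real_derivative \<eta>' x) (at x)" "smooth \<eta>'"
    using smooth_derivE[OF sm] by blast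
  have z': "\<eta>' x = 0" if "\<bar>x\<bar> > 1" for x
  proof -
    have "open {x::real. \<bar>x\<bar> > 1}" by (intro open_Collect_less continuous_intros)
    then have "\<forall>\<^sub>F y in nhds x. \<eta> y = 0"
      using that z by (auto simp: eventually_nhds)
    then have "(\<eta> has_real_derivative 0) (at x) \<longleftrightarrow> ((\<lambda>_. 0) has_real_derivative 0) (at x)"
      by (intro DERIV_cong_ev) auto
    then show ?thesis using \<eta>'(1)[of x] DERIV_unique by fastforce
  qed
  have bd: "\<exists>B. \<forall>x. \<bar>f x\<bar> \<le> B" if "smooth f" "\<And>x. \<bar>x\<bar> > 1 \<Longrightarrow> f x = 0" for f :: "real \<Rightarrow> real"
  proof -
    have "compact (f ` {-1..1})"
      using smooth_continuous[OF that(1)] by (intro compact_continuous_image) (auto intro: continuous_on_subset)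
    then obtain B where B: "\<forall>y\<in>f ` {-1..1}. norm y \<le> B" using compact_imp_bounded bounded_iff by blast
    have "\<bar>f x\<bar> \<le> max B 0" for x
    proof (cases "\<bar>x\<bar> > 1")
      case False
      then have "x \<in> {-1..1}" unfolding atLeastAtMost_iff by linarith
      then have "\<bar>f x\<bar> \<le> B" using B by (metis imageI real_norm_def)
      then show ?thesis by simp
    qed (use that in simp)
    then show ?thesis by blast
  qed
  obtain B1 B2 where "\<forall>x. \<bar>\<eta> x\<bar> \<le> B1" "\<forall>x. \<bar>\<eta>' x\<bar> \<le> B2" using bd[OF sm z] bd[OF \<eta>'(2) z'] by blast
  then have "\<bar>\<eta> x\<bar> \<le> max B1 B2" "\<bar>\<eta>' x\<bar> \<le> max B1 B2" for x by (auto simp: le_max_iff_disj)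
  moreover from this(1)[of 0] have "max B1 B2 \<ge> 0" using abs_ge_zero order_trans by blast
  moreover have "\<eta> 0 = 1" using c unfolding \<eta>_def c_def by simp
  ultimately show thesis using that[of \<eta> \<eta>' "max B1 B2"] sm \<eta>' z by blast
qed

lemma smooth_hermite_fun: "smooth (hermite_fun a b n)"
proof -
  have "smooth_upto k (hermite_fun a b n)" for k
  proof (induction k arbitrary: n)
    case 0
    show ?case by (simp add: continuous_hermite_fun)
  next
    case (Suc k)
    \<comment> \<open>The mean of the lowering and raising formulas. The terms with x - b cancel, so
      the derivative stays in the span of the Hermite functions and the induction applies.\<close>
    define f' where "f' = (\<lambda>x. (a * sqrt (2 * real n) / 2) * hermite_fun a b (n - 1) x
        + (- (a * sqrt (2 * real (Suc n))) / 2) * hermite_fun a b (Suc n) x)"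
    have "smooth_upto k f'" unfolding f'_def
      by (intro smooth_upto_add smooth_upto_mult smooth_upto_const Suc)
    moreover have "(hermite_fun a b n has_real_derivative f' x) (at x)" for x
    proof -
      have "a * sqrt (2 * real n) * hermite_fun a b (n - 1) x - a\<^sup>2 * (x - b) * hermite_fun a b n x = f' x"
        using hermite_fun_Suc[of a n b x] unfolding f'_def by (simp add: field_simps)
      then show ?thesis using hermite_fun_has_derivative[of a b n x] by simp
    qed
    ultimately show ?case by auto
  qed
  then show ?thesis by (simp add: smooth_def)
qed

lemma hermite_fun_in_L2: "a > 0 \<Longrightarrow> hermite_fun a b n \<in> L2"
  using hermite_fun_exp_square_integrable[of a b n 0] by (simp add: L2_def)

lemma hermite_tensor_eq: "hermite_tensor \<alpha> \<beta> n = tensor (\<lambda>j. hermite_fun (\<alpha> $ j) (\<beta> $ j) (n j))"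
  by (auto simp: hermite_tensor_def tensor_def)

lemma hermite_tensor_in_L2: "\<forall>j. \<alpha> $ j > 0 \<Longrightarrow> hermite_tensor \<alpha> \<beta> n \<in> L2"
  unfolding hermite_tensor_eq by (intro tensor_in_L2 hermite_fun_in_L2) auto

text \<open>The Hermite functions lack compact support, so the weak derivative is tested against their
  products with the cutoffs \<open>\<eta> (x / (k + 1))\<close>.\<close>

lemma herm_deriv_coeff:
  fixes \<alpha> \<beta> :: "real^'n::finite"
  assumes \<alpha>: "\<forall>j. \<alpha> $ j > 0" and u: "u \<in> L2" and w: "w \<in> L2" and D: "herm_deriv \<alpha> \<beta> j u w"
  shows "(LBINT x. w x * hermite_tensor \<alpha> \<beta> n x) =
    \<alpha> $ j * sqrt (2 * real (Suc (n j))) * (LBINT x. u x * hermite_tensor \<alpha> \<beta> (n(j := Suc (n j))) x)"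
proof -
  obtain \<eta> \<eta>' B where \<eta>: "smooth \<eta>" "\<And>x. (\<eta> has_real_derivative \<eta>' x) (at x)" "smooth \<eta>'"
    "B \<ge> 0" "\<And>x. \<bar>\<eta> x\<bar> \<le> B" "\<And>x. \<bar>\<eta>' x\<bar> \<le> B" "\<eta> 0 = 1" "\<And>x. \<bar>x\<bar> > 1 \<Longrightarrow> \<eta> x = 0"
    using cutoff_exists by blast
  define h where "h = (\<lambda>i. hermite_fun (\<alpha> $ i) (\<beta> $ i) (n i))"
  define h1 where "h1 = hermite_fun (\<alpha> $ j) (\<beta> $ j) (Suc (n j))"
  define c where "c = \<alpha> $ j * sqrt (2 * real (Suc (n j)))"
  have c0: "c \<ge> 0" unfolding c_def using \<alpha> by (simp add: less_imp_le)
  have hL2: "h i \<in> L2" "h1 \<in> L2" for i unfolding h_def h1_def using \<alpha> hermite_fun_in_L2 by auto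
  have hm: "h i \<in> borel_measurable borel" "h1 \<in> borel_measurable borel" for i using hL2 L2_measurable by auto
  have \<eta>m: "\<eta> \<in> borel_measurable borel" "\<eta>' \<in> borel_measurable borel"
    using \<eta> smooth_continuous by (auto intro: borel_measurable_continuous_onI)
  note [measurable] = hm \<eta>m
  define r where "r = (\<lambda>k. 1 / real (Suc k))"
  have r: "0 < r k" "r k \<le> 1" for k by (auto simp: r_def)
  have r0: "r \<longlonglongrightarrow> 0" unfolding r_def using LIMSEQ_inverse_real_of_nat by (simp add: inverse_eq_divide)
  define g where "g = (\<lambda>k i x. h i x * \<eta> (r k * x))"
  define g' where "g' = (\<lambda>k i x. ((\<alpha> $ i)\<^sup>2 * (x - \<beta> $ i) * h i x - \<alpha> $ i * sqrt (2 * real (Suc (n i))) * hermite_fun (\<alpha> $ i) (\<beta> $ i) (Suc (n i)) x) * \<eta> (r k * x)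
       + (\<eta>' (r k * x) * r k) * h i x)"
  \<comment> \<open>The \<open>j\<close>-th factor after cancellation: \<open>g' k j\<close> minus
    the multiplication term of \<open>herm_deriv\<close> applied to \<open>g k j\<close>. The
    unbounded factor x - beta_j has disappeared, and the limit is \<open>- c * h1\<close>.\<close>
  define e where "e = (\<lambda>k x. (\<eta>' (r k * x) * r k) * h j x - c * h1 x * \<eta> (r k * x))"
  have gder: "(g k i has_real_derivative g' k i x) (at x)" for k i x
  proof -
    have "((\<lambda>x. \<eta> (r k * x)) has_real_derivative \<eta>' (r k * x) * r k) (at x)"
      by (rule DERIV_chain2[OF \<eta>(2)]) (auto intro!: derivative_eq_intros)
    from DERIV_mult[OF hermite_fun_has_derivative' this]
    show ?thesis unfolding g_def g'_def h_def .
  qed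
  have gsm: "smooth (g k i)" for k i
  proof -
    have "smooth (\<lambda>x. \<eta> (r k * x + 0))" by (rule smooth_intros) (rule \<eta>)
    then show ?thesis unfolding g_def h_def by (intro smooth_intros smooth_hermite_fun) simp
  qed
  have g0: "g k i x = 0" if "\<bar>x\<bar> > real (Suc k)" for k i x
  proof -
    have "\<bar>r k * x\<bar> > 1" using that by (simp add: r_def abs_mult field_simps)
    then show ?thesis by (simp add: g_def \<eta>)
  qed
  have t: "test_function (tensor (g k))" for k by (rule test_function_tensor[OF gsm g0])
  have eq: "(LBINT x. u x * tensor ((g k)(j := e k)) x) = - (LBINT x. w x * tensor (g k) x)" for k
  proof -
    let ?\<phi> = "tensor (g k)" and ?d = "\<lambda>x. frechet_derivative (tensor (g k)) (at x) (axis j 1)"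
    let ?v = "\<lambda>x. w x - (\<alpha> $ j)\<^sup>2 * (x $ j - \<beta> $ j) * u x"
    have wp: "locally_integrable u" "locally_integrable ?v" "(LBINT x. u x * ?d x) = - (LBINT x. ?v x * ?\<phi> x)"
      using D t[of k] unfolding herm_deriv_def weak_partial_def by auto
    have d: "?d x = tensor ((g k)(j := g' k j)) x" for x by (rule tensor_frechet[of "g k" "g' k", OF gder])
    \<comment> \<open>\<open>?v\<close> is kept in one piece, because its local integrability is
      what \<open>weak_partial\<close> provides.\<close>
    have i: "integrable lborel (\<lambda>x. u x * ?d x)" "integrable lborel (\<lambda>x. ?v x * ?\<phi> x)" "integrable lborel (\<lambda>x. w x * ?\<phi> x)"
      by (rule integrable_mult_compact_support wp test_function_derivative test_function_continuous t L2_locally_integrable w)+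
    have "u x * tensor ((g k)(j := e k)) x = u x * ?d x + ?v x * ?\<phi> x - w x * ?\<phi> x" for x
    proof -
      have E: "e k (x $ j) = g' k j (x $ j) - (\<alpha> $ j)\<^sup>2 * (x $ j - \<beta> $ j) * g k j (x $ j)"
        by (simp add: e_def g'_def g_def h1_def c_def algebra_simps)
      show ?thesis unfolding d tensor_upd tensor_remove[of "g k" x j] E by (simp add: algebra_simps)
    qed
    then have "(LBINT x. u x * tensor ((g k)(j := e k)) x) = (LBINT x. u x * ?d x + ?v x * ?\<phi> x - w x * ?\<phi> x)" by simp
    also have "\<dots> = (LBINT x. u x * ?d x) + (LBINT x. ?v x * ?\<phi> x) - (LBINT x. w x * ?\<phi> x)"
      using i by (simp only: Bochner_Integration.integral_diff Bochner_Integration.integral_add Bochner_Integration.integrable_add)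
    finally show ?thesis using wp(3) by simp
  qed
  have \<eta>lim: "(\<lambda>k. \<eta> (r k * x)) \<longlonglongrightarrow> 1" for x
  proof -
    have "(\<lambda>k. r k * x) \<longlonglongrightarrow> 0" using tendsto_mult_right[OF r0, of x] by simp
    moreover have "isCont \<eta> 0" using \<eta>(2) DERIV_isCont by blast
    ultimately show ?thesis using isCont_tendsto_compose \<eta>(7) by fastforce
  qed
  have lim1: "(\<lambda>k. LBINT x. w x * tensor (g k) x) \<longlonglongrightarrow> (LBINT x. w x * tensor h x)"
  proof (rule integral_tensor_tendsto[where D = "\<lambda>i x. B * \<bar>h i x\<bar>", OF w])
    show "(\<lambda>x. B * \<bar>h i x\<bar>) \<in> L2" for i by (intro L2_scale L2_abs hL2)
    show "\<bar>g k i x\<bar> \<le> B * \<bar>h i x\<bar>" for k i x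
      using mult_right_mono[OF \<eta>(5)[of "r k * x"], of "\<bar>h i x\<bar>"] by (simp add: g_def abs_mult mult.commute)
    show "(\<lambda>k. g k i x) \<longlonglongrightarrow> h i x" for i x
      using tendsto_mult_left[OF \<eta>lim, of "h i x" x] by (simp add: g_def)
  qed (simp_all add: g_def hm)
  have lim2: "(\<lambda>k. LBINT x. u x * tensor ((g k)(j := e k)) x) \<longlonglongrightarrow> (LBINT x. u x * tensor (h(j := (\<lambda>x. - c * h1 x))) x)"
  proof (rule integral_tensor_tendsto[where D = "(\<lambda>i x. B * \<bar>h i x\<bar>)(j := \<lambda>x. B * (\<bar>h j x\<bar> + c * \<bar>h1 x\<bar>))", OF u])
    show "((\<lambda>i x. B * \<bar>h i x\<bar>)(j := \<lambda>x. B * (\<bar>h j x\<bar> + c * \<bar>h1 x\<bar>))) i \<in> L2" for i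
      by (cases "i = j") (auto intro!: L2_scale L2_lincomb L2_abs hL2)
    show "((g k)(j := e k)) i \<in> borel_measurable borel" for k i by (simp add: g_def e_def)
    show "(h(j := \<lambda>x. - c * h1 x)) i \<in> borel_measurable borel" for i by simp
    show "\<bar>((g k)(j := e k)) i x\<bar> \<le> ((\<lambda>i x. B * \<bar>h i x\<bar>)(j := \<lambda>x. B * (\<bar>h j x\<bar> + c * \<bar>h1 x\<bar>))) i x" for k i x
    proof (cases "i = j")
      case False
      then show ?thesis using mult_right_mono[OF \<eta>(5)[of "r k * x"], of "\<bar>h i x\<bar>"] by (simp add: g_def abs_mult mult.commute)
    next
      case True
      have "\<bar>e k x\<bar> \<le> \<bar>(\<eta>' (r k * x) * r k) * h j x\<bar> + \<bar>c * h1 x * \<eta> (r k * x)\<bar>"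
        unfolding e_def by (rule abs_triangle_ineq4)
      also have "\<bar>(\<eta>' (r k * x) * r k) * h j x\<bar> \<le> (B * 1) * \<bar>h j x\<bar>"
        unfolding abs_mult using r[of k] \<eta>(4,6) by (intro mult_right_mono mult_mono) auto
      also have "\<bar>c * h1 x * \<eta> (r k * x)\<bar> \<le> (c * \<bar>h1 x\<bar>) * B"
        unfolding abs_mult using c0 \<eta>(5) by (intro mult_mono) auto
      finally show ?thesis using True by (simp add: algebra_simps)
    qed
    show "(\<lambda>k. ((g k)(j := e k)) i x) \<longlonglongrightarrow> (h(j := \<lambda>x. - c * h1 x)) i x" for i x
    proof (cases "i = j")
      case False
      then show ?thesis using tendsto_mult_left[OF \<eta>lim, of "h i x" x] by (simp add: g_def)
    next
      case True
      have "(\<lambda>k. \<eta>' (r k * x) * r k) \<longlonglongrightarrow> 0"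
      proof (rule tendsto_rabs_zero_cancel, rule tendsto_sandwich[OF _ _ tendsto_const])
        show "(\<lambda>k. B * r k) \<longlonglongrightarrow> 0" using tendsto_mult_left[OF r0, of B] by simp
        show "\<forall>\<^sub>F k in sequentially. \<bar>\<eta>' (r k * x) * r k\<bar> \<le> B * r k"
          unfolding abs_mult using r \<eta>(6) by (auto intro!: mult_right_mono simp: less_imp_le)
      qed auto
      then have "(\<lambda>k. (\<eta>' (r k * x) * r k) * h j x - c * h1 x * \<eta> (r k * x)) \<longlonglongrightarrow> 0 * h j x - c * h1 x * 1"
        by (intro tendsto_intros \<eta>lim)
      then show ?thesis using True by (simp add: e_def)
    qed
  qed
  have "(\<lambda>k. LBINT x. u x * tensor ((g k)(j := e k)) x) \<longlonglongrightarrow> - (LBINT x. w x * tensor h x)"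
    unfolding eq by (rule tendsto_minus[OF lim1])
  with lim2 have "- (LBINT x. w x * tensor h x) = (LBINT x. u x * tensor (h(j := (\<lambda>x. - c * h1 x))) x)"
    using LIMSEQ_unique by blast
  also have "u x * tensor (h(j := (\<lambda>x. - c * h1 x))) x = - c * (u x * hermite_tensor \<alpha> \<beta> (n(j := Suc (n j))) x)" for x
  proof -
    have "hermite_tensor \<alpha> \<beta> (n(j := Suc (n j))) = tensor (h(j := h1))"
      unfolding hermite_tensor_eq by (rule arg_cong[where f = tensor]) (auto simp: h_def h1_def)
    then show ?thesis by (simp add: tensor_upd)
  qed
  then have "(LBINT x. u x * tensor (h(j := (\<lambda>x. - c * h1 x))) x) = - c * (LBINT x. u x * hermite_tensor \<alpha> \<beta> (n(j := Suc (n j))) x)"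
    by simp
  finally show ?thesis by (simp add: c_def hermite_tensor_eq h_def)
qed

section \<open>Classical derivatives as weak derivatives\<close>

lemma integral_directional_derivative_eq_0:
  fixes f :: "'a::euclidean_space \<Rightarrow> real"
  assumes d: "\<And>x. (f has_derivative F x) (at x)"
    and f: "continuous_compact_support f" and F: "continuous_compact_support (\<lambda>x. F x e)"
  shows "(LBINT x. F x e) = 0"
proof -
  obtain B where B: "B \<ge> 0" "\<And>x. \<bar>F x e\<bar> \<le> B" using continuous_compact_support_bounded[OF F] by blast
  have "bounded (closure {x. f x \<noteq> 0} \<union> closure {x. F x e \<noteq> 0})"
    using f F by (auto simp: continuous_compact_support_def compact_imp_bounded)
  then obtain R where R: "\<forall>x\<in>closure {x. f x \<noteq> 0} \<union> closure {x. F x e \<noteq> 0}. norm x \<le> R" using bounded_iff by blast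
  have z: "f x = 0" if "norm x > R" for x
  proof (rule ccontr)
    assume "f x \<noteq> 0"
    then have "x \<in> closure {x. f x \<noteq> 0}" by (intro subsetD[OF closure_subset]) simp
    then show False using R that by force
  qed
  define t where "t = (\<lambda>k. 1 / real (Suc k))"
  have t: "0 < t k" "t k \<le> 1" for k by (auto simp: t_def)
  have t0: "t \<longlonglongrightarrow> 0" unfolding t_def using LIMSEQ_inverse_real_of_nat by (simp add: inverse_eq_divide)
  define q where "q = (\<lambda>k x. (f (t k *\<^sub>R e + x) - f x) / t k)"
  have line: "((\<lambda>s. f (s *\<^sub>R e + x)) has_real_derivative F (s *\<^sub>R e + x) e) (at s)" for s x
  proof -
    have 1: "((\<lambda>s. s *\<^sub>R e + x) has_derivative (\<lambda>h. h *\<^sub>R e)) (at s)"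
      by (auto intro!: derivative_eq_intros)
    have "((\<lambda>s. f (s *\<^sub>R e + x)) has_derivative (\<lambda>h. F (s *\<^sub>R e + x) (h *\<^sub>R e))) (at s)"
      using has_derivative_compose[OF 1 d] .
    moreover have "F (s *\<^sub>R e + x) (h *\<^sub>R e) = F (s *\<^sub>R e + x) e * h" for h
      using linear_scale[OF has_derivative_linear[OF d], of "s *\<^sub>R e + x" h e] by simp
    ultimately show ?thesis by (simp add: has_field_derivative_def)
  qed
  have fm[measurable]: "f \<in> borel_measurable borel" and [measurable]: "(\<lambda>x. F x e) \<in> borel_measurable borel"
    using f F by (auto simp: continuous_compact_support_def intro: borel_measurable_continuous_onI)
  have "locally_integrable (\<lambda>_::'a. 1)"
    unfolding locally_integrable_def set_integrable_def
    using emeasure_compact_finite by (auto intro!: integrable_real_indicator borel_closed compact_imp_closed)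
  from integrable_mult_compact_support[OF this f] have fi: "integrable lborel f" by simp
  have shift: "integrable lborel (\<lambda>x. f (c + x))" "(LBINT x. f (c + x)) = (LBINT x. f x)" for c
  proof -
    have "integrable (distr lborel borel ((+) c)) f" using fi by (simp add: lborel_distr_plus)
    then show "integrable lborel (\<lambda>x. f (c + x))" by (subst (asm) integrable_distr_eq) auto
    have "(LBINT x. f x) = integral\<^sup>L (distr lborel borel ((+) c)) f" by (simp add: lborel_distr_plus)
    also have "\<dots> = (LBINT x. f (c + x))" by (rule integral_distr) auto
    finally show "(LBINT x. f (c + x)) = (LBINT x. f x)" by simp
  qed
  \<comment> \<open>Translation invariance makes every difference quotient integrate to 0; it
    remains to pass to the limit.\<close>
  have q0: "(LBINT x. q k x) = 0" for k
    unfolding q_def using shift fi by (simp add: Bochner_Integration.integral_diff)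
  \<comment> \<open>The quotients are bounded by \<open>B\<close> through the mean value theorem,
    and as \<open>t k\<close> is at most 1 they vanish beyond radius \<open>R + norm e\<close>. This
    gives the majorant.\<close>
  have "(\<lambda>k. LBINT x. q k x) \<longlonglongrightarrow> (LBINT x. F x e)"
  proof (rule integral_dominated_convergence[where w = "\<lambda>x. B * indicator (cball 0 (R + norm e)) x"])
    show "integrable lborel (\<lambda>x::'a. B * indicator (cball 0 (R + norm e)) x)"
      using emeasure_compact_finite[of "cball (0::'a) (R + norm e)"]
      by (intro integrable_mult_right integrable_real_indicator) auto
    show "AE x in lborel. (\<lambda>k. q k x) \<longlonglongrightarrow> F x e"
    proof (rule AE_I2)
      fix x
      have "((\<lambda>h. (f (h *\<^sub>R e + x) - f x) / h) \<longlongrightarrow> F x e) (at 0)"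
        using line[of x 0] unfolding has_field_derivative_iff by simp
      moreover have "filterlim t (at 0) sequentially"
        unfolding filterlim_at using t0 t by (auto simp: less_imp_neq[symmetric] intro!: always_eventually)
      ultimately show "(\<lambda>k. q k x) \<longlonglongrightarrow> F x e" unfolding q_def by (rule filterlim_compose)
    qed
    show "AE x in lborel. norm (q k x) \<le> B * indicator (cball 0 (R + norm e)) x" for k
    proof (rule AE_I2)
      fix x
      show "norm (q k x) \<le> B * indicator (cball 0 (R + norm e)) x"
      proof (cases "norm x \<le> R + norm e")
        case True
        obtain s where "f (t k *\<^sub>R e + x) - f (0 *\<^sub>R e + x) = (t k - 0) * F (s *\<^sub>R e + x) e"
          using MVT2[OF t(1)[of k], of "\<lambda>s. f (s *\<^sub>R e + x)" "\<lambda>s. F (s *\<^sub>R e + x) e"] line by blast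
        then have "q k x = F (s *\<^sub>R e + x) e" unfolding q_def using t(1)[of k] by (simp add: field_simps)
        then show ?thesis using B True by simp
      next
        case False
        have "norm x - norm (t k *\<^sub>R e) \<le> norm (t k *\<^sub>R e + x)" by (metis add.commute norm_diff_ineq)
        moreover have "norm (t k *\<^sub>R e) \<le> norm e" using t[of k] by (simp add: mult_left_le_one_le)
        ultimately have "R < norm (t k *\<^sub>R e + x)" "R < norm x" using False norm_ge_zero[of e] by linarith+
        then show ?thesis using z False by (simp add: q_def)
      qed
    qed
  qed (simp_all add: q_def)
  then show ?thesis by (simp add: q0 LIMSEQ_const_iff)
qed

lemma continuous_locally_integrable:
  fixes f :: "'a::euclidean_space \<Rightarrow> real"
  assumes "continuous_on UNIV f"
  shows "locally_integrable f"
  unfolding locally_integrable_def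
  by (metis assms borel_integrable_compact continuous_on_subset set_integrable_def subset_UNIV)

lemma continuous_compact_support_mult:
  assumes f: "continuous_on UNIV f" and g: "continuous_compact_support g"
  shows "continuous_compact_support (\<lambda>x. f x * g x)"
proof -
  have "closure {x. f x * g x \<noteq> 0} \<subseteq> closure {x. g x \<noteq> 0}" by (intro closure_mono) auto
  moreover have "compact (closure {x. g x \<noteq> 0})" using g by (simp add: continuous_compact_support_def)
  ultimately have "compact (closure {x. f x * g x \<noteq> 0})"
    unfolding compact_eq_bounded_closed using bounded_subset by blast
  then show ?thesis using f g by (auto simp: continuous_compact_support_def intro: continuous_on_mult)
qed

lemma continuous_compact_support_add:
  assumes f: "continuous_compact_support f" and g: "continuous_compact_support g"
  shows "continuous_compact_support (\<lambda>x. f x + g x)"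
proof -
  have "closure {x. f x + g x \<noteq> 0} \<subseteq> closure {x. f x \<noteq> 0} \<union> closure {x. g x \<noteq> 0}"
    unfolding closure_Un[symmetric] by (intro closure_mono) auto
  moreover have "compact (closure {x. f x \<noteq> 0} \<union> closure {x. g x \<noteq> 0})"
    using f g by (auto simp: continuous_compact_support_def)
  ultimately have "compact (closure {x. f x + g x \<noteq> 0})"
    unfolding compact_eq_bounded_closed using bounded_subset by blast
  then show ?thesis using f g by (auto simp: continuous_compact_support_def intro: continuous_on_add)
qed

text \<open>Integration by parts amounts to the vanishing integral of the \<open>j\<close>-th
  derivative of \<open>f\<close> times the test function, a product with compact support.\<close>

lemma weak_partial_classical:
  fixes f :: "real^'n::finite \<Rightarrow> real"
  assumes d: "\<And>x. (f has_derivative F x) (at x)" and c: "continuous_on UNIV (\<lambda>x. F x (axis j 1))"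
  shows "weak_partial j f (\<lambda>x. F x (axis j 1))"
proof -
  have fc: "continuous_on UNIV f"
    by (rule differentiable_imp_continuous_on) (use d in \<open>auto simp: differentiable_on_def differentiable_def\<close>)
  have "(LBINT x. f x * frechet_derivative \<phi> (at x) (axis j 1)) = - (LBINT x. F x (axis j 1) * \<phi> x)"
    if \<phi>: "test_function \<phi>" for \<phi>
  proof -
    let ?d = "\<lambda>x. frechet_derivative \<phi> (at x) (axis j 1)"
    note cc = test_function_continuous[OF \<phi>] test_function_derivative[OF \<phi>, of j]
    have "((\<lambda>x. f x * \<phi> x) has_derivative (\<lambda>h. f x * frechet_derivative \<phi> (at x) h + F x h * \<phi> x)) (at x)" for x
      by (rule has_derivative_mult[OF d test_function_has_derivative[OF \<phi>]])
    then have "(LBINT x. f x * ?d x + F x (axis j 1) * \<phi> x) = 0"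
      by (rule integral_directional_derivative_eq_0[where F = "\<lambda>x h. f x * frechet_derivative \<phi> (at x) h + F x h * \<phi> x" and e = "axis j 1"])
         (intro continuous_compact_support_add continuous_compact_support_mult fc c cc)+
    moreover have "(LBINT x. f x * ?d x + F x (axis j 1) * \<phi> x) = (LBINT x. f x * ?d x) + (LBINT x. F x (axis j 1) * \<phi> x)"
      by (intro Bochner_Integration.integral_add integrable_mult_compact_support continuous_locally_integrable fc c cc)
    ultimately show ?thesis by simp
  qed
  then show ?thesis using fc c by (auto simp: weak_partial_def intro: continuous_locally_integrable)
qed

text \<open>The lowering relation in coordinate \<open>j\<close>. At \<open>n j = 0\<close> the
  factor sqrt 0 removes the term, whatever the truncated index denotes.\<close>

lemma herm_deriv_hermite_tensor:
  fixes \<alpha> \<beta> :: "real^'n::finite"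
  shows "herm_deriv \<alpha> \<beta> j (hermite_tensor \<alpha> \<beta> n)
    (\<lambda>x. \<alpha> $ j * sqrt (2 * real (n j)) * hermite_tensor \<alpha> \<beta> (n(j := n j - 1)) x)"
proof -
  define h where "h = (\<lambda>i. hermite_fun (\<alpha> $ i) (\<beta> $ i) (n i))"
  define h' where "h' = (\<lambda>i x. \<alpha> $ i * sqrt (2 * real (n i)) * hermite_fun (\<alpha> $ i) (\<beta> $ i) (n i - 1) x - (\<alpha> $ i)\<^sup>2 * (x - \<beta> $ i) * h i x)"
  have d: "(h i has_real_derivative h' i x) (at x)" for i x
    unfolding h_def h'_def by (rule hermite_fun_has_derivative)
  have c: "continuous_on UNIV (h i)" "continuous_on UNIV (h' i)" for i
    unfolding h_def h'_def by (intro continuous_intros continuous_on_compose2[OF continuous_hermite_fun] continuous_hermite_fun subset_UNIV)+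
  let ?F = "\<lambda>x v. \<Sum>i\<in>UNIV. v $ i * tensor (h(i := h' i)) x"
  have F: "?F x (axis j 1) = tensor (h(j := h' j)) x" for x
    by (simp add: axis_def if_distrib[of "\<lambda>c. c * _"] cong: if_cong)
  have "weak_partial j (tensor h) (\<lambda>x. ?F x (axis j 1))"
  proof (rule weak_partial_classical)
    show "(tensor h has_derivative ?F x) (at x)" for x by (rule tensor_has_derivative[OF d])
    show "continuous_on UNIV (\<lambda>x. ?F x (axis j 1))"
      unfolding F by (rule continuous_tensor) (auto simp: c)
  qed
  moreover have "tensor (h(j := h' j)) x = \<alpha> $ j * sqrt (2 * real (n j)) * hermite_tensor \<alpha> \<beta> (n(j := n j - 1)) x
      - (\<alpha> $ j)\<^sup>2 * (x $ j - \<beta> $ j) * tensor h x" for x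
  proof -
    have "hermite_tensor \<alpha> \<beta> (n(j := n j - 1)) = tensor (h(j := hermite_fun (\<alpha> $ j) (\<beta> $ j) (n j - 1)))"
      unfolding hermite_tensor_eq by (rule arg_cong[where f = tensor]) (auto simp: h_def)
    then show ?thesis unfolding tensor_remove[of h x j] by (simp add: tensor_upd h'_def algebra_simps)
  qed
  moreover have "hermite_tensor \<alpha> \<beta> n = tensor h" by (simp add: hermite_tensor_eq h_def)
  ultimately show ?thesis unfolding F herm_deriv_def by simp
qed

section \<open>Orthonormality of the Hermite functions\<close>

lemma hermite_tensor_0_norm:
  assumes "\<forall>j. \<alpha> $ j > 0"
  shows "(LBINT x. hermite_tensor \<alpha> \<beta> (\<lambda>_. 0) x * hermite_tensor \<alpha> \<beta> (\<lambda>_. 0) x) = 1"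
  using tensor_L2(2)[of "\<lambda>j. hermite_fun (\<alpha> $ j) (\<beta> $ j) 0"] assms
    hermite_fun_in_L2[of _ _ 0] hermite_fun_0_norm
  by (simp add: hermite_tensor_eq power2_eq_square L2_def)

text \<open>Taking a Hermite function for \<open>u\<close> in \<open>herm_deriv_coeff\<close>
  compares lowering in \<open>m\<close> with raising in \<open>n\<close>. Lowering both indices in
  one coordinate thus reduces the sum of the entries of \<open>n\<close>, and the recursion ends at
  the ground state.\<close>

lemma hermite_tensor_orthonormal:
  fixes \<alpha> \<beta> :: "real^'n::finite"
  assumes \<alpha>: "\<forall>j. \<alpha> $ j > 0"
  shows "(LBINT x. hermite_tensor \<alpha> \<beta> m x * hermite_tensor \<alpha> \<beta> n x) = (if m = n then 1 else 0)"
proof (induction "\<Sum>j\<in>UNIV. n j" arbitrary: m n rule: less_induct)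
  case less
  let ?H = "hermite_tensor \<alpha> \<beta>"
  have step: "\<alpha> $ j * sqrt (2 * real (m j)) * (LBINT x. ?H (m(j := m j - 1)) x * ?H n x) =
      \<alpha> $ j * sqrt (2 * real (Suc (n j))) * (LBINT x. ?H m x * ?H (n(j := Suc (n j))) x)" for m n j
    using herm_deriv_coeff[OF \<alpha> hermite_tensor_in_L2[OF \<alpha>] L2_scale[OF hermite_tensor_in_L2[OF \<alpha>]] herm_deriv_hermite_tensor, where n = n]
    by (simp add: mult.assoc)
  \<comment> \<open>If \<open>m j = 0\<close>, lowering annihilates the first function, while the
    weight on the raised side is positive.\<close>
  have zero: "(LBINT x. ?H m x * ?H n x) = 0" if "m j = 0" "n j \<noteq> 0" for m n j
    using step[of j m "n(j := n j - 1)"] that \<alpha> by (simp add: less_imp_neq[symmetric])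
  show ?case
  proof (cases "\<exists>j. n j \<noteq> 0")
    case True
    then obtain j where j: "n j \<noteq> 0" by blast
    show ?thesis
    proof (cases "m j = 0")
      case True
      then show ?thesis using zero[of m j n] True j by auto
    next
      case False
      define m' where "m' = m(j := m j - 1)"
      define n' where "n' = n(j := n j - 1)"
      have "(\<Sum>j\<in>UNIV. n' j) < (\<Sum>j\<in>UNIV. n j)"
        by (rule sum_strict_mono_ex1) (use j in \<open>auto simp: n'_def\<close>)
      then have IH: "(LBINT x. ?H m' x * ?H n' x) = (if m' = n' then 1 else 0)" by (rule less)
      have n: "n = n'(j := Suc (n' j))" using j by (auto simp: n'_def)
      have "\<alpha> $ j * sqrt (2 * real (m j)) * (LBINT x. ?H m' x * ?H n' x) =
          \<alpha> $ j * sqrt (2 * real (n j)) * (LBINT x. ?H m x * ?H n x)"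
        using step[of j m n', folded n m'_def] j by (simp add: n'_def)
      then have "sqrt (real (m j)) * (if m' = n' then 1 else 0) = sqrt (real (n j)) * (LBINT x. ?H m x * ?H n x)"
        unfolding IH using \<alpha> by (simp add: real_sqrt_mult less_imp_neq[symmetric])
      moreover have "m' = n' \<longleftrightarrow> m = n"
      proof
        assume "m' = n'"
        then have "m' i = n' i" for i by simp
        then have "m i = n i" for i
          using j False by (cases "i = j") (auto simp: m'_def n'_def fun_upd_def dest!: meta_spec[of _ i])
        then show "m = n" by auto
      qed (simp add: m'_def n'_def)
      ultimately show ?thesis using j by auto
    qed
  next
    case False
    then have n: "n = (\<lambda>_. 0)" by auto
    show ?thesis
    proof (cases "m = n")
      case True
      then show ?thesis using n hermite_tensor_0_norm[OF \<alpha>] by simp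
    next
      case False
      then obtain j where "m j \<noteq> 0" using n by (auto simp: fun_eq_iff)
      then have "(LBINT x. ?H n x * ?H m x) = 0" using n by (intro zero[of _ j]) auto
      then show ?thesis using False by (simp add: mult.commute)
    qed
  qed
qed

text \<open>\<open>herm_deriv\<close> alone guarantees locally integrable versions. The coefficient
  formula is iterated through every intermediate derivative, so each link of the chain is kept in
  L2.\<close>

definition L2_herm_deriv ::
    "real^'n \<Rightarrow> real^'n \<Rightarrow> 'n::finite \<Rightarrow> (real^'n \<Rightarrow> real) \<Rightarrow> (real^'n \<Rightarrow> real) \<Rightarrow> bool" where
  "L2_herm_deriv \<alpha> \<beta> j u w \<longleftrightarrow> u \<in> L2 \<and> w \<in> L2 \<and> herm_deriv \<alpha> \<beta> j u w"

text \<open>The zeroth power is plain equality and carries no L2 information, whence the separate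
  premise on \<open>u\<close>.\<close>

lemma L2_herm_deriv_pow_L2: "(L2_herm_deriv \<alpha> \<beta> j ^^ l) u w \<Longrightarrow> u \<in> L2 \<Longrightarrow> w \<in> L2"
  by (induction l arbitrary: w) (auto simp: L2_herm_deriv_def elim!: relpowp_Suc_E)

lemma L2_herm_deriv_pow_imp: "(L2_herm_deriv \<alpha> \<beta> j ^^ l) u w \<Longrightarrow> (herm_deriv \<alpha> \<beta> j ^^ l) u w"
proof (induction l arbitrary: w)
  case (Suc l)
  then obtain v where "(L2_herm_deriv \<alpha> \<beta> j ^^ l) u v" "L2_herm_deriv \<alpha> \<beta> j v w" by (auto elim: relpowp_Suc_E)
  then show ?case using Suc.IH relpowp_Suc_I L2_herm_deriv_def by metis
qed simp

text \<open>The successive weights n_j + 1, ..., n_j + l multiply up to a rising factorial. Squaring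
  turns the products of square roots into this factorial, and squares are all that Parseval
  uses.\<close>

lemma L2_herm_deriv_pow_coeff:
  fixes \<alpha> \<beta> :: "real^'n::finite"
  assumes \<alpha>: "\<forall>j. \<alpha> $ j > 0" and "(L2_herm_deriv \<alpha> \<beta> j ^^ l) u w"
  shows "(LBINT x. w x * hermite_tensor \<alpha> \<beta> n x)\<^sup>2 =
    (2 * (\<alpha> $ j)\<^sup>2) ^ l * pochhammer (real (Suc (n j))) l * (LBINT x. u x * hermite_tensor \<alpha> \<beta> (n(j := n j + l)) x)\<^sup>2"
  using assms(2)
proof (induction l arbitrary: w n)
  case 0
  then show ?case by simp
next
  case (Suc l)
  then obtain v where v: "(L2_herm_deriv \<alpha> \<beta> j ^^ l) u v" "L2_herm_deriv \<alpha> \<beta> j v w" by (auto elim: relpowp_Suc_E)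
  have *: "(LBINT x. w x * hermite_tensor \<alpha> \<beta> n x)\<^sup>2 =
     2 * (\<alpha> $ j)\<^sup>2 * real (Suc (n j)) * (LBINT x. v x * hermite_tensor \<alpha> \<beta> (n(j := Suc (n j))) x)\<^sup>2"
    using herm_deriv_coeff[OF \<alpha>, of v w \<beta> j n] v(2) by (simp add: L2_herm_deriv_def power_mult_distrib)
  have upd: "(n(j := Suc (n j)))(j := Suc (n j) + l) = n(j := n j + Suc l)" by auto
  have "(LBINT x. v x * hermite_tensor \<alpha> \<beta> (n(j := Suc (n j))) x)\<^sup>2 =
      (2 * (\<alpha> $ j)\<^sup>2) ^ l * pochhammer (real (Suc (n j)) + 1) l * (LBINT x. u x * hermite_tensor \<alpha> \<beta> (n(j := n j + Suc l)) x)\<^sup>2"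
    using Suc.IH[OF v(1), of "n(j := Suc (n j))"] unfolding fun_upd_same upd by (simp only: of_nat_Suc add.commute)
  with * show ?case unfolding pochhammer_rec by (simp only: power_Suc mult_ac)
qed

lemma herm_deriv_diff:
  assumes 1: "herm_deriv \<alpha> \<beta> j u w" and 2: "herm_deriv \<alpha> \<beta> j u' w'"
  shows "herm_deriv \<alpha> \<beta> j (\<lambda>x. u x - c * u' x) (\<lambda>x. w x - c * w' x)"
proof -
  let ?v = "\<lambda>u w x. w x - (\<alpha> $ j)\<^sup>2 * (x $ j - \<beta> $ j) * u x"
  have li: "locally_integrable u" "locally_integrable (?v u w)" "locally_integrable u'" "locally_integrable (?v u' w')"
    using 1 2 by (auto simp: herm_deriv_def weak_partial_def)
  have eq: "?v (\<lambda>x. u x - c * u' x) (\<lambda>x. w x - c * w' x) = (\<lambda>x. ?v u w x - c * ?v u' w' x)"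
    by (simp add: fun_eq_iff algebra_simps)
  have split: "(LBINT x. (f x - c * g x) * h x) = (LBINT x. f x * h x) - c * (LBINT x. g x * h x)"
    if "locally_integrable f" "locally_integrable g" "continuous_compact_support h" for f g h :: "real^'a \<Rightarrow> real"
  proof -
    have "(LBINT x. (f x - c * g x) * h x) = (LBINT x. f x * h x - c * (g x * h x))"
      by (simp add: algebra_simps)
    also have "\<dots> = (LBINT x. f x * h x) - (LBINT x. c * (g x * h x))"
      by (intro Bochner_Integration.integral_diff integrable_mult_right integrable_mult_compact_support that)
    finally show ?thesis by simp
  qed
  show ?thesis unfolding herm_deriv_def eq weak_partial_def
  proof (intro conjI allI impI)
    fix \<phi> :: "real^'a \<Rightarrow> real" assume \<phi>: "test_function \<phi>"
    show "(LBINT x. (u x - c * u' x) * frechet_derivative \<phi> (at x) (axis j 1)) = - (LBINT x. (?v u w x - c * ?v u' w' x) * \<phi> x)"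
      unfolding split[OF li(1,3) test_function_derivative[OF \<phi>]] split[OF li(2,4) test_function_continuous[OF \<phi>]]
      using 1 2 \<phi> unfolding herm_deriv_def weak_partial_def by (simp add: algebra_simps)
  qed (intro locally_integrable_diff li)+
qed

lemma L2_herm_deriv_pow_diff:
  "(L2_herm_deriv \<alpha> \<beta> j ^^ l) u w \<Longrightarrow> (L2_herm_deriv \<alpha> \<beta> j ^^ l) u' w' \<Longrightarrow>
   (L2_herm_deriv \<alpha> \<beta> j ^^ l) (\<lambda>x. u x - c * u' x) (\<lambda>x. w x - c * w' x)"
proof (induction l arbitrary: w w')
  case 0
  then show ?case by simp
next
  case (Suc l)
  obtain v v' where v: "(L2_herm_deriv \<alpha> \<beta> j ^^ l) u v" "L2_herm_deriv \<alpha> \<beta> j v w"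
    "(L2_herm_deriv \<alpha> \<beta> j ^^ l) u' v'" "L2_herm_deriv \<alpha> \<beta> j v' w'"
    using Suc.prems by (elim relpowp_Suc_E) blast
  have "L2_herm_deriv \<alpha> \<beta> j (\<lambda>x. v x - c * v' x) (\<lambda>x. w x - c * w' x)"
    using v(2,4) L2_lincomb[of v v' "- c"] L2_lincomb[of w w' "- c"] by (auto simp: L2_herm_deriv_def herm_deriv_diff)
  then show ?case using Suc.IH[OF v(1,3)] by (intro relpowp_Suc_I)
qed

text \<open>Existence of a chain is enough, for \<open>L2_herm_deriv_pow_coeff\<close> then supplies
  the squared coefficients. The induction carries the explicit form, a multiple of one Hermite
  function.\<close>

lemma L2_herm_deriv_pow_hermite_tensor:
  fixes \<alpha> \<beta> :: "real^'n::finite"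
  assumes \<alpha>: "\<forall>j. \<alpha> $ j > 0"
  shows "\<exists>w. (L2_herm_deriv \<alpha> \<beta> j ^^ l) (hermite_tensor \<alpha> \<beta> n) w"
proof -
  have base: "L2_herm_deriv \<alpha> \<beta> j (\<lambda>x. c * hermite_tensor \<alpha> \<beta> n x)
      (\<lambda>x. c * (\<alpha> $ j * sqrt (2 * real (n j))) * hermite_tensor \<alpha> \<beta> (n(j := n j - 1)) x)" for c n
  proof -
    let ?H = "hermite_tensor \<alpha> \<beta> n" and ?H' = "\<lambda>x. \<alpha> $ j * sqrt (2 * real (n j)) * hermite_tensor \<alpha> \<beta> (n(j := n j - 1)) x"
    \<comment> \<open>Scaling by \<open>c\<close> is written as subtracting the multiple 1 - c, so
      linearity in the form of \<open>herm_deriv_diff\<close> covers it.\<close>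
    have "herm_deriv \<alpha> \<beta> j (\<lambda>x. ?H x - (1 - c) * ?H x) (\<lambda>x. ?H' x - (1 - c) * ?H' x)"
      by (intro herm_deriv_diff herm_deriv_hermite_tensor)
    moreover have "(\<lambda>x. ?H x - (1 - c) * ?H x) = (\<lambda>x. c * ?H x)" "(\<lambda>x. ?H' x - (1 - c) * ?H' x) = (\<lambda>x. c * (\<alpha> $ j * sqrt (2 * real (n j))) * hermite_tensor \<alpha> \<beta> (n(j := n j - 1)) x)"
      by (auto simp: fun_eq_iff algebra_simps)
    ultimately show ?thesis using hermite_tensor_in_L2[OF \<alpha>] by (simp add: L2_herm_deriv_def L2_scale)
  qed
  have "\<exists>c m. (L2_herm_deriv \<alpha> \<beta> j ^^ l) (hermite_tensor \<alpha> \<beta> n) (\<lambda>x. c * hermite_tensor \<alpha> \<beta> m x)"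
  proof (induction l)
    case 0
    show ?case by (rule exI[of _ 1], rule exI[of _ n]) simp
  next
    case (Suc l)
    then show ?case using base by (blast intro: relpowp_Suc_I)
  qed
  then show ?thesis by blast
qed

lemma L2_herm_deriv_pow_diff_sum:
  fixes \<alpha> \<beta> :: "real^'n::finite"
  assumes \<alpha>: "\<forall>j. \<alpha> $ j > 0" and "finite S" and u: "(L2_herm_deriv \<alpha> \<beta> j ^^ l) u w"
  shows "\<exists>w'. (L2_herm_deriv \<alpha> \<beta> j ^^ l) (\<lambda>x. u x - (\<Sum>n\<in>S. c n * hermite_tensor \<alpha> \<beta> n x)) w'"
  using assms(2)
proof (induction S)
  case empty
  then show ?case using u by auto
next
  case (insert n S)
  obtain w1 where w1: "(L2_herm_deriv \<alpha> \<beta> j ^^ l) (\<lambda>x. u x - (\<Sum>n\<in>S. c n * hermite_tensor \<alpha> \<beta> n x)) w1" using insert by blast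
  obtain w2 where w2: "(L2_herm_deriv \<alpha> \<beta> j ^^ l) (hermite_tensor \<alpha> \<beta> n) w2" using L2_herm_deriv_pow_hermite_tensor[OF \<alpha>] by blast
  have "(\<lambda>x. u x - (\<Sum>n\<in>insert n S. c n * hermite_tensor \<alpha> \<beta> n x)) =
    (\<lambda>x. (u x - (\<Sum>n\<in>S. c n * hermite_tensor \<alpha> \<beta> n x)) - c n * hermite_tensor \<alpha> \<beta> n x)"
    using insert by (auto simp: fun_eq_iff)
  then show ?case using L2_herm_deriv_pow_diff[OF w1 w2, of "c n"] by auto
qed

subsection \<open>Completeness of the Hermite functions\<close>

lemma partial_exp_sum_le:
  fixes y :: real assumes "y \<ge> 0"
  shows "(\<Sum>k<n. y ^ k /\<^sub>R fact k) \<le> exp y"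
  using sum_le_suminf[OF summable_exp_generic[of y], of "{..<n}"] assms by (simp add: exp_def)

lemma power_le_fact_exp:
  fixes y :: real assumes "y \<ge> 0"
  shows "y ^ k \<le> fact k * exp y"
proof -
  have "y ^ k /\<^sub>R fact k \<le> (\<Sum>i<Suc k. y ^ i /\<^sub>R fact i)"
    using assms by (simp add: sum_nonneg)
  also have "\<dots> \<le> exp y" by (rule partial_exp_sum_le[OF assms])
  finally show ?thesis by (simp add: field_simps)
qed

text \<open>If all moments of the signed measure \<open>y\<^sub>* (G M)\<close> vanish, then so does its Fourier transform,
  by the power series of \<open>exp (i t y)\<close>. Uniqueness of characteristic functions applies to the two
  normalised halves of its Jordan decomposition.\<close>

lemma fourier_zero_if_moments_zero:
  fixes G y :: "'a \<Rightarrow> real"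
  assumes [measurable]: "G \<in> borel_measurable M" "y \<in> borel_measurable M"
    and int: "\<And>t. integrable M (\<lambda>x. G x * exp (t * \<bar>y x\<bar>))"
    and mom: "\<And>k. (LINT x|M. G x * y x ^ k) = 0"
  shows "(CLINT x|M. of_real (G x) * iexp (t * y x)) = 0"
proof -
  have mint: "integrable M (\<lambda>x. G x * y x ^ k)" for k
  proof (rule Bochner_Integration.integrable_bound)
    show "integrable M (\<lambda>x. fact k * (G x * exp (1 * \<bar>y x\<bar>)))" by (intro integrable_mult_right int)
    show "AE x in M. norm (G x * y x ^ k) \<le> norm (fact k * (G x * exp (1 * \<bar>y x\<bar>)))"
    proof (rule AE_I2)
      fix x
      show "norm (G x * y x ^ k) \<le> norm (fact k * (G x * exp (1 * \<bar>y x\<bar>)))"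
        using mult_left_mono[OF power_le_fact_exp[of "\<bar>y x\<bar>" k], of "\<bar>G x\<bar>"]
        by (simp add: abs_mult power_abs mult.left_commute)
    qed
  qed simp
  define s where "s = (\<lambda>n x. of_real (G x) * (\<Sum>k<n. (\<i> * of_real (t * y x)) ^ k /\<^sub>R fact k))"
  have s0: "(CLINT x|M. s n x) = 0" for n
  proof -
    have z: "(CLINT x|M. ((\<i> * of_real t) ^ k /\<^sub>R fact k) * of_real (G x * y x ^ k)) = 0" for k
    proof -
      have "(CLINT x|M. ((\<i> * of_real t) ^ k /\<^sub>R fact k) * of_real (G x * y x ^ k)) =
        ((\<i> * of_real t) ^ k /\<^sub>R fact k) * (CLINT x|M. of_real (G x * y x ^ k))" by (rule integral_mult_right_zero)
      also have "(CLINT x|M. complex_of_real (G x * y x ^ k)) = of_real (LINT x|M. G x * y x ^ k)"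
        by (rule integral_complex_of_real)
      finally show ?thesis by (simp add: mom)
    qed
    have "s n x = (\<Sum>k<n. ((\<i> * of_real t) ^ k /\<^sub>R fact k) * of_real (G x * y x ^ k))" for x
      unfolding s_def sum_distrib_left by (rule sum.cong) (auto simp: power_mult_distrib mult_ac)
    then have "(CLINT x|M. s n x) = (\<Sum>k<n. CLINT x|M. ((\<i> * of_real t) ^ k /\<^sub>R fact k) * of_real (G x * y x ^ k))"
      using mint by (simp only:) (intro Bochner_Integration.integral_sum integrable_mult_right integrable_of_real, auto)
    also have "\<dots> = 0" by (rule sum.neutral) (use z in blast)
    finally show ?thesis .
  qed
  have "(\<lambda>n. CLINT x|M. s n x) \<longlonglongrightarrow> (CLINT x|M. of_real (G x) * iexp (t * y x))"
  proof (rule integral_dominated_convergence[where w = "\<lambda>x. \<bar>G x * exp (\<bar>t\<bar> * \<bar>y x\<bar>)\<bar>"])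
    show "integrable M (\<lambda>x. \<bar>G x * exp (\<bar>t\<bar> * \<bar>y x\<bar>)\<bar>)" by (intro integrable_abs int)
    show "AE x in M. (\<lambda>n. s n x) \<longlonglongrightarrow> of_real (G x) * iexp (t * y x)"
      unfolding s_def using exp_converges[unfolded sums_def] by (intro AE_I2 tendsto_mult_left) blast
    show "AE x in M. norm (s n x) \<le> \<bar>G x * exp (\<bar>t\<bar> * \<bar>y x\<bar>)\<bar>" for n
    proof (rule AE_I2)
      fix x
      have "norm (\<Sum>k<n. (\<i> * of_real (t * y x)) ^ k /\<^sub>R fact k :: complex) \<le> (\<Sum>k<n. (\<bar>t\<bar> * \<bar>y x\<bar>) ^ k /\<^sub>R fact k)"
        by (rule sum_norm_le) (simp add: norm_mult norm_power power_mult_distrib abs_mult)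
      also have "\<dots> \<le> exp (\<bar>t\<bar> * \<bar>y x\<bar>)" by (rule partial_exp_sum_le) simp
      finally show "norm (s n x) \<le> \<bar>G x * exp (\<bar>t\<bar> * \<bar>y x\<bar>)\<bar>"
        unfolding s_def norm_mult abs_mult by (auto intro: mult_left_mono)
    qed
  qed (simp_all add: s_def)
  then show ?thesis by (simp add: s0 LIMSEQ_const_iff)
qed

lemma integral_indicator_zero_if_moments_zero:
  fixes G y :: "'a \<Rightarrow> real"
  assumes [measurable]: "G \<in> borel_measurable M" "y \<in> borel_measurable M"
    and int: "\<And>t. integrable M (\<lambda>x. G x * exp (t * \<bar>y x\<bar>))"
    and mom: "\<And>k. (LINT x|M. G x * y x ^ k) = 0"
    and B[measurable]: "B \<in> sets borel"
  shows "(LINT x|M. G x * indicator B (y x)) = 0"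
proof -
  define P N where "P = (\<lambda>x. max 0 (G x))" and "N = (\<lambda>x. max 0 (- G x))"
  have PN: "P x - N x = G x" "0 \<le> P x" "0 \<le> N x" "\<bar>P x\<bar> \<le> \<bar>G x\<bar>" "\<bar>N x\<bar> \<le> \<bar>G x\<bar>" for x by (auto simp: P_def N_def)
  have [measurable]: "P \<in> borel_measurable M" "N \<in> borel_measurable M" unfolding P_def N_def by measurable
  have Gi: "integrable M G" using int[of 0] by simp
  have Pi: "integrable M P" by (rule Bochner_Integration.integrable_bound[OF Gi]) (use PN in auto)
  have Ni: "integrable M N" by (rule Bochner_Integration.integrable_bound[OF Gi]) (use PN in auto)
  have ind: "integrable M (\<lambda>x. F x * indicator B (y x))" if "integrable M F" for F :: "'a \<Rightarrow> real"
  proof -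
    have [measurable]: "F \<in> borel_measurable M" using that by auto
    show ?thesis by (rule Bochner_Integration.integrable_bound[OF that]) (auto simp: indicator_def)
  qed
  \<comment> \<open>The zeroth moment of \<open>G\<close> vanishes, so \<open>P\<close> and
    \<open>N\<close> have the same mass \<open>m\<close>. If it is 0, then \<open>G\<close> vanishes
    almost everywhere; otherwise both can be normalised by it.\<close>
  define m where "m = (LINT x|M. P x)"
  have "(LINT x|M. G x) = m - (LINT x|M. N x)"
    unfolding m_def PN(1)[symmetric] using Pi Ni by (rule Bochner_Integration.integral_diff)
  then have mN: "(LINT x|M. N x) = m" using mom[of 0] by simp
  have split: "(LINT x|M. G x * indicator B (y x)) = (LINT x|M. P x * indicator B (y x)) - (LINT x|M. N x * indicator B (y x))"
    unfolding PN(1)[symmetric] left_diff_distrib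
    by (intro Bochner_Integration.integral_diff ind Pi Ni)
  show ?thesis
  proof (cases "m = 0")
    case True
    have "AE x in M. P x = 0" using integral_nonneg_eq_0_iff_AE[OF Pi] PN True m_def by auto
    moreover have "AE x in M. N x = 0" using integral_nonneg_eq_0_iff_AE[OF Ni] PN True mN by auto
    ultimately have "AE x in M. G x * indicator B (y x) = 0"
      by eventually_elim (metis PN(1) diff_zero mult_zero_left)
    then show ?thesis by (subst integral_cong_AE[where g = "\<lambda>_. 0"]) auto
  next
    case False
    moreover have "0 \<le> m" unfolding m_def by (rule Bochner_Integration.integral_nonneg) (rule PN)
    ultimately have m: "m > 0" by simp
    \<comment> \<open>The law of \<open>y\<close> under the probability density
      \<open>F / m\<close>. Equality of the laws for \<open>P\<close> and \<open>N\<close> on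
      \<open>B\<close> is the claim.\<close>
    define D where "D = (\<lambda>F. distr (density M (\<lambda>x. ennreal (F x / m))) borel y)"
    have Dm: "real_distribution (D F)"
      and Dc: "char (D F) t = (CLINT x|M. of_real (F x) * iexp (t * y x)) / m"
      and Db: "measure (D F) B = (LINT x|M. F x * indicator B (y x)) / m"
      if F: "integrable M F" "\<And>x. F x \<ge> 0" "(LINT x|M. F x) = m" for F t
    proof -
      have [measurable]: "F \<in> borel_measurable M" using F(1) by auto
      have Fi: "integrable M (\<lambda>x. F x / m)" using F(1) by simp
      have "(\<integral>\<^sup>+x. ennreal (F x / m) \<partial>M) = ennreal (LINT x|M. F x / m)"
        using Fi F(2) m by (intro nn_integral_eq_integral) auto
      also have "\<dots> = 1" using F(3) m by simp
      finally have "prob_space (density M (\<lambda>x. ennreal (F x / m)))"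
        by (intro prob_spaceI) (simp add: emeasure_density cong: nn_integral_cong)
      then have "prob_space (D F)" unfolding D_def by (rule prob_space.prob_space_distr) simp
      then show "real_distribution (D F)"
        unfolding real_distribution_def real_distribution_axioms_def by (simp add: D_def)
      have "char (D F) t = (CLINT x|density M (\<lambda>x. ennreal (F x / m)). iexp (t * y x))"
        unfolding char_def D_def by (rule integral_distr) auto
      also have "\<dots> = (CLINT x|M. (F x / m) *\<^sub>R iexp (t * y x))"
        using F(2) m by (intro integral_density) auto
      also have "\<dots> = (CLINT x|M. (of_real (F x) * iexp (t * y x)) / m)"
        by (simp add: scaleR_conv_of_real)
      finally show "char (D F) t = (CLINT x|M. of_real (F x) * iexp (t * y x)) / m" by simp
      have "measure (D F) B = (LINT x|D F. indicator B x)" by (simp add: D_def)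
      also have "\<dots> = (LINT x|density M (\<lambda>x. ennreal (F x / m)). indicator B (y x))"
        unfolding D_def by (rule integral_distr) auto
      also have "\<dots> = (LINT x|M. (F x / m) *\<^sub>R indicator B (y x))"
        using F(2) m by (intro integral_density) auto
      finally show "measure (D F) B = (LINT x|M. F x * indicator B (y x)) / m" by simp
    qed
    have "char (D P) t = char (D N) t" for t
    proof -
      have i: "integrable M (\<lambda>x. complex_of_real (F x) * iexp (t * y x))" if "integrable M F" for F
      proof -
        have [measurable]: "F \<in> borel_measurable M" using that by auto
        show ?thesis by (rule Bochner_Integration.integrable_bound[OF that]) (auto simp: norm_mult)
      qed
      have "(CLINT x|M. complex_of_real (P x) * iexp (t * y x)) - (CLINT x|M. complex_of_real (N x) * iexp (t * y x))
        = (CLINT x|M. complex_of_real (P x) * iexp (t * y x) - complex_of_real (N x) * iexp (t * y x))"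
        by (rule Bochner_Integration.integral_diff[symmetric]) (rule i Pi Ni)+
      also have "\<dots> = (CLINT x|M. of_real (G x) * iexp (t * y x))"
        unfolding PN(1)[symmetric] by (simp add: left_diff_distrib)
      also have "\<dots> = 0" by (rule fourier_zero_if_moments_zero[OF assms(1,2) int mom])
      finally show ?thesis using Dc[OF Pi PN(2)] Dc[OF Ni PN(3) mN] by (simp add: m_def)
    qed
    then have "D P = D N"
      using Dm[OF Pi PN(2)] Dm[OF Ni PN(3) mN] by (intro Levy_uniqueness) (auto simp: m_def)
    then have "(LINT x|M. P x * indicator B (y x)) / m = (LINT x|M. N x * indicator B (y x)) / m"
      using Db[OF Pi PN(2) m_def[symmetric]] Db[OF Ni PN(3) mN] by metis
    then show ?thesis unfolding split using m by simp
  qed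
qed

lemma hermite_fun_power_in_L2:
  assumes "a > 0"
  shows "(\<lambda>x. (x - b) ^ k * hermite_fun a b n x) \<in> L2"
    and "(\<lambda>x. hermite_fun a b n x * exp (t * \<bar>x - b\<bar>)) \<in> L2"
proof -
  show e: "(\<lambda>x. hermite_fun a b n x * exp (t * \<bar>x - b\<bar>)) \<in> L2" for t
    using hermite_fun_exp_square_integrable[OF assms] by (simp add: L2_def)
  show "(\<lambda>x. (x - b) ^ k * hermite_fun a b n x) \<in> L2"
  proof (rule L2_dominated[OF L2_scale[OF e[of 1], of "fact k"]])
    show "\<bar>(x - b) ^ k * hermite_fun a b n x\<bar> \<le> \<bar>fact k * (hermite_fun a b n x * exp (1 * \<bar>x - b\<bar>))\<bar>" for x
      using mult_right_mono[OF power_le_fact_exp[of "\<bar>x - b\<bar>" k], of "\<bar>hermite_fun a b n x\<bar>"]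
      by (simp add: abs_mult power_abs mult_ac)
  qed simp
qed

text \<open>Coordinates are localised one at a time. In those of \<open>J\<close> the Hermite factor
  is replaced by the ground state times an indicator; the remaining factors stay arbitrary, so
  orthogonality in the next coordinate yields all its moments. With \<open>J\<close> exhausted,
  \<open>f\<close> times a positive Gaussian integrates to 0 over every box.\<close>

lemma hermite_tensor_complete:
  fixes \<alpha> \<beta> :: "real^'n::finite" and f :: "real^'n \<Rightarrow> real"
  assumes \<alpha>: "\<forall>j. \<alpha> $ j > 0" and f: "f \<in> L2"
    and zero: "\<And>n. (LBINT x. f x * hermite_tensor \<alpha> \<beta> n x) = 0"
  shows "AE x in lborel. f x = 0"
proof -
  note fm[measurable] = L2_measurable[OF f]
  define h where "h = (\<lambda>j. hermite_fun (\<alpha> $ j) (\<beta> $ j))"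
  have hL2: "h j n \<in> L2" for j n unfolding h_def using \<alpha> hermite_fun_in_L2 by auto
  define Q where "Q = (\<lambda>J B n j x. if j \<in> J then h j 0 x * indicator (B j) x else h j (n j) x)"
  have hB: "(\<lambda>x. h j 0 x * indicator C x) \<in> L2" if [measurable]: "C \<in> sets borel" for j C
    by (rule L2_dominated[OF hL2[of j 0]]) (use L2_measurable[OF hL2[of j 0]] in \<open>auto simp: indicator_def\<close>)
  have QL2: "Q J B n j \<in> L2" if "\<And>j. B j \<in> sets borel" for J B n j
    unfolding Q_def by (cases "j \<in> J") (auto simp: hL2 hB that)
  have main: "(LBINT x. f x * tensor (Q J B n) x) = 0" if "\<And>j. B j \<in> sets borel" "finite J" for J B n
    using that(2)
  proof (induction J arbitrary: n)
    case empty
    then show ?case using zero[of n] by (simp add: Q_def hermite_tensor_eq h_def)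
  next
    case (insert i J)
    have q: "tensor ((Q J B n)(i := g)) \<in> L2" if "g \<in> L2" for g
      by (rule tensor_in_L2) (use QL2 insert that \<open>\<And>j. B j \<in> sets borel\<close> in auto)
    have qi: "integrable lborel (\<lambda>x. f x * tensor ((Q J B n)(i := g)) x)" if "g \<in> L2" for g
      by (rule L2_mult_integrable[OF f q[OF that]])
    \<comment> \<open>By the three-term recurrence, multiplication by x - beta_i sends h_r to a
      combination of h_(r+1) and h_(r-1). Every moment thus reduces to \<open>k = 0\<close>, the
      induction hypothesis for \<open>J\<close>.\<close>
    have mom: "(LBINT x. f x * tensor ((Q J B n)(i := \<lambda>x. (x - \<beta> $ i) ^ k * h i r x)) x) = 0" for k r
    proof (induction k arbitrary: r)
      case 0
      have eq: "Q J B (n(i := r)) = (Q J B n)(i := \<lambda>x. (x - \<beta> $ i) ^ 0 * h i r x)"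
        using insert.hyps by (auto simp: Q_def fun_eq_iff)
      show ?case unfolding eq[symmetric] by (rule insert.IH)
    next
      case (Suc k)
      define a where "a = \<alpha> $ i"
      have a: "a > 0" using \<alpha> by (simp add: a_def)
      define c1 c2 where "c1 = a * sqrt (2 * real (Suc r)) / (2 * a\<^sup>2)" and "c2 = a * sqrt (2 * real r) / (2 * a\<^sup>2)"
      let ?g = "\<lambda>k r x. (x - \<beta> $ i) ^ k * h i r x"
      have gL2: "?g k r \<in> L2" for k r unfolding h_def using hermite_fun_power_in_L2(1) \<alpha> by auto
      have E: "(x - \<beta> $ i) * h i r x = c1 * h i (Suc r) x + c2 * h i (r - 1) x" for x
        using hermite_fun_Suc[of a r "\<beta> $ i" x] a unfolding h_def c1_def c2_def a_def[symmetric]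
        by (simp add: field_simps)
      have "?g (Suc k) r x = (x - \<beta> $ i) ^ k * ((x - \<beta> $ i) * h i r x)" for x by simp
      then have "?g (Suc k) r x = c1 * ?g k (Suc r) x + c2 * ?g k (r - 1) x" for x
        unfolding E by (simp add: distrib_left mult.left_commute)
      then have "f x * tensor ((Q J B n)(i := ?g (Suc k) r)) x =
          c1 * (f x * tensor ((Q J B n)(i := ?g k (Suc r))) x) + c2 * (f x * tensor ((Q J B n)(i := ?g k (r - 1))) x)" for x
        unfolding tensor_upd by (simp add: algebra_simps)
      then have "(LBINT x. f x * tensor ((Q J B n)(i := ?g (Suc k) r)) x) =
          (LBINT x. c1 * (f x * tensor ((Q J B n)(i := ?g k (Suc r))) x) + c2 * (f x * tensor ((Q J B n)(i := ?g k (r - 1))) x))"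
        by presburger
      also have "\<dots> = (LBINT x. c1 * (f x * tensor ((Q J B n)(i := ?g k (Suc r))) x)) + (LBINT x. c2 * (f x * tensor ((Q J B n)(i := ?g k (r - 1))) x))"
        by (rule Bochner_Integration.integral_add) (rule integrable_mult_right qi gL2)+
      also have "\<dots> = 0" unfolding integral_mult_right_zero Suc.IH by simp
      finally show ?case .
    qed
    define G where "G = (\<lambda>x. f x * tensor ((Q J B n)(i := h i 0)) x)"
    have [measurable]: "G \<in> borel_measurable lborel"
      using L2_measurable[OF q[OF hL2]] unfolding G_def by simp
    \<comment> \<open>The moments are taken about beta_i, so the target set is translated
      accordingly.\<close>
    define C where "C = (\<lambda>y. y + \<beta> $ i) -` B i"
    have C: "C \<in> sets borel"
      using measurable_sets_borel[of "\<lambda>y. y + \<beta> $ i" borel "B i"] that(1) by (simp add: C_def)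
    have "(LBINT x. G x * indicator C (x $ i - \<beta> $ i)) = 0"
    proof (rule integral_indicator_zero_if_moments_zero[OF _ _ _ _ C])
      show "(\<lambda>x. x $ i - \<beta> $ i) \<in> borel_measurable lborel" by simp
      show "integrable lborel (\<lambda>x. G x * exp (t * \<bar>x $ i - \<beta> $ i\<bar>))" for t
      proof -
        have "(\<lambda>x. h i 0 x * exp (t * \<bar>x - \<beta> $ i\<bar>)) \<in> L2"
          unfolding h_def using hermite_fun_power_in_L2(2) \<alpha> by auto
        from qi[OF this] show ?thesis unfolding G_def tensor_upd by (simp add: mult_ac)
      qed
      show "(LBINT x. G x * (x $ i - \<beta> $ i) ^ k) = 0" for k
        using mom[of k 0] unfolding G_def tensor_upd by (simp add: mult_ac)
    qed simp
    moreover have "G x * indicator C (x $ i - \<beta> $ i) = f x * tensor (Q (insert i J) B n) x" for x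
    proof -
      have "Q (insert i J) B n = (Q J B n)(i := \<lambda>x. h i 0 x * indicator (B i) x)"
        by (auto simp: Q_def fun_eq_iff)
      then show ?thesis unfolding G_def tensor_upd C_def by (simp add: tensor_upd indicator_def)
    qed
    ultimately show ?case by simp
  qed
  have "AE x in lborel. f x * tensor (\<lambda>j. h j 0) x = 0"
  proof (rule AE_zero_if_box_integrals_zero)
    have t: "tensor (\<lambda>j. h j 0) \<in> L2" by (intro tensor_in_L2 hL2)
    show m: "(\<lambda>x. f x * tensor (\<lambda>j. h j 0) x) \<in> borel_measurable borel"
      using L2_measurable[OF t] by simp
    have i: "integrable lborel (\<lambda>x. f x * tensor (\<lambda>j. h j 0) x)" by (rule L2_mult_integrable[OF f t])
    fix a b :: "real^'n"
    show "integrable lborel (\<lambda>x. f x * tensor (\<lambda>j. h j 0) x * indicator (box a b) x)"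
      by (rule Bochner_Integration.integrable_bound[OF i]) (use m in \<open>auto simp: indicator_def\<close>)
    let ?B = "\<lambda>j. {a $ j <..< b $ j}"
    have eq: "f x * tensor (\<lambda>j. h j 0) x * indicator (box a b) x = f x * tensor (Q UNIV ?B (\<lambda>_. 0)) x" for x
    proof -
      have "(\<Prod>j\<in>UNIV. indicator (?B j) (x $ j)) = (indicator (box a b) x :: real)"
        by (auto simp: indicator_def mem_box_cart)
      then show ?thesis by (simp add: Q_def tensor_def prod.distrib)
    qed
    show "(LBINT x. f x * tensor (\<lambda>j. h j 0) x * indicator (box a b) x) = 0"
      unfolding eq by (rule main) simp_all
  qed
  moreover have "tensor (\<lambda>j. h j 0) x \<noteq> 0" for x
    using \<alpha> by (auto simp: tensor_def h_def hermite_fun_0 less_imp_neq[symmetric])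
  ultimately show ?thesis by simp
qed

subsection \<open>Parseval\<close>

text \<open>A weighted arithmetic-geometric mean in place of Cauchy-Schwarz. The free weight is
  later 2^k, which balances squared norms of size 4^(-k).\<close>

lemma integral_abs_mult_le:
  assumes f: "f \<in> L2" and g: "g \<in> L2" and r: "r > 0"
  shows "(LBINT x. \<bar>f x * g x\<bar>) \<le> (r * (LBINT x. (f x)\<^sup>2) + (LBINT x. (g x)\<^sup>2) / r) / 2"
proof -
  have i: "integrable lborel (\<lambda>x. (f x)\<^sup>2)" "integrable lborel (\<lambda>x. (g x)\<^sup>2)" using f g by (auto simp: L2_def)
  have "(LBINT x. \<bar>f x * g x\<bar>) \<le> (LBINT x. r / 2 * (f x)\<^sup>2 + 1 / (2 * r) * (g x)\<^sup>2)"
  proof (rule integral_mono)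
    show "integrable lborel (\<lambda>x. \<bar>f x * g x\<bar>)" by (intro integrable_abs L2_mult_integrable f g)
    show "integrable lborel (\<lambda>x. r / 2 * (f x)\<^sup>2 + 1 / (2 * r) * (g x)\<^sup>2)"
      using i by (intro Bochner_Integration.integrable_add integrable_mult_right)
    fix x
    have "0 \<le> (r * \<bar>f x\<bar> - \<bar>g x\<bar>)\<^sup>2" by simp
    then have "2 * r * \<bar>f x * g x\<bar> \<le> r\<^sup>2 * (f x)\<^sup>2 + (g x)\<^sup>2"
      by (simp add: power2_diff power_mult_distrib abs_mult algebra_simps)
    then show "\<bar>f x * g x\<bar> \<le> r / 2 * (f x)\<^sup>2 + 1 / (2 * r) * (g x)\<^sup>2"
      using r by (simp add: field_simps power2_eq_square)
  qed
  also have "\<dots> = (LBINT x. r / 2 * (f x)\<^sup>2) + (LBINT x. 1 / (2 * r) * (g x)\<^sup>2)"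
    using i by (intro Bochner_Integration.integral_add integrable_mult_right)
  finally show ?thesis using r by (simp add: field_simps)
qed

lemma integral_square_diff:
  assumes f: "f \<in> L2" and g: "g \<in> L2"
  shows "(LBINT x. (f x - g x)\<^sup>2) = (LBINT x. (f x)\<^sup>2) - 2 * (LBINT x. f x * g x) + (LBINT x. (g x)\<^sup>2)"
proof -
  have i: "integrable lborel (\<lambda>x. (f x)\<^sup>2)" "integrable lborel (\<lambda>x. (g x)\<^sup>2)" "integrable lborel (\<lambda>x. 2 * (f x * g x))"
    using f g L2_mult_integrable[OF f g] by (auto simp: L2_def)
  have "(LBINT x. (f x - g x)\<^sup>2) = (LBINT x. ((f x)\<^sup>2 - 2 * (f x * g x)) + (g x)\<^sup>2)"
    by (simp add: power2_diff algebra_simps)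
  also have "\<dots> = (LBINT x. (f x)\<^sup>2) - (LBINT x. 2 * (f x * g x)) + (LBINT x. (g x)\<^sup>2)"
    using i by (simp only: Bochner_Integration.integral_add Bochner_Integration.integral_diff Bochner_Integration.integrable_diff)
  finally show ?thesis by simp
qed

lemma integral_mult_sum:
  assumes f: "f \<in> L2" and e: "\<And>n. n \<in> F \<Longrightarrow> e n \<in> L2"
  shows "(LBINT x. f x * (\<Sum>n\<in>F. c n * e n x)) = (\<Sum>n\<in>F. c n * (LBINT x. f x * e n x))"
proof -
  have "(LBINT x. f x * (\<Sum>n\<in>F. c n * e n x)) = (LBINT x. (\<Sum>n\<in>F. c n * (f x * e n x)))"
    by (simp add: sum_distrib_left mult.left_commute)
  also have "\<dots> = (\<Sum>n\<in>F. LBINT x. c n * (f x * e n x))"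
    by (intro Bochner_Integration.integral_sum integrable_mult_right L2_mult_integrable f e)
  finally show ?thesis by simp
qed

lemma hermite_sum_coeff:
  fixes \<alpha> \<beta> :: "real^'n::finite"
  assumes \<alpha>: "\<forall>j. \<alpha> $ j > 0" and F: "finite F"
  shows "(LBINT x. (\<Sum>n\<in>F. c n * hermite_tensor \<alpha> \<beta> n x) * hermite_tensor \<alpha> \<beta> m x) = (if m \<in> F then c m else 0)"
proof -
  have "(LBINT x. (\<Sum>n\<in>F. c n * hermite_tensor \<alpha> \<beta> n x) * hermite_tensor \<alpha> \<beta> m x)
      = (LBINT x. hermite_tensor \<alpha> \<beta> m x * (\<Sum>n\<in>F. c n * hermite_tensor \<alpha> \<beta> n x))"
    by (simp add: mult.commute)
  also have "\<dots> = (\<Sum>n\<in>F. c n * (if m = n then 1 else 0))"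
    by (simp add: integral_mult_sum hermite_tensor_in_L2[OF \<alpha>] hermite_tensor_orthonormal[OF \<alpha>])
  also have "\<dots> = (if m \<in> F then c m else 0)"
    using F by (simp add: if_distrib[of "\<lambda>z. c _ * z"] sum.delta' cong: if_cong)
  finally show ?thesis .
qed

lemma hermite_sum_norm:
  fixes \<alpha> \<beta> :: "real^'n::finite"
  assumes \<alpha>: "\<forall>j. \<alpha> $ j > 0" and F: "finite F"
  shows "(LBINT x. (\<Sum>n\<in>F. c n * hermite_tensor \<alpha> \<beta> n x)\<^sup>2) = (\<Sum>n\<in>F. (c n)\<^sup>2)"
proof -
  have L: "(\<lambda>x. \<Sum>n\<in>F. c n * hermite_tensor \<alpha> \<beta> n x) \<in> L2"
    by (intro L2_sum L2_scale hermite_tensor_in_L2 \<alpha>)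
  show ?thesis unfolding power2_eq_square
    by (subst integral_mult_sum[OF L hermite_tensor_in_L2[OF \<alpha>]]) (simp add: hermite_sum_coeff[OF \<alpha> F])
qed

lemma hermite_bessel:
  fixes \<alpha> \<beta> :: "real^'n::finite"
  assumes \<alpha>: "\<forall>j. \<alpha> $ j > 0" and F: "finite F" and w: "w \<in> L2"
  shows "(\<Sum>n\<in>F. (LBINT x. w x * hermite_tensor \<alpha> \<beta> n x)\<^sup>2) \<le> (LBINT x. (w x)\<^sup>2)"
proof -
  define c where "c = (\<lambda>n. LBINT x. w x * hermite_tensor \<alpha> \<beta> n x)"
  let ?s = "\<lambda>x. \<Sum>n\<in>F. c n * hermite_tensor \<alpha> \<beta> n x"
  have L: "?s \<in> L2" by (intro L2_sum L2_scale hermite_tensor_in_L2 \<alpha>)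
  have "0 \<le> (LBINT x. (w x - ?s x)\<^sup>2)" by simp
  also have "\<dots> = (LBINT x. (w x)\<^sup>2) - 2 * (\<Sum>n\<in>F. (c n)\<^sup>2) + (\<Sum>n\<in>F. (c n)\<^sup>2)"
    unfolding integral_square_diff[OF w L] hermite_sum_norm[OF \<alpha> F]
    by (subst integral_mult_sum[OF w hermite_tensor_in_L2[OF \<alpha>]]) (simp add: c_def power2_eq_square)
  finally show ?thesis by (simp add: c_def)
qed

text \<open>Riesz--Fischer for a sequence with geometrically decreasing increments; the almost everywhere
  convergence is obtained by integrating against a positive weight \<open>\<psi>\<close>.\<close>

lemma L2_limit_exists:
  fixes s :: "nat \<Rightarrow> 'a::euclidean_space \<Rightarrow> real" and \<psi> :: "'a \<Rightarrow> real"
  assumes s: "\<And>k. s k \<in> L2" and inc: "\<And>k. (LBINT x. (s (Suc k) x - s k x)\<^sup>2) \<le> (1/4) ^ k"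
    and \<psi>: "\<psi> \<in> L2" "\<And>x. \<psi> x > 0"
  obtains g where "g \<in> borel_measurable borel" "AE x in lborel. (\<lambda>k. s k x) \<longlonglongrightarrow> g x"
proof -
  note [measurable] = L2_measurable[OF s] L2_measurable[OF \<psi>(1)]
  define d where "d = (\<lambda>k x. \<bar>(s (Suc k) x - s k x) * \<psi> x\<bar>)"
  define A where "A = (1 + (LBINT x. (\<psi> x)\<^sup>2)) / 2"
  have A: "A \<ge> 0" by (simp add: A_def)
  have dL: "(\<lambda>x. s (Suc k) x - s k x) \<in> L2" for k by (intro L2_diff s)
  have di: "integrable lborel (d k)" for k unfolding d_def by (intro integrable_abs L2_mult_integrable dL \<psi>)
  have dle: "(LBINT x. d k x) \<le> A * (1/2) ^ k" for k
  proof -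
    have "(LBINT x. d k x) \<le> (2 ^ k * (LBINT x. (s (Suc k) x - s k x)\<^sup>2) + (LBINT x. (\<psi> x)\<^sup>2) / 2 ^ k) / 2"
      unfolding d_def by (rule integral_abs_mult_le[OF dL \<psi>(1)]) simp
    also have "\<dots> \<le> (2 ^ k * (1/4) ^ k + (LBINT x. (\<psi> x)\<^sup>2) / 2 ^ k) / 2"
      using inc[of k] by (intro divide_right_mono add_mono mult_left_mono) auto
    also have "(2::real) ^ k * (1/4) ^ k = (1/2) ^ k" by (simp flip: power_mult_distrib)
    also have "((1/2) ^ k + (LBINT x. (\<psi> x)\<^sup>2) / 2 ^ k) / 2 = A * (1/2) ^ k"
      by (simp add: A_def power_one_over field_simps)
    finally show ?thesis .
  qed
  have "(\<integral>\<^sup>+x. (\<Sum>k. ennreal (d k x)) \<partial>lborel) = (\<Sum>k. \<integral>\<^sup>+x. ennreal (d k x) \<partial>lborel)"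
    by (rule nn_integral_suminf) (simp add: d_def)
  also have "\<dots> \<le> (\<Sum>k. ennreal (A * (1/2) ^ k))"
  proof (rule suminf_le)
    fix k
    have "(\<integral>\<^sup>+x. ennreal (d k x) \<partial>lborel) = ennreal (LBINT x. d k x)"
      by (rule nn_integral_eq_integral[OF di]) (simp add: d_def)
    also have "\<dots> \<le> ennreal (A * (1/2) ^ k)" using dle by (rule ennreal_leI)
    finally show "(\<integral>\<^sup>+x. ennreal (d k x) \<partial>lborel) \<le> ennreal (A * (1/2) ^ k)" .
  qed auto
  also have "\<dots> = ennreal (\<Sum>k. A * (1/2) ^ k)"
    using A by (intro suminf_ennreal2) (auto intro!: summable_mult summable_geometric)
  also have "\<dots> < \<infinity>" by simp
  finally have "AE x in lborel. (\<Sum>k. ennreal (d k x)) \<noteq> \<infinity>"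
    by (intro nn_integral_PInf_AE) (auto simp: d_def)
  then have conv: "AE x in lborel. convergent (\<lambda>k. s k x)"
  proof eventually_elim
    case (elim x)
    have "summable (\<lambda>k. d k x)"
      using elim by (intro summable_suminf_not_top) (auto simp: d_def)
    then have "summable (\<lambda>k. d k x * (1 / \<psi> x))" by (rule summable_mult2)
    moreover have "d k x * (1 / \<psi> x) = \<bar>s (Suc k) x - s k x\<bar>" for k
      using \<psi>(2)[of x] by (simp add: d_def abs_mult)
    ultimately have "summable (\<lambda>k. \<bar>s (Suc k) x - s k x\<bar>)" by (simp only:)
    then have "summable (\<lambda>k. s (Suc k) x - s k x)" by (rule summable_rabs_cancel)
    then have "(\<lambda>n. \<Sum>k<n. s (Suc k) x - s k x) \<longlonglongrightarrow> (\<Sum>k. s (Suc k) x - s k x)"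
      by (rule summable_LIMSEQ)
    from tendsto_add[OF this tendsto_const[of "s 0 x"]]
    have "(\<lambda>k. s k x) \<longlonglongrightarrow> (\<Sum>k. s (Suc k) x - s k x) + s 0 x"
      by (simp only: sum_lessThan_telescope[of "\<lambda>k. s k x"] diff_add_cancel)
    then show ?case by (auto simp: convergent_def)
  qed
  show thesis
  proof
    show "(\<lambda>x. lim (\<lambda>k. s k x)) \<in> borel_measurable borel" by measurable
    show "AE x in lborel. (\<lambda>k. s k x) \<longlonglongrightarrow> lim (\<lambda>k. s k x)"
      using conv by eventually_elim (simp add: convergent_LIMSEQ_iff)
  qed
qed

text \<open>The bound is asked for only from \<open>K\<close> on, so that it applies to s_k - s_j,
  which is controlled for k >= j.\<close>

lemma L2_fatou:
  fixes s :: "nat \<Rightarrow> 'a::euclidean_space \<Rightarrow> real"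
  assumes s: "\<And>k. s k \<in> L2" and le: "\<And>k. k \<ge> K \<Longrightarrow> (LBINT x. (s k x)\<^sup>2) \<le> B"
    and [measurable]: "g \<in> borel_measurable borel" and lim: "AE x in lborel. (\<lambda>k. s k x) \<longlonglongrightarrow> g x"
  shows "g \<in> L2" and "(LBINT x. (g x)\<^sup>2) \<le> B"
proof -
  note [measurable] = L2_measurable[OF s]
  have B: "B \<ge> 0" using le[of K] by (meson order_refl order_trans Bochner_Integration.integral_nonneg zero_le_power2)
  have "(\<integral>\<^sup>+x. ennreal ((g x)\<^sup>2) \<partial>lborel) \<le> (\<integral>\<^sup>+x. liminf (\<lambda>k. ennreal ((s k x)\<^sup>2)) \<partial>lborel)"
  proof (rule nn_integral_mono_AE)
    show "AE x in lborel. ennreal ((g x)\<^sup>2) \<le> liminf (\<lambda>k. ennreal ((s k x)\<^sup>2))"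
      using lim
    proof eventually_elim
      case (elim x)
      have "(\<lambda>k. ennreal ((s k x)\<^sup>2)) \<longlonglongrightarrow> ennreal ((g x)\<^sup>2)"
        by (intro tendsto_ennrealI tendsto_power elim)
      from lim_imp_Liminf[OF _ this] show ?case by simp
    qed
  qed
  also have "\<dots> \<le> liminf (\<lambda>k. \<integral>\<^sup>+x. ennreal ((s k x)\<^sup>2) \<partial>lborel)"
    by (rule nn_integral_liminf) simp
  also have "\<dots> \<le> ennreal B"
  proof -
    have "\<forall>\<^sub>F k in sequentially. (\<integral>\<^sup>+x. ennreal ((s k x)\<^sup>2) \<partial>lborel) \<le> ennreal B"
      unfolding eventually_sequentially
    proof (intro exI[of _ K] allI impI)
      fix k assume "K \<le> k"
      have "(\<integral>\<^sup>+x. ennreal ((s k x)\<^sup>2) \<partial>lborel) = ennreal (LBINT x. (s k x)\<^sup>2)"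
        using s[of k] by (intro nn_integral_eq_integral) (auto simp: L2_def)
      then show "(\<integral>\<^sup>+x. ennreal ((s k x)\<^sup>2) \<partial>lborel) \<le> ennreal B" using le[OF \<open>K \<le> k\<close>] by (simp add: ennreal_leI)
    qed
    then have "liminf (\<lambda>k. \<integral>\<^sup>+x. ennreal ((s k x)\<^sup>2) \<partial>lborel) \<le> liminf (\<lambda>k. ennreal B)"
      by (rule Liminf_mono)
    then show ?thesis by (simp add: Liminf_const)
  qed
  finally have nn: "(\<integral>\<^sup>+x. ennreal ((g x)\<^sup>2) \<partial>lborel) \<le> ennreal B" .
  have i: "integrable lborel (\<lambda>x. (g x)\<^sup>2)"
    by (rule integrableI_bounded) (use nn in \<open>auto simp: less_top[symmetric] top_unique\<close>)
  then show "g \<in> L2" by (simp add: L2_def)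
  have "ennreal (LBINT x. (g x)\<^sup>2) \<le> ennreal B"
    using nn nn_integral_eq_integral[OF i] by simp
  then show "(LBINT x. (g x)\<^sup>2) \<le> B" using B by simp
qed

text \<open>The converse of Bessel, stated through finite partial sums. A fast subsequence of the
  partial sums of the Hermite series converges almost everywhere to some \<open>g\<close>, whose
  squared norm is at most \<open>B\<close> by Fatou. The coefficients of \<open>g\<close> are those
  of \<open>w\<close>, and completeness identifies the two.\<close>

lemma hermite_parseval_bound:
  fixes \<alpha> \<beta> :: "real^'n::finite"
  assumes \<alpha>: "\<forall>j. \<alpha> $ j > 0" and w: "w \<in> L2"
    and le: "\<And>F. finite F \<Longrightarrow> (\<Sum>n\<in>F. (LBINT x. w x * hermite_tensor \<alpha> \<beta> n x)\<^sup>2) \<le> B"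
  shows "(LBINT x. (w x)\<^sup>2) \<le> B"
proof -
  let ?H = "hermite_tensor \<alpha> \<beta>"
  define c where "c = (\<lambda>n. LBINT x. w x * ?H n x)"
  \<comment> \<open>Multi-indices are countable, so \<open>to_nat\<close> yields an increasing
    exhaustion by finite sets.\<close>
  define F where "F = (\<lambda>k. {n :: 'n \<Rightarrow> nat. to_nat n < k})"
  have Ff: "finite (F k)" for k
    unfolding F_def by (rule finite_imageD[of to_nat]) (auto intro: finite_subset[of _ "{..<k}"] inj_on_subset[OF inj_to_nat])
  have Fmono: "F j \<subseteq> F k" if "j \<le> k" for j k using that by (auto simp: F_def)
  define S where "S = (\<lambda>k. \<Sum>n\<in>F k. (c n)\<^sup>2)"
  have Sle: "S k \<le> B" for k unfolding S_def c_def by (rule le[OF Ff])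
  have Smono: "S j \<le> S k" if "j \<le> k" for j k unfolding S_def using Ff Fmono[OF that] by (intro sum_mono2) auto
  obtain L where L: "S \<longlonglongrightarrow> L" "\<And>k. S k \<le> L"
    using incseq_convergent[of S B] Smono Sle by (auto simp: incseq_def)
  have "\<exists>N. \<forall>m\<ge>N. L - S m < (1/4) ^ k" for k
    using L(1)[unfolded LIMSEQ_def, rule_format, of "(1/4) ^ k"] by (force simp: dist_real_def)
  then obtain N where N: "\<And>k m. m \<ge> N k \<Longrightarrow> L - S m < (1/4) ^ k" by metis
  \<comment> \<open>Summing the thresholds makes \<open>p\<close> monotone with \<open>p k\<close>
    at least \<open>N k\<close>; the \<open>Suc\<close> adds \<open>p k > k\<close>, so the sets
    \<open>F (p k)\<close> exhaust all multi-indices.\<close>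
  define p where "p = (\<lambda>k. \<Sum>i\<le>k. Suc (N i))"
  have pN: "p k \<ge> N k" for k unfolding p_def using member_le_sum[of k "{..k}" "\<lambda>i. Suc (N i)"] by auto
  have pmono: "p j \<le> p k" if "j \<le> k" for j k unfolding p_def using that by (intro sum_mono2) auto
  have pk: "p k > k" for k unfolding p_def by (induction k) auto
  define s where "s = (\<lambda>k x. \<Sum>n\<in>F (p k). c n * ?H n x)"
  have sL: "s k \<in> L2" for k unfolding s_def by (intro L2_sum L2_scale hermite_tensor_in_L2 \<alpha>)
  have diff: "(LBINT x. (s k x - s j x)\<^sup>2) \<le> (1/4) ^ j" if "j \<le> k" for j k
  proof -
    have sub: "F (p j) \<subseteq> F (p k)" using that by (intro Fmono pmono)
    have "s k x - s j x = (\<Sum>n\<in>F (p k) - F (p j). c n * ?H n x)" for x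
      unfolding s_def by (simp only: sum_diff[OF Ff sub])
    then have "(LBINT x. (s k x - s j x)\<^sup>2) = (\<Sum>n\<in>F (p k) - F (p j). (c n)\<^sup>2)"
      using hermite_sum_norm[OF \<alpha>, of "F (p k) - F (p j)"] Ff by simp
    also have "\<dots> = S (p k) - S (p j)" unfolding S_def by (simp only: sum_diff[OF Ff sub])
    also have "\<dots> \<le> L - S (p j)" using L(2) by simp
    also have "\<dots> \<le> (1/4) ^ j" using N[OF pN] by (simp add: less_imp_le)
    finally show ?thesis .
  qed
  \<comment> \<open>The ground state is strictly positive and serves as the weight in
    \<open>L2_limit_exists\<close>.\<close>
  have \<psi>: "?H (\<lambda>_. 0) x > 0" for x
    unfolding hermite_tensor_def hermite_fun_0 using \<alpha> by (intro prod_pos) auto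
  obtain g where g: "g \<in> borel_measurable borel" "AE x in lborel. (\<lambda>k. s k x) \<longlonglongrightarrow> g x"
    by (rule L2_limit_exists[OF sL diff hermite_tensor_in_L2[OF \<alpha>] \<psi>]) auto
  have gB: "g \<in> L2" "(LBINT x. (g x)\<^sup>2) \<le> B"
    using L2_fatou[OF sL _ g, of 0 B] Sle hermite_sum_norm[OF \<alpha> Ff] by (auto simp: s_def S_def)
  have gs: "(LBINT x. (g x - s j x)\<^sup>2) \<le> (1/4) ^ j" for j
  proof (rule L2_fatou(2)[where s = "\<lambda>k x. s k x - s j x" and K = j])
    show "(\<lambda>x. s k x - s j x) \<in> L2" for k by (intro L2_diff sL)
    show "(\<lambda>x. g x - s j x) \<in> borel_measurable borel" using g(1) L2_measurable[OF sL] by simp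
    show "AE x in lborel. (\<lambda>k. s k x - s j x) \<longlonglongrightarrow> g x - s j x"
      using g(2) by eventually_elim (intro tendsto_diff tendsto_const)
  qed (rule diff)
  have gc: "(LBINT x. g x * ?H n x) = c n" for n
  proof (rule ccontr)
    assume ne: "(LBINT x. g x * ?H n x) \<noteq> c n"
    \<comment> \<open>From \<open>to_nat n\<close> on the partial sum contains the index
      \<open>n\<close> and has coefficient exactly \<open>c n\<close>, so the discrepancy is the
      pairing of g - s_j with a unit vector.\<close>
    have bound: "\<bar>(LBINT x. g x * ?H n x) - c n\<bar> \<le> (1/2) ^ j" if j: "j \<ge> to_nat n" for j
    proof -
      have nF: "n \<in> F (p j)" using j pk[of j] by (simp add: F_def)
      have Hn: "(LBINT x. (?H n x)\<^sup>2) = 1" using hermite_tensor_orthonormal[OF \<alpha>, of \<beta> n n] by (simp add: power2_eq_square)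
      have "(LBINT x. (g x - s j x) * ?H n x) = (LBINT x. g x * ?H n x - s j x * ?H n x)"
        by (simp add: left_diff_distrib)
      also have "\<dots> = (LBINT x. g x * ?H n x) - (LBINT x. s j x * ?H n x)"
        by (intro Bochner_Integration.integral_diff L2_mult_integrable gB sL hermite_tensor_in_L2 \<alpha>)
      also have "(LBINT x. s j x * ?H n x) = c n"
        unfolding s_def using hermite_sum_coeff[OF \<alpha> Ff] nF by simp
      finally have "\<bar>(LBINT x. g x * ?H n x) - c n\<bar> = \<bar>LBINT x. (g x - s j x) * ?H n x\<bar>" by simp
      also have "\<dots> \<le> (LBINT x. \<bar>(g x - s j x) * ?H n x\<bar>)" by (rule integral_abs_bound)
      also have "\<dots> \<le> (2 ^ j * (LBINT x. (g x - s j x)\<^sup>2) + (LBINT x. (?H n x)\<^sup>2) / 2 ^ j) / 2"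
        by (rule integral_abs_mult_le[OF L2_diff[OF gB(1) sL] hermite_tensor_in_L2[OF \<alpha>]]) simp
      also have "\<dots> \<le> (2 ^ j * (1/4) ^ j + 1 / 2 ^ j) / 2"
        unfolding Hn using gs[of j] by (intro divide_right_mono add_mono mult_left_mono) auto
      also have "(2::real) ^ j * (1/4) ^ j = (1/2) ^ j" by (simp flip: power_mult_distrib)
      also have "((1/2) ^ j + 1 / 2 ^ j) / 2 = ((1/2) ^ j :: real)" by (simp add: power_one_over)
      finally show ?thesis .
    qed
    have "(\<lambda>j. (1/2 :: real) ^ j) \<longlonglongrightarrow> 0" by (rule LIMSEQ_power_zero) simp
    then have "\<bar>(LBINT x. g x * ?H n x) - c n\<bar> \<le> 0"
      by (rule LIMSEQ_le_const) (use bound in blast)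
    then show False using ne by simp
  qed
  have "AE x in lborel. w x - g x = 0"
  proof (rule hermite_tensor_complete[OF \<alpha> L2_diff[OF w gB(1)]])
    fix n
    have "(LBINT x. (w x - g x) * ?H n x) = (LBINT x. w x * ?H n x - g x * ?H n x)"
      by (simp add: left_diff_distrib)
    also have "\<dots> = (LBINT x. w x * ?H n x) - (LBINT x. g x * ?H n x)"
      by (intro Bochner_Integration.integral_diff L2_mult_integrable gB w hermite_tensor_in_L2 \<alpha>)
    finally show "(LBINT x. (w x - g x) * ?H n x) = 0" by (simp add: gc c_def)
  qed
  then have "(LBINT x. (w x)\<^sup>2) = (LBINT x. (g x)\<^sup>2)"
    using L2_measurable[OF w] g(1) by (intro integral_cong_AE) auto
  then show ?thesis using gB by simp
qed

subsection \<open>Derivatives in the spaces K and the adaptive index set\<close>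

lemma locally_integrable_cong_AE:
  assumes "locally_integrable f" and [measurable]: "g \<in> borel_measurable borel" and "AE x in lborel. f x = g x"
  shows "locally_integrable g"
  unfolding locally_integrable_def
proof (intro allI impI)
  fix K :: "'a set" assume K: "compact K"
  then have [measurable]: "K \<in> sets borel" by (auto intro: borel_closed compact_imp_closed)
  have [measurable]: "f \<in> borel_measurable borel" by (rule locally_integrable_measurable[OF assms(1)])
  have "set_integrable lborel K f" using assms(1) K by (simp add: locally_integrable_def)
  moreover have "AE x in lborel. indicator K x *\<^sub>R f x = indicator K x *\<^sub>R g x"
    using assms(3) by eventually_elim simp
  ultimately show "set_integrable lborel K g" unfolding set_integrable_def
    by (subst integrable_cong_AE[symmetric]) auto
qed

lemma herm_deriv_measurable:
  fixes \<alpha> \<beta> :: "real^'n::finite"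
  assumes "herm_deriv \<alpha> \<beta> j u w"
  shows "w \<in> borel_measurable borel"
proof -
  have [measurable]: "u \<in> borel_measurable borel" "(\<lambda>x. w x - (\<alpha> $ j)\<^sup>2 * (x $ j - \<beta> $ j) * u x) \<in> borel_measurable borel"
    using assms by (auto simp: herm_deriv_def weak_partial_def intro: locally_integrable_measurable)
  have "(\<lambda>x. (w x - (\<alpha> $ j)\<^sup>2 * (x $ j - \<beta> $ j) * u x) + (\<alpha> $ j)\<^sup>2 * (x $ j - \<beta> $ j) * u x) \<in> borel_measurable borel"
    by measurable
  then show ?thesis by simp
qed

lemma herm_deriv_unique:
  assumes "herm_deriv \<alpha> \<beta> j u w" "herm_deriv \<alpha> \<beta> j u' w'" "AE x in lborel. u x = u' x"
  shows "AE x in lborel. w x = w' x"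
  using weak_partial_unique[OF assms(1,2)[unfolded herm_deriv_def] assms(3)] assms(3)
  by eventually_elim simp

lemma herm_deriv_pow_unique:
  assumes "(herm_deriv \<alpha> \<beta> j ^^ l) u w" "(herm_deriv \<alpha> \<beta> j ^^ l) u w'"
  shows "AE x in lborel. w x = w' x"
  using assms
proof (induction l arbitrary: w w')
  case (Suc l)
  obtain v v' where v: "(herm_deriv \<alpha> \<beta> j ^^ l) u v" "herm_deriv \<alpha> \<beta> j v w"
    "(herm_deriv \<alpha> \<beta> j ^^ l) u v'" "herm_deriv \<alpha> \<beta> j v' w'"
    using Suc.prems by (elim relpowp_Suc_E) blast
  show ?case by (rule herm_deriv_unique[OF v(2,4) Suc.IH[OF v(1,3)]])
qed simp

lemma herm_deriv_cong_AE:
  fixes \<alpha> \<beta> :: "real^'n::finite"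
  assumes D: "herm_deriv \<alpha> \<beta> j u w" and u': "u' \<in> L2" and ae: "AE x in lborel. u x = u' x"
  shows "herm_deriv \<alpha> \<beta> j u' w"
proof -
  let ?v = "\<lambda>u x. w x - (\<alpha> $ j)\<^sup>2 * (x $ j - \<beta> $ j) * u x"
  have li: "locally_integrable u" "locally_integrable (?v u)" using D by (auto simp: herm_deriv_def weak_partial_def)
  have [measurable]: "w \<in> borel_measurable borel" "u' \<in> borel_measurable borel" "u \<in> borel_measurable borel"
    using D u' li by (auto intro: herm_deriv_measurable L2_measurable locally_integrable_measurable)
  have "locally_integrable (?v u')"
    by (rule locally_integrable_cong_AE[OF li(2)]) (use ae in \<open>measurable; eventually_elim; simp\<close>)+
  moreover have "(LBINT x. u' x * frechet_derivative \<phi> (at x) (axis j 1)) = - (LBINT x. ?v u' x * \<phi> x)"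
    if \<phi>: "test_function \<phi>" for \<phi>
  proof -
    have [measurable]: "(\<lambda>x. frechet_derivative \<phi> (at x) (axis j 1)) \<in> borel_measurable borel" "\<phi> \<in> borel_measurable borel"
      using test_function_derivative[OF \<phi>] test_function_continuous[OF \<phi>]
      by (auto simp: continuous_compact_support_def intro: borel_measurable_continuous_onI)
    have "(LBINT x. u' x * frechet_derivative \<phi> (at x) (axis j 1)) = (LBINT x. u x * frechet_derivative \<phi> (at x) (axis j 1))"
      by (rule integral_cong_AE) (use ae in auto)
    also have "\<dots> = - (LBINT x. ?v u x * \<phi> x)"
      using D \<phi> by (simp add: herm_deriv_def weak_partial_def)
    also have "(LBINT x. ?v u x * \<phi> x) = (LBINT x. ?v u' x * \<phi> x)"
      by (rule integral_cong_AE) (use ae in auto)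
    finally show ?thesis .
  qed
  ultimately show ?thesis using L2_locally_integrable[OF u'] by (simp add: herm_deriv_def weak_partial_def)
qed

lemma L2_norm_of_herm_deriv_pow:
  fixes \<alpha> \<beta> :: "real^'n::finite"
  assumes w: "(herm_deriv \<alpha> \<beta> j ^^ l) u w"
  shows "(L2_norm_of (herm_deriv \<alpha> \<beta> j ^^ l) u)\<^sup>2 = (LBINT x. (w x)\<^sup>2)"
proof -
  define w' where "w' = (SOME w. (herm_deriv \<alpha> \<beta> j ^^ l) u w)"
  have w': "(herm_deriv \<alpha> \<beta> j ^^ l) u w'" unfolding w'_def by (rule someI[of _ w]) (rule w)
  have "(LBINT x. (w' x)\<^sup>2) = (LBINT x. (w x)\<^sup>2)"
  proof (cases l)
    \<comment> \<open>For \<open>l = 0\<close> both versions are literally \<open>u\<close>. In the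
      other case the last derivative step supplies the measurability needed to compare
      integrals.\<close>
    case 0
    then show ?thesis using w w' by simp
  next
    case (Suc k)
    have "w \<in> borel_measurable borel" "w' \<in> borel_measurable borel"
      using w w' unfolding Suc by (auto elim!: relpowp_Suc_E intro: herm_deriv_measurable)
    then show ?thesis using herm_deriv_pow_unique[OF w w'] by (intro integral_cong_AE) auto
  qed
  then show ?thesis unfolding L2_norm_of_def L2_norm_def w'_def[symmetric] by simp
qed

text \<open>The other coordinates contribute a zeroth power, which is equality, the unit of
  relational composition. This is how pure derivatives are read off from \<open>K_space\<close> and
  \<open>K_seminorm\<close>.\<close>

lemma herm_deriv_multi_single:
  "herm_deriv_multi \<alpha> \<beta> (\<lambda>i. if i = j then r else 0) = herm_deriv \<alpha> \<beta> j ^^ r"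
proof -
  have "foldr (\<lambda>i R. R OO (herm_deriv \<alpha> \<beta> i ^^ (if i = j then r else 0))) xs (=) =
      (if j \<in> set xs then herm_deriv \<alpha> \<beta> j ^^ r else (=))" if "distinct xs" for xs
    using that
  proof (induction xs)
    case (Cons a xs)
    then show ?case by (auto simp: eq_OO OO_eq)
  qed simp
  then show ?thesis unfolding herm_deriv_multi_def by simp
qed

lemma mi_inf_single: "mi_inf UNIV (\<lambda>i::'n::finite. if i = j then r else 0) = r"
proof -
  have "(\<lambda>i::'n. if i = j then r else 0) ` UNIV \<subseteq> {0, r}" "r \<in> (\<lambda>i::'n. if i = j then r else 0) ` UNIV" by auto
  then show ?thesis unfolding mi_inf_def by (intro Max_eqI) auto
qed

text \<open>For each order separately \<open>K_space\<close> offers a final function in L2, reached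
  through unknown intermediate versions. The one before last agrees almost everywhere with the L2
  version built so far and can be exchanged for it.\<close>

lemma K_space_L2_herm_deriv_pow:
  fixes \<alpha> \<beta> :: "real^'n::{finite,linorder}"
  assumes u: "u \<in> K_space \<alpha> \<beta> m" and r: "r \<le> m"
  shows "\<exists>w. (L2_herm_deriv \<alpha> \<beta> j ^^ r) u w"
  using r
proof (induction r)
  case 0
  show ?case by simp
next
  case (Suc r)
  have ex: "\<exists>w\<in>L2. (herm_deriv \<alpha> \<beta> j ^^ r) u w" if "r \<le> m" for r
    using u that unfolding K_space_def herm_deriv_multi_single[of \<alpha> \<beta> j r, symmetric]
    by (auto simp: mi_inf_single)
  have uL2: "u \<in> L2" using ex[of 0] by auto
  obtain w where w: "(L2_herm_deriv \<alpha> \<beta> j ^^ r) u w" using Suc by auto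
  have wL2: "w \<in> L2" by (rule L2_herm_deriv_pow_L2[OF w uL2])
  obtain z where z: "z \<in> L2" "(herm_deriv \<alpha> \<beta> j ^^ Suc r) u z" using ex[OF Suc.prems] by blast
  then obtain w' where w': "(herm_deriv \<alpha> \<beta> j ^^ r) u w'" "herm_deriv \<alpha> \<beta> j w' z" by (auto elim: relpowp_Suc_E)
  have "AE x in lborel. w' x = w x" by (rule herm_deriv_pow_unique[OF w'(1) L2_herm_deriv_pow_imp[OF w]])
  then have "L2_herm_deriv \<alpha> \<beta> j w z"
    using herm_deriv_cong_AE[OF w'(2) wL2] wL2 z by (simp add: L2_herm_deriv_def)
  with w show ?case by (blast intro: relpowp_Suc_I)
qed

lemma K_space_in_L2: "u \<in> K_space \<alpha> \<beta> m \<Longrightarrow> u \<in> L2"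
proof -
  assume u: "u \<in> K_space \<alpha> \<beta> m"
  \<comment> \<open>The zero multi-index, written as a pure one at an arbitrary coordinate so that
    the lemmas on pure multi-indices apply.\<close>
  have "mi_inf UNIV (\<lambda>i::'a. if i = undefined then 0 else 0) \<le> m" unfolding mi_inf_single by simp
  then have "\<exists>w\<in>L2. herm_deriv_multi \<alpha> \<beta> (\<lambda>i. if i = undefined then 0 else 0) u w"
    using u unfolding K_space_def by blast
  then show ?thesis unfolding herm_deriv_multi_single by simp
qed

text \<open>For \<open>m > 0\<close> the pure multi-indices m e_j are pairwise distinct, so their
  terms form a subsum of the squared seminorm.\<close>

lemma K_seminorm_ge:
  fixes \<alpha> \<beta> :: "real^'n::{finite,linorder}"
  assumes m: "m > 0" and w: "\<And>j. (herm_deriv \<alpha> \<beta> j ^^ m) u (w j)"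
  shows "(\<Sum>j\<in>UNIV. LBINT x. (w j x)\<^sup>2) \<le> (K_seminorm \<alpha> \<beta> m u)\<^sup>2"
proof -
  let ?e = "\<lambda>j i::'n. if i = j then m else 0" and ?N = "\<lambda>k. (L2_norm_of (herm_deriv_multi \<alpha> \<beta> k) u)\<^sup>2"
  have inj: "inj ?e" using m by (auto simp: inj_on_def fun_eq_iff split: if_splits)
  \<comment> \<open>Finiteness is essential: a sum over an infinite set would be 0 by
    convention.\<close>
  have "{k :: 'n \<Rightarrow> nat. mi_inf UNIV k = m} \<subseteq> (UNIV \<rightarrow>\<^sub>E {..m})"
    by (auto simp: mi_inf_def PiE_def extensional_def)
  then have fin: "finite {k :: 'n \<Rightarrow> nat. mi_inf UNIV k = m}"
    by (rule finite_subset) (intro finite_PiE finite finite_atMost)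
  have "(\<Sum>j\<in>UNIV. LBINT x. (w j x)\<^sup>2) = (\<Sum>j\<in>UNIV. ?N (?e j))"
    unfolding herm_deriv_multi_single using L2_norm_of_herm_deriv_pow[OF w] by simp
  also have "\<dots> = (\<Sum>k\<in>range ?e. ?N k)" by (simp add: sum.reindex[OF inj])
  also have "\<dots> \<le> (\<Sum>k | mi_inf UNIV k = m. ?N k)"
    by (rule sum_mono2[OF fin]) (auto simp: mi_inf_single)
  also have "\<dots> = (K_seminorm \<alpha> \<beta> m u)\<^sup>2"
    unfolding K_seminorm_def by (simp add: sum_nonneg)
  finally show ?thesis .
qed

section \<open>Finiteness and thresholds of the adaptive index set\<close>

lemma card_first_coords:
  assumes "d1 \<le> CARD('n::{finite,linorder})"
  shows "card (first_coords d1 :: 'n set) = d1"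
proof -
  \<comment> \<open>Counting the smaller coordinates gives a strictly increasing map into the
    numbers below d, hence a bijection onto them.\<close>
  define rank where "rank = (\<lambda>j::'n. card {i. i < j})"
  have sm: "rank i < rank j" if "i < j" for i j
    unfolding rank_def using that by (intro psubset_card_mono) (auto intro: less_trans)
  have inj: "inj rank"
    by (rule injI) (metis sm less_irrefl linorder_less_linear)
  have "rank j < CARD('n)" for j
    unfolding rank_def by (intro psubset_card_mono) auto
  then have "rank ` UNIV \<subseteq> {..<CARD('n)}" by auto
  then have "rank ` UNIV = {..<CARD('n)}"
    by (intro card_subset_eq) (simp_all add: card_image[OF inj])
  then have "{..<d1} \<subseteq> range rank" using assms by auto
  then have "card (rank -` {..<d1}) = card {..<d1}" using inj by (intro card_vimage_inj)
  moreover have "first_coords d1 = rank -` {..<d1}" by (auto simp: first_coords_def rank_def)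
  ultimately show ?thesis by simp
qed

lemma mi_inf_attained:
  assumes "finite J" "J \<noteq> {}"
  obtains i where "i \<in> J" "n i = mi_inf J n" "\<And>j. j \<in> J \<Longrightarrow> n j \<le> mi_inf J n"
proof -
  have "mi_inf J n \<in> n ` J" unfolding mi_inf_def using assms by (intro Max_in) auto
  moreover have "n j \<le> mi_inf J n" if "j \<in> J" for j unfolding mi_inf_def using assms that by (intro Max_ge) auto
  ultimately show thesis using that by (metis imageE)
qed

text \<open>On a nonzero second block with maximum X, the mixed size is at least X, so the defining
  inequality gives X^(1-gamma) <= N_2^(1-gamma), hence X <= N_2 because gamma < 1. Finiteness makes
  the full truncation a legitimate element of the span.\<close>

lemma adaptive_index_set_finite:
  assumes "1 \<le> d1" "d1 < CARD('n::{finite,linorder})" "\<gamma> < 1"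
  shows "finite (adaptive_index_set d1 \<gamma> N1 N2 :: ('n \<Rightarrow> nat) set)"
proof -
  let ?J1 = "first_coords d1 :: 'n set" and ?J2 = "- first_coords d1 :: 'n set"
  have c: "card ?J1 = d1" using card_first_coords assms by (metis less_imp_le)
  have J1: "?J1 \<noteq> {}" using c assms(1) by auto
  have J2: "?J2 \<noteq> {}" using c assms(2) by (metis Compl_empty_eq double_complement less_irrefl)
  have "n j \<le> N1 + N2" if n: "n \<in> adaptive_index_set d1 \<gamma> N1 N2" for n :: "'n \<Rightarrow> nat" and j
  proof (cases "j \<in> ?J1")
    case True
    obtain i where "n j \<le> mi_inf ?J1 n" by (rule mi_inf_attained[OF finite J1, of n]) (use True in blast)
    then show ?thesis using n by (simp add: adaptive_index_set_def Let_def)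
  next
    case False
    obtain i where i: "i \<in> ?J2" "n i = mi_inf ?J2 n" "\<And>j. j \<in> ?J2 \<Longrightarrow> n j \<le> mi_inf ?J2 n"
      using mi_inf_attained[OF finite J2, of n] by blast
    define X where "X = mi_inf ?J2 n"
    show ?thesis
    proof (cases "\<forall>j\<in>?J2. n j = 0")
      case True
      then show ?thesis using False by simp
    next
      case nz: False
      then have X1: "X \<ge> 1" using i(3) unfolding X_def by (metis One_nat_def Suc_leI le_zero_eq not_gr0)
      have "X \<le> mi_mix ?J2 n"
      proof -
        have "mi_mix ?J2 n = max 1 (n i) * (\<Prod>j\<in>?J2 - {i}. max 1 (n j))"
          unfolding mi_mix_def using i(1) by (intro prod.remove) auto
        moreover have "1 \<le> (\<Prod>j\<in>?J2 - {i}. max 1 (n j))" by (intro prod_ge_1) auto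
        ultimately show ?thesis using i(2) unfolding X_def by (metis le_max_iff_disj mult_le_mono nat_mult_1_right order_refl)
      qed
      then have "real X * real X powr (- \<gamma>) \<le> real (mi_mix ?J2 n) * real X powr (- \<gamma>)"
        by (intro mult_right_mono) auto
      also have "\<dots> \<le> real N2 powr (1 - \<gamma>)"
        using n nz unfolding X_def by (auto simp: adaptive_index_set_def Let_def)
      also have "real X * real X powr (- \<gamma>) = real X powr (1 - \<gamma>)"
        using X1 powr_add[of "real X" 1 "- \<gamma>"] by simp
      finally have "real X powr (1 - \<gamma>) \<le> real N2 powr (1 - \<gamma>)" .
      then have "real X \<le> real N2"
        using powr_less_mono2[of "1 - \<gamma>" "real N2" "real X"] assms(3) by (meson not_le of_nat_0_le_iff diff_gt_0_iff_gt)
      then show ?thesis using i(3)[of j] False unfolding X_def by simp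
    qed
  qed
  then have "adaptive_index_set d1 \<gamma> N1 N2 \<subseteq> (UNIV :: 'n set) \<rightarrow>\<^sub>E {..N1 + N2}"
    by (auto simp: PiE_def extensional_def)
  then show ?thesis by (rule finite_subset) (intro finite_PiE finite finite_atMost)
qed

text \<open>Origin of the exponent: a violated second condition gives N_2^(1-gamma) < X^(d-d_1)
  X^(-gamma) for the block maximum X, and a root is taken. This is possible as d - d_1 >= 1 >
  gamma.\<close>

lemma not_in_adaptive_index_set:
  fixes n :: "'n::{finite,linorder} \<Rightarrow> nat"
  assumes "1 \<le> d1" "d1 < CARD('n)" "\<gamma> < 1"
    and n: "n \<notin> adaptive_index_set d1 \<gamma> N1 N2"
  shows "\<exists>i. real N1 < real (n i) \<or> real N2 powr ((1 - \<gamma>) / (real CARD('n) - real d1 - \<gamma>)) < real (n i)"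
proof -
  let ?J1 = "first_coords d1 :: 'n set" and ?J2 = "- first_coords d1 :: 'n set"
  have c: "card ?J1 = d1" using card_first_coords assms by (metis less_imp_le)
  have c2: "card ?J2 = CARD('n) - d1" using card_Diff_subset[of ?J1 UNIV] c by (simp add: Compl_eq_Diff_UNIV)
  have J1: "?J1 \<noteq> {}" using c assms(1) by auto
  have J2: "?J2 \<noteq> {}" using c assms(2) by (metis Compl_empty_eq double_complement less_irrefl)
  show ?thesis
  proof (cases "mi_inf ?J1 n \<le> N1")
    case False
    obtain i where "n i = mi_inf ?J1 n" using mi_inf_attained[OF finite J1, of n] by metis
    then show ?thesis using False by (metis not_le of_nat_less_iff)
  next
    case True
    obtain i where i: "i \<in> ?J2" "n i = mi_inf ?J2 n" "\<And>j. j \<in> ?J2 \<Longrightarrow> n j \<le> mi_inf ?J2 n"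
      using mi_inf_attained[OF finite J2, of n] by blast
    define X where "X = mi_inf ?J2 n"
    define p where "p = real CARD('n) - real d1 - \<gamma>"
    have p: "p > 0" using assms(2,3) unfolding p_def by (simp add: less_diff_conv)
    have nz: "\<not> (\<forall>j\<in>?J2. n j = 0)" and big: "real N2 powr (1 - \<gamma>) < real (mi_mix ?J2 n) * real X powr (- \<gamma>)"
      using n True unfolding X_def by (auto simp: adaptive_index_set_def Let_def not_le)
    \<comment> \<open>The factors of \<open>mi_mix\<close> are maxima with 1, so bounding them by
      \<open>X\<close> requires \<open>X\<close> to be at least 1.\<close>
    have X1: "X \<ge> 1" using nz i(3) unfolding X_def by (metis One_nat_def Suc_leI le_zero_eq not_gr0)
    have "mi_mix ?J2 n \<le> (\<Prod>j\<in>?J2. X)"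
      unfolding mi_mix_def using i(3) X1 by (intro prod_mono) (auto simp: X_def)
    then have "mi_mix ?J2 n \<le> X ^ (CARD('n) - d1)" using c2 by simp
    then have "real (mi_mix ?J2 n) \<le> real X ^ (CARD('n) - d1)" by (metis of_nat_le_iff of_nat_power)
    also have "\<dots> = real X powr (real CARD('n) - real d1)"
      using X1 assms(2) by (simp add: powr_realpow[symmetric] of_nat_diff)
    finally have "real (mi_mix ?J2 n) * real X powr (- \<gamma>) \<le> real X powr (real CARD('n) - real d1) * real X powr (- \<gamma>)"
      by (intro mult_right_mono) auto
    also have "\<dots> = real X powr p" unfolding p_def powr_add[symmetric] by simp
    finally have "real N2 powr (1 - \<gamma>) < real X powr p" using big by simp
    then have "(real N2 powr (1 - \<gamma>)) powr (1 / p) < (real X powr p) powr (1 / p)"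
      using p by (intro powr_less_mono2) auto
    then have "real N2 powr ((1 - \<gamma>) / p) < real X" using p by (simp add: powr_powr)
    then show ?thesis using i(2) unfolding X_def p_def by metis
  qed
qed

section \<open>Comparison of the weights and the projection error\<close>

lemma pochhammer_le_power: "pochhammer (real (Suc k)) l \<le> real (k + l) ^ l"
proof -
  have "pochhammer (real (Suc k)) l = (\<Prod>i=0..<l. real (Suc k) + real i)" by (simp add: pochhammer_prod)
  also have "\<dots> \<le> (\<Prod>i=0..<l. real (k + l))" by (intro prod_mono) auto
  finally show ?thesis by simp
qed

text \<open>Here k + m plays the role of the large entry before it is lowered by m. Every factor is
  at least k + 1 >= (k + m) / m; the loss m^m reappears in the constant \<open>A\<close>.\<close>

lemma power_le_pochhammer:
  "(real (k + m) / real m) ^ m \<le> pochhammer (real (Suc k)) m"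
proof -
  have "real (k + m) / real m \<le> real (Suc k) + real i" if "m > 0" for i
  proof -
    have "k \<le> m * k" using that by simp
    moreover have "m * (Suc k + i) = m + m * k + m * i" by (simp add: algebra_simps)
    ultimately have "k + m \<le> m * (Suc k + i)" by linarith
    then have "real (k + m) \<le> real m * (real (Suc k) + real i)" by (metis of_nat_add of_nat_le_iff of_nat_mult)
    then show ?thesis using that by (simp add: field_simps)
  qed
  then have "(\<Prod>i=0..<m. real (k + m) / real m) \<le> (\<Prod>i=0..<m. real (Suc k) + real i)"
    by (intro prod_mono) auto
  then show ?thesis by (simp add: pochhammer_prod)
qed

text \<open>\<open>A\<close> collects the loss m^m and the ratio of the alpha-weights, with sums
  over coordinates dominating the individual terms. The factor d under the root comes from adding
  the d derivatives in the W seminorm.\<close>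

lemma hermite_projection_error:
  fixes \<alpha> \<beta> :: "real^'n::{finite,linorder}"
  assumes \<alpha>: "\<forall>j. \<alpha> $ j > 0" and l: "0 < l" "l \<le> m" and u: "u \<in> K_space \<alpha> \<beta> m"
    and S: "finite S" and \<epsilon>: "\<epsilon> \<ge> 0"
    and out: "\<And>n. n \<notin> S \<Longrightarrow> \<exists>i. (\<forall>j. n j \<le> n i) \<and> m \<le> n i \<and> real (n i) powr (real l - real m) \<le> \<epsilon>"
    and c: "\<And>n. c n = (LBINT x. u x * hermite_tensor \<alpha> \<beta> n x)"
    and A: "A = real m ^ m * (\<Sum>j\<in>UNIV. (2 * (\<alpha> $ j)\<^sup>2) ^ l) * (\<Sum>i\<in>UNIV. 1 / (2 * (\<alpha> $ i)\<^sup>2) ^ m)"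
  shows "W_seminorm \<alpha> \<beta> l (\<lambda>x. u x - (\<Sum>n\<in>S. c n * hermite_tensor \<alpha> \<beta> n x))
    \<le> sqrt (real CARD('n) * A * \<epsilon>) * K_seminorm \<alpha> \<beta> m u"
proof -
  let ?H = "hermite_tensor \<alpha> \<beta>"
  let ?U = "\<lambda>x. \<Sum>n\<in>S. c n * ?H n x"
  define a where "a = (\<lambda>j. 2 * (\<alpha> $ j)\<^sup>2)"
  have a: "a j > 0" for j using \<alpha> by (auto simp: a_def) (metis less_irrefl)
  have m: "m > 0" using l by simp
  have uL2: "u \<in> L2" by (rule K_space_in_L2[OF u])
  obtain w where w: "\<And>j. (L2_herm_deriv \<alpha> \<beta> j ^^ m) u (w j)"
    using K_space_L2_herm_deriv_pow[OF u order_refl] by metis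
  have wL2: "w j \<in> L2" for j by (rule L2_herm_deriv_pow_L2[OF w uL2])
  have "\<forall>j. \<exists>v. (L2_herm_deriv \<alpha> \<beta> j ^^ l) (\<lambda>x. u x - ?U x) v"
  proof
    fix j
    obtain w' where "(L2_herm_deriv \<alpha> \<beta> j ^^ l) u w'" using K_space_L2_herm_deriv_pow[OF u l(2)] by blast
    then show "\<exists>v. (L2_herm_deriv \<alpha> \<beta> j ^^ l) (\<lambda>x. u x - ?U x) v" by (rule L2_herm_deriv_pow_diff_sum[OF \<alpha> S])
  qed
  from choice[OF this] obtain v where v: "\<And>j. (L2_herm_deriv \<alpha> \<beta> j ^^ l) (\<lambda>x. u x - ?U x) (v j)" by blast
  have UL2: "?U \<in> L2" by (intro L2_sum L2_scale hermite_tensor_in_L2 \<alpha>)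
  have vL2: "v j \<in> L2" for j by (rule L2_herm_deriv_pow_L2[OF v L2_diff[OF uL2 UL2]])
  have cu: "(LBINT x. (u x - ?U x) * ?H n x) = (if n \<in> S then 0 else c n)" for n
  proof -
    have "(LBINT x. (u x - ?U x) * ?H n x) = (LBINT x. u x * ?H n x - ?U x * ?H n x)"
      by (simp only: left_diff_distrib)
    also have "\<dots> = (LBINT x. u x * ?H n x) - (LBINT x. ?U x * ?H n x)"
      by (intro Bochner_Integration.integral_diff L2_mult_integrable uL2 UL2 hermite_tensor_in_L2 \<alpha>)
    finally show ?thesis unfolding hermite_sum_coeff[OF \<alpha> S] c by simp
  qed
  define V where "V = (\<lambda>j n. (LBINT x. v j x * ?H n x)\<^sup>2)"
  define Wc where "Wc = (\<lambda>i n. (LBINT x. w i x * ?H n x)\<^sup>2)"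
  have V: "V j n = a j ^ l * pochhammer (real (Suc (n j))) l * (if n(j := n j + l) \<in> S then 0 else c (n(j := n j + l)))\<^sup>2" for j n
    unfolding V_def L2_herm_deriv_pow_coeff[OF \<alpha> v] cu a_def ..
  have Wc: "Wc i n = a i ^ m * pochhammer (real (Suc (n i))) m * (c (n(i := n i + m)))\<^sup>2" for i n
    unfolding Wc_def L2_herm_deriv_pow_coeff[OF \<alpha> w] c a_def ..
  have Wc0: "Wc i n \<ge> 0" for i n by (simp add: Wc_def)
  have A0: "A \<ge> 0" unfolding A by (intro mult_nonneg_nonneg sum_nonneg) auto
  \<comment> \<open>The gain for one coefficient: with M = n_i the error weight M^l equals M^(l-m)
    M^m, and M^m is controlled by the weight of the coefficient in D_i^m u.\<close>
  have single: "a j ^ l * real (n i) ^ l * (c n)\<^sup>2 \<le> A * \<epsilon> * Wc i (n(i := n i - m))"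
    if i: "m \<le> n i" "real (n i) powr (real l - real m) \<le> \<epsilon>" for i j n
  proof -
    define M where "M = real (n i)"
    have M: "M > 0" using i m by (simp add: M_def)
    have "M ^ l = M powr (real l - real m) * M ^ m"
      using M by (simp add: powr_diff powr_realpow)
    also have "\<dots> \<le> \<epsilon> * M ^ m" using i M by (intro mult_right_mono) (auto simp: M_def)
    finally have 1: "M ^ l \<le> \<epsilon> * M ^ m" .
    \<comment> \<open>Lowering by \<open>m\<close> and raising again returns to \<open>n\<close>
      because \<open>m \<le> n i\<close> rules out truncation.\<close>
    have "(n(i := n i - m))(i := (n(i := n i - m)) i + m) = n" using i by auto
    then have "Wc i (n(i := n i - m)) = a i ^ m * pochhammer (real (Suc (n i - m))) m * (c n)\<^sup>2"
      unfolding Wc by simp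
    moreover have "(M / real m) ^ m \<le> pochhammer (real (Suc (n i - m))) m"
      using power_le_pochhammer[of "n i - m" m] i by (simp add: M_def)
    ultimately have 2: "a i ^ m * (M / real m) ^ m * (c n)\<^sup>2 \<le> Wc i (n(i := n i - m))"
      using a[of i] by (simp add: mult_left_mono mult_right_mono)
    have "a j ^ l * M ^ l * (c n)\<^sup>2 \<le> a j ^ l * (\<epsilon> * M ^ m) * (c n)\<^sup>2"
      using 1 a[of j] by (intro mult_right_mono mult_left_mono) auto
    also have "\<dots> = (real m ^ m * a j ^ l * (1 / a i ^ m)) * \<epsilon> * (a i ^ m * (M / real m) ^ m * (c n)\<^sup>2)"
      using m a[of i] by (simp add: power_divide)
    also have "\<dots> \<le> A * \<epsilon> * Wc i (n(i := n i - m))"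
    proof (rule mult_mono[OF mult_right_mono 2])
      have "a j ^ l \<le> (\<Sum>j\<in>UNIV. a j ^ l)" using a by (intro member_le_sum) (auto simp: less_imp_le)
      moreover have "1 / a i ^ m \<le> (\<Sum>i\<in>UNIV. 1 / a i ^ m)" using a by (intro member_le_sum) (auto simp: less_imp_le)
      ultimately have "real m ^ m * a j ^ l * (1 / a i ^ m) \<le> real m ^ m * (\<Sum>j\<in>UNIV. a j ^ l) * (\<Sum>i\<in>UNIV. 1 / a i ^ m)"
        using a by (intro mult_mono mult_nonneg_nonneg sum_nonneg order_refl) (auto simp: less_imp_le)
      then show "real m ^ m * a j ^ l * (1 / a i ^ m) \<le> A" by (simp add: A a_def)
    qed (use \<epsilon> A0 a[of i] M in auto)
    finally show ?thesis by (simp add: M_def)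
  qed
  \<comment> \<open>The maximal coordinate varies with the index. Summing over all admissible
    \<open>i\<close> removes this dependence, so that the sums over \<open>n\<close> and
    \<open>i\<close> can be exchanged.\<close>
  have termwise: "V j n \<le> A * \<epsilon> * (\<Sum>i | m \<le> (n(j := n j + l)) i. Wc i ((n(j := n j + l))(i := (n(j := n j + l)) i - m)))" for j n
  proof -
    define n' where "n' = n(j := n j + l)"
    have "V j n \<le> A * \<epsilon> * (\<Sum>i | m \<le> n' i. Wc i (n'(i := n' i - m)))"
    proof (cases "n' \<in> S")
      case True
      then have "V j n = 0" unfolding V n'_def[symmetric] by simp
      then show ?thesis using A0 \<epsilon> Wc0 by (simp add: sum_nonneg)
    next
      case False
      obtain i where i: "\<And>j. n' j \<le> n' i" "m \<le> n' i" "real (n' i) powr (real l - real m) \<le> \<epsilon>" using out[OF False] by blast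
      have "pochhammer (real (Suc (n j))) l \<le> real (n j + l) ^ l" by (rule pochhammer_le_power)
      also have "\<dots> \<le> real (n' i) ^ l" using i(1)[of j] by (intro power_mono) (auto simp: n'_def)
      finally have "V j n \<le> a j ^ l * real (n' i) ^ l * (c n')\<^sup>2"
        unfolding V n'_def[symmetric] using False a[of j] by (simp add: mult_left_mono mult_right_mono)
      also have "\<dots> \<le> A * \<epsilon> * Wc i (n'(i := n' i - m))" by (rule single[of n' i j, OF i(2,3)])
      also have "\<dots> \<le> A * \<epsilon> * (\<Sum>i | m \<le> n' i. Wc i (n'(i := n' i - m)))"
        using i(2) A0 \<epsilon> Wc0 by (intro mult_left_mono member_le_sum) auto
      finally show ?thesis .
    qed
    then show ?thesis unfolding n'_def .
  qed
  have vle: "(LBINT x. (v j x)\<^sup>2) \<le> A * \<epsilon> * (\<Sum>i\<in>UNIV. LBINT x. (w i x)\<^sup>2)" for j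
  proof (rule hermite_parseval_bound[OF \<alpha> vL2])
    fix F :: "('n \<Rightarrow> nat) set" assume F: "finite F"
    define up where "up = (\<lambda>n. n(j := n j + l))"
    define shift where "shift = (\<lambda>i n. (up n)(i := up n i - m))"
    have "(\<Sum>n\<in>F. V j n) \<le> (\<Sum>n\<in>F. A * \<epsilon> * (\<Sum>i | m \<le> up n i. Wc i (shift i n)))"
      unfolding shift_def up_def by (intro sum_mono termwise)
    also have "\<dots> = A * \<epsilon> * (\<Sum>n\<in>F. \<Sum>i\<in>UNIV. if m \<le> up n i then Wc i (shift i n) else 0)"
      by (simp add: sum_distrib_left[symmetric] sum.inter_filter[of UNIV, simplified])
    also have "(\<Sum>n\<in>F. \<Sum>i\<in>UNIV. if m \<le> up n i then Wc i (shift i n) else 0) =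
        (\<Sum>i\<in>UNIV. \<Sum>n\<in>F. if m \<le> up n i then Wc i (shift i n) else 0)"
      by (rule sum.swap)
    also have "\<dots> \<le> (\<Sum>i\<in>UNIV. LBINT x. (w i x)\<^sup>2)"
    proof (rule sum_mono)
      fix i
      let ?F = "{n \<in> F. m \<le> up n i}"
      \<comment> \<open>Both shifts are reversible where \<open>m \<le> up n i\<close>, so no
        coefficient of \<open>w i\<close> is charged twice and Bessel applies.\<close>
      have inj: "inj_on (shift i) ?F"
      proof (rule inj_onI)
        fix p q assume pq: "p \<in> ?F" "q \<in> ?F" "shift i p = shift i q"
        have "up p k = up q k" for k
          using fun_cong[OF pq(3), of k] pq(1,2) by (cases "k = i") (auto simp: shift_def)
        then have "p k = q k" for k by (cases "k = j") (auto simp: up_def dest: meta_spec[of _ k])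
        then show "p = q" by auto
      qed
      have "(\<Sum>n\<in>F. if m \<le> up n i then Wc i (shift i n) else 0) = (\<Sum>n\<in>?F. Wc i (shift i n))"
        by (rule sum.inter_filter[OF F, symmetric])
      also have "\<dots> = (\<Sum>n\<in>shift i ` ?F. Wc i n)" by (simp add: sum.reindex[OF inj])
      also have "\<dots> \<le> (LBINT x. (w i x)\<^sup>2)"
        unfolding Wc_def using F by (intro hermite_bessel[OF \<alpha> _ wL2]) simp
      finally show "(\<Sum>n\<in>F. if m \<le> up n i then Wc i (shift i n) else 0) \<le> (LBINT x. (w i x)\<^sup>2)" .
    qed
    finally show "(\<Sum>n\<in>F. (LBINT x. v j x * ?H n x)\<^sup>2) \<le> A * \<epsilon> * (\<Sum>i\<in>UNIV. LBINT x. (w i x)\<^sup>2)"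
      using A0 \<epsilon> by (simp add: V_def mult_left_mono)
  qed
  have K: "(\<Sum>i\<in>UNIV. LBINT x. (w i x)\<^sup>2) \<le> (K_seminorm \<alpha> \<beta> m u)\<^sup>2"
    by (rule K_seminorm_ge[OF m L2_herm_deriv_pow_imp[OF w]])
  have K0: "K_seminorm \<alpha> \<beta> m u \<ge> 0" by (simp add: K_seminorm_def sum_nonneg)
  have "(\<Sum>j\<in>UNIV. (L2_norm_of (herm_deriv \<alpha> \<beta> j ^^ l) (\<lambda>x. u x - ?U x))\<^sup>2) = (\<Sum>j\<in>UNIV. LBINT x. (v j x)\<^sup>2)"
    using L2_norm_of_herm_deriv_pow[OF L2_herm_deriv_pow_imp[OF v]] by simp
  also have "\<dots> \<le> (\<Sum>j\<in>(UNIV :: 'n set). A * \<epsilon> * (K_seminorm \<alpha> \<beta> m u)\<^sup>2)"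
    using vle K A0 \<epsilon> by (intro sum_mono) (meson mult_left_mono mult_nonneg_nonneg order_trans)
  also have "\<dots> = (real CARD('n) * A * \<epsilon>) * (K_seminorm \<alpha> \<beta> m u)\<^sup>2" by simp
  finally have "W_seminorm \<alpha> \<beta> l (\<lambda>x. u x - ?U x) \<le> sqrt ((real CARD('n) * A * \<epsilon>) * (K_seminorm \<alpha> \<beta> m u)\<^sup>2)"
    unfolding W_seminorm_def by (rule real_sqrt_le_mono)
  then show ?thesis using K0 by (simp add: real_sqrt_mult)
qed

theorem theorem1p2:
  fixes d1 l m :: nat and \<gamma> :: real and \<alpha> :: "real ^ 'n::{finite,linorder}"
  assumes "1 \<le> d1" and "d1 < CARD('n)"
    and "\<gamma> < 1"
    and "\<forall>j. 0 < \<alpha> $ j"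
    and "0 < l" and "l \<le> m"
  shows "\<exists>C>0. \<exists>N0::nat. \<forall>\<beta> :: real ^ 'n::{finite,linorder}. \<forall>N1\<ge>N0. \<forall>N2\<ge>N0. \<forall>u \<in> K_space \<alpha> \<beta> m.
    (INF U \<in> adaptive_space \<alpha> \<beta> d1 \<gamma> N1 N2. W_seminorm \<alpha> \<beta> l (\<lambda>x. u x - U x))
      \<le> C * (Max (range (\<lambda>j. \<alpha> $ j))) powr (real l - real m)
          * (real N1 powr (real l - real m)
             + real N2 powr ((1 - \<gamma>) / (real CARD('n) - real d1 - \<gamma>) * (real l - real m))) powr (1/2)
          * K_seminorm \<alpha> \<beta> m u"
proof -
  define \<theta> where "\<theta> = (1 - \<gamma>) / (real CARD('n) - real d1 - \<gamma>)"
  have \<theta>: "\<theta> > 0" using assms(2,3) unfolding \<theta>_def by (intro divide_pos_pos) (auto simp: less_diff_conv)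
  define A where "A = real m ^ m * (\<Sum>j\<in>UNIV. (2 * (\<alpha> $ j)\<^sup>2) ^ l) * (\<Sum>i\<in>UNIV. 1 / (2 * (\<alpha> $ i)\<^sup>2) ^ m)"
  have \<alpha>0: "0 < 2 * (\<alpha> $ j)\<^sup>2" for j using assms(4) by (simp add: less_imp_neq[symmetric])
  have A: "A > 0"
    unfolding A_def using assms(5,6) \<alpha>0 by (intro mult_pos_pos sum_pos) auto
  define \<mu> where "\<mu> = Max (range (\<lambda>j. \<alpha> $ j))"
  have "\<mu> \<in> range (\<lambda>j. \<alpha> $ j)" unfolding \<mu>_def by (intro Max_in) auto
  then have \<mu>: "\<mu> > 0" using assms(4) by auto
  \<comment> \<open>The power of \<open>\<mu>\<close> is inverse to the one in the claim; the
    constant may depend on alpha.\<close>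
  define C where "C = sqrt (real CARD('n) * A) * \<mu> powr (real m - real l)"
  have C: "C > 0" unfolding C_def using A \<mu> by simp
  have C\<mu>: "C * \<mu> powr (real l - real m) = sqrt (real CARD('n) * A)"
    unfolding C_def using \<mu> by (simp add: mult.assoc flip: powr_add)
  \<comment> \<open>Chosen so that N_1 >= m and N_2^theta >= m. Any index outside the set then has
    maximal entry at least \<open>m\<close> and can be lowered by \<open>m\<close>.\<close>
  obtain N0 :: nat where N0: "real m + real m powr (1 / \<theta>) \<le> real N0" using real_arch_simple by blast
  show ?thesis
  proof (intro exI[of _ C] exI[of _ N0] conjI C allI impI ballI)
    fix \<beta> :: "real^'n::{finite,linorder}" and N1 N2 u assume N1: "N0 \<le> N1" and N2: "N0 \<le> N2" and u: "u \<in> K_space \<alpha> \<beta> m"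
    \<comment> \<open>The sum dominates either term, and which of the two thresholds is exceeded
      depends on the index.\<close>
    define \<epsilon> where "\<epsilon> = real N1 powr (real l - real m) + real N2 powr (\<theta> * (real l - real m))"
    define S where "S = (adaptive_index_set d1 \<gamma> N1 N2 :: ('n \<Rightarrow> nat) set)"
    have S: "finite S" unfolding S_def by (rule adaptive_index_set_finite[OF assms(1-3)])
    define c where "c = (\<lambda>n. LBINT x. u x * hermite_tensor \<alpha> \<beta> n x)"
    define U where "U = (\<lambda>x. \<Sum>n\<in>S. c n * hermite_tensor \<alpha> \<beta> n x)"
    have m1: "real m \<ge> 1" using assms(5,6) by simp
    have N1m: "real m \<le> real N1" using N0 N1 powr_ge_zero[of "real m" "1 / \<theta>"] by linarith
    have N2p: "real N2 > 0" using N0 N2 m1 powr_ge_zero[of "real m" "1 / \<theta>"] by linarith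
    have N2m: "real m \<le> real N2 powr \<theta>"
    proof -
      have "real m = (real m powr (1 / \<theta>)) powr \<theta>" using \<theta> m1 by (simp add: powr_powr)
      also have "\<dots> \<le> real N2 powr \<theta>" using N0 N2 \<theta> by (intro powr_mono2) auto
      finally show ?thesis .
    qed
    have out: "\<exists>i. (\<forall>j. n j \<le> n i) \<and> m \<le> n i \<and> real (n i) powr (real l - real m) \<le> \<epsilon>" if n: "n \<notin> S" for n
    proof -
      obtain i where i: "\<And>j. n j \<le> n i" using mi_inf_attained[of "UNIV :: 'n set" n] by (metis UNIV_I finite UNIV_not_empty)
      have neg: "real l - real m \<le> 0" using assms(6) by simp
      obtain k where "real N1 < real (n k) \<or> real N2 powr \<theta> < real (n k)"
        using not_in_adaptive_index_set[OF assms(1-3) n[unfolded S_def]] unfolding \<theta>_def by blast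
      \<comment> \<open>The threshold is exceeded at some coordinate \<open>k\<close> of one block;
        the overall maximum \<open>i\<close> inherits it.\<close>
      then have "real N1 < real (n i) \<or> real N2 powr \<theta> < real (n i)"
        using i[of k] by (metis of_nat_le_iff order_less_le_trans)
      then show ?thesis
      proof
        assume h: "real N1 < real (n i)"
        have "real (n i) powr (real l - real m) \<le> real N1 powr (real l - real m)"
          using h N1m m1 neg by (intro powr_mono2') auto
        also have "\<dots> \<le> \<epsilon>" unfolding \<epsilon>_def by simp
        finally show ?thesis using i h N1m by (intro exI[of _ i]) auto
      next
        assume h: "real N2 powr \<theta> < real (n i)"
        have "real (n i) powr (real l - real m) \<le> (real N2 powr \<theta>) powr (real l - real m)"
          using h N2p neg by (intro powr_mono2') auto
        also have "\<dots> \<le> \<epsilon>" unfolding \<epsilon>_def by (simp add: powr_powr)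
        finally show ?thesis using i h N2m by (intro exI[of _ i]) auto
      qed
    qed
    have \<epsilon>: "\<epsilon> \<ge> 0" unfolding \<epsilon>_def by simp
    have main: "W_seminorm \<alpha> \<beta> l (\<lambda>x. u x - U x) \<le> sqrt (real CARD('n) * A * \<epsilon>) * K_seminorm \<alpha> \<beta> m u"
      unfolding U_def by (rule hermite_projection_error[OF assms(4-6) u S \<epsilon> out]) (simp_all add: c_def A_def)
    have "U \<in> adaptive_space \<alpha> \<beta> d1 \<gamma> N1 N2"
      unfolding adaptive_space_def U_def using S by (auto simp: S_def)
    \<comment> \<open>A real infimum lies below a given value only for sets bounded below; seminorms
      are nonnegative.\<close>
    moreover have "bdd_below ((\<lambda>U. W_seminorm \<alpha> \<beta> l (\<lambda>x. u x - U x)) ` adaptive_space \<alpha> \<beta> d1 \<gamma> N1 N2)"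
      by (rule bdd_belowI2[of _ 0]) (simp add: W_seminorm_def sum_nonneg)
    ultimately have "(INF U \<in> adaptive_space \<alpha> \<beta> d1 \<gamma> N1 N2. W_seminorm \<alpha> \<beta> l (\<lambda>x. u x - U x)) \<le> sqrt (real CARD('n) * A * \<epsilon>) * K_seminorm \<alpha> \<beta> m u"
      using main by (intro cINF_lower2)
    also have "sqrt (real CARD('n) * A * \<epsilon>) = C * \<mu> powr (real l - real m) * \<epsilon> powr (1/2)"
      unfolding C\<mu> powr_half_sqrt[OF \<epsilon>] by (rule real_sqrt_mult)
    finally show "(INF U \<in> adaptive_space \<alpha> \<beta> d1 \<gamma> N1 N2. W_seminorm \<alpha> \<beta> l (\<lambda>x. u x - U x))
      \<le> C * (Max (range (\<lambda>j. \<alpha> $ j))) powr (real l - real m)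
          * (real N1 powr (real l - real m)
             + real N2 powr ((1 - \<gamma>) / (real CARD('n) - real d1 - \<gamma>) * (real l - real m))) powr (1/2)
          * K_seminorm \<alpha> \<beta> m u"
      unfolding \<epsilon>_def \<mu>_def \<theta>_def .
  qed
qed

end
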